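(* For every $\lambda\in\mathbb{R}$ the image of $\widehat\Psi_\lambda:(\widehat\eta_\lambda,\infty)\to\mathbb{R}$ is an open interval $I_\lambda$. Consequently, for any rational number $q=m/n$ such that $2\pi q\in I_\lambda$ and every $\xi\in\widehat\Psi_\lambda^{-1}(2\pi q)$, the curve $\gamma_\xi$ is a B-string with multiplier $\lambda$ and characteristic number $q$.
   Context: $\mathbb{S}^2\subset\mathbb{R}^3$ is the unit sphere. For an arc-length parameterized curve $\gamma$ in $\mathbb{S}^2$ the signed geodesic curvature $\kappa$ is defined by $\nabla_TT=\kappa N$, $T=\dot\gamma$, $N=\gamma\times\dot\gamma$. A B-curve with multiplier $\lambda$ is an arc-length parameterized curve $\gamma:\mathbb{R}\to\mathbb{S}^2$ with positive, non-constant, periodic curvature $\kappa$ such that $\mu=\sqrt{\kappa}$ satisfies, for some constant $\xi>0$, $$\dot\mu^2=-\mu^2Q(\mu),\qquad Q(t)=t^4+4\lambda t^3+4(\lambda^2-\xi^2)t^2+1.\qquad( * )$$ (These are the critical curves with non-constant curvature of $\int(\sqrt{|\kappa|}+\lambda)ds$.) A B-string is a periodic B-curve. Fix $\lambda\in\mathbb{R}$. Let $\eta_\lambda$ be the unique positive root of $t^4+2\lambda t^3-1$ and $\widehat\eta_\lambda=\frac{1}{2\eta_\lambda}\sqrt{1+(\eta_\lambda(\eta_\lambda+2\lambda))^2}$. For $\xi>\widehat\eta_\lambda$, $Q$ has exactly two positive roots $e_1>e_2>0$, and $( * )$ has a non-constant positive periodic smooth solution $\mu$ on $\mathbb{R}$,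 with least period $\omega$, minimum $e_2$ and maximum $e_1$, unique up to translation of $s$; normalize it by $\mu(\omega/2)=e_1$. Set $$\theta(s)=2\xi\int_{\omega/2}^s\frac{\mu^2(\mu+2\lambda)}{1-4\xi^2\mu^2}\,dt,\qquad \gamma_\xi(s)=\frac{1}{2\xi\mu}\left(1,-\sigma\sqrt{4\xi^2\mu^2-1}\cos\theta,\sigma\sqrt{4\xi^2\mu^2-1}\sin\theta\right),$$ where $\sigma\equiv1$ if $4\lambda\xi+1\ne0$, and if $4\lambda\xi+1=0$ then $\sigma=1$ on $[2k\omega,(2k+1)\omega)$ and $\sigma=-1$ on $[(2k+1)\omega,(2k+2)\omega)$, $k\in\mathbb{Z}$ (in this case the integrand is extended by continuity across its removable singularities). Then $\gamma_\xi$ is a B-curve with multiplier $\lambda$ and every B-curve with multiplier $\lambda$ coincides with some $\gamma_\xi$ up to a rigid motion and a translation of $s$. Put $\Psi_\lambda(\xi)=2\xi\int_0^\omega\frac{\mu^2(\mu+2\lambda)}{1-4\xi^2\mu^2}\,ds$. This function has a jump at $\xi=-1/(4\lambda)$ when $\lambda<0$; its continuous regularization is $$\widehat\Psi_\lambda(\xi)=\begin{cases}\Psi_\lambda(\xi)+2\pi,&4\lambda\xi+1>0,\\ \Psi_\lambda(\xi)+\pi,&4\lambda\xi+1=0,\\ \Psi_\lambda(\xi),&4\lambda\xi+1<0.\end{cases}$$ If $\widehat\Psi_\lambda(\xi)=2\pi q$ with $q=m/n\in\mathbb{Q}$, $\gcd(m,n)=1$, then $q$ is called the characteristic number of $\gamma_\xi$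 and $n$ its wave number. *)

theory Defs
  imports "HOL-Analysis.Analysis"
begin

section \<open>Curves in the unit sphere\<close>

definition smooth :: "(real \<Rightarrow> 'a::real_normed_vector) \<Rightarrow> bool" where
  "smooth f \<longleftrightarrow>
    (\<forall>k s. ((\<lambda>g t. vector_derivative g (at t)) ^^ k) f differentiable (at s))"

definition periodic :: "(real \<Rightarrow> 'a) \<Rightarrow> bool" where
  "periodic f \<longleftrightarrow> (\<exists>p>0. \<forall>s. f (s + p) = f s)"

definition least_period :: "(real \<Rightarrow> 'a) \<Rightarrow> real \<Rightarrow> bool" where
  "least_period f p \<longleftrightarrow>
    0 < p \<and> (\<forall>s. f (s + p) = f s) \<and>
    (\<forall>p'. 0 < p' \<and> (\<forall>s. f (s + p') = f s) \<longrightarrow> p \<le> p')"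

definition velocity :: "(real \<Rightarrow> real^3) \<Rightarrow> real \<Rightarrow> real^3" where
  "velocity c s = vector_derivative c (at s)"

definition unit_normal :: "(real \<Rightarrow> real^3) \<Rightarrow> real \<Rightarrow> real^3" where
  "unit_normal c s = cross3 (c s) (velocity c s)"

definition arclength_curve_in_sphere :: "(real \<Rightarrow> real^3) \<Rightarrow> bool" where
  "arclength_curve_in_sphere c \<longleftrightarrow>
    smooth c \<and> (\<forall>s. norm (c s) = 1) \<and> (\<forall>s. norm (velocity c s) = 1)"

text \<open>The Levi-Civita connection of the sphere is the tangential part of the Euclidean
  derivative, that is, its projection to the orthogonal complement of the position vector.\<close>

definition covariant_acceleration :: "(real \<Rightarrow> real^3) \<Rightarrow> real \<Rightarrow> real^3" where
  "covariant_acceleration c s =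
    (let a = vector_derivative (velocity c) (at s) in a - (a \<bullet> c s) *\<^sub>R c s)"

definition has_geodesic_curvature :: "(real \<Rightarrow> real^3) \<Rightarrow> (real \<Rightarrow> real) \<Rightarrow> bool" where
  "has_geodesic_curvature c \<kappa> \<longleftrightarrow>
    (\<forall>s. covariant_acceleration c s = \<kappa> s *\<^sub>R unit_normal c s)"


section \<open>B-curves and B-strings\<close>

definition Q :: "real \<Rightarrow> real \<Rightarrow> real \<Rightarrow> real" where
  "Q lam \<xi> t = t^4 + 4 * lam * t^3 + 4 * (lam^2 - \<xi>^2) * t^2 + 1"

definition solves_Q_equation :: "real \<Rightarrow> real \<Rightarrow> (real \<Rightarrow> real) \<Rightarrow> bool" where
  "solves_Q_equation lam \<xi> u \<longleftrightarrow>
    (\<forall>s. (u has_real_derivative deriv u s) (at s) \<and>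
         (deriv u s)^2 = - ((u s)^2 * Q lam \<xi> (u s)))"

definition B_curve :: "real \<Rightarrow> (real \<Rightarrow> real^3) \<Rightarrow> bool" where
  "B_curve lam c \<longleftrightarrow>
    arclength_curve_in_sphere c \<and>
    (\<exists>\<kappa>. has_geodesic_curvature c \<kappa> \<and>
         (\<forall>s. 0 < \<kappa> s) \<and> \<not> \<kappa> constant_on UNIV \<and> periodic \<kappa> \<and>
         (\<exists>\<xi>>0. solves_Q_equation lam \<xi> (\<lambda>s. sqrt (\<kappa> s))))"

definition B_string :: "real \<Rightarrow> (real \<Rightarrow> real^3) \<Rightarrow> bool" where
  "B_string lam c \<longleftrightarrow> B_curve lam c \<and> periodic c"


section \<open>The standard B-curves\<close>

definition eta :: "real \<Rightarrow> real" where
  "eta lam = (THE t. 0 < t \<and> t^4 + 2 * lam * t^3 - 1 = 0)"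

definition eta_hat :: "real \<Rightarrow> real" where
  "eta_hat lam = 1 / (2 * eta lam) * sqrt (1 + (eta lam * (eta lam + 2 * lam))^2)"

definition e1 :: "real \<Rightarrow> real \<Rightarrow> real" where
  "e1 lam \<xi> = Max {t. 0 < t \<and> Q lam \<xi> t = 0}"

definition e2 :: "real \<Rightarrow> real \<Rightarrow> real" where
  "e2 lam \<xi> = Min {t. 0 < t \<and> Q lam \<xi> t = 0}"

text \<open>For \<open>\<xi> > eta_hat lam\<close> exactly one \<open>u\<close> satisfies the following predicate. Smoothness is
  essential for this: a solution that is merely once differentiable can rest at
  \<open>e1\<close> or \<open>e2\<close> for any length of time.\<close>

definition normalized_solution :: "real \<Rightarrow> real \<Rightarrow> (real \<Rightarrow> real) \<Rightarrow> bool" where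
  "normalized_solution lam \<xi> u \<longleftrightarrow>
    smooth u \<and> (\<forall>s. 0 < u s) \<and> \<not> u constant_on UNIV \<and>
    solves_Q_equation lam \<xi> u \<and>
    (\<forall>s. e2 lam \<xi> \<le> u s \<and> u s \<le> e1 lam \<xi>) \<and> e2 lam \<xi> \<in> range u \<and> e1 lam \<xi> \<in> range u \<and>
    (\<exists>w. least_period u w \<and> u (w / 2) = e1 lam \<xi>)"

definition mu :: "real \<Rightarrow> real \<Rightarrow> real \<Rightarrow> real" where
  "mu lam \<xi> = (SOME u. normalized_solution lam \<xi> u)"

definition omega :: "real \<Rightarrow> real \<Rightarrow> real" where
  "omega lam \<xi> = (THE w. least_period (mu lam \<xi>) w)"

text \<open>The denominator vanishes only if \<open>4 * lam * \<xi> + 1 = 0\<close>, and then exactly where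
  \<open>mu lam \<xi> s = e2 lam \<xi> = - 2 * lam\<close>; there the quotient is extended by continuity.\<close>

definition angular_speed :: "real \<Rightarrow> real \<Rightarrow> real \<Rightarrow> real" where
  "angular_speed lam \<xi> s =
    (let f = (\<lambda>t. (mu lam \<xi> t)^2 * (mu lam \<xi> t + 2 * lam) / (1 - 4 * \<xi>^2 * (mu lam \<xi> t)^2))
     in if 1 - 4 * \<xi>^2 * (mu lam \<xi> s)^2 = 0 then Lim (at s) f else f s)"

definition theta :: "real \<Rightarrow> real \<Rightarrow> real \<Rightarrow> real" where
  "theta lam \<xi> s = 2 * \<xi> * (LBINT t=ereal (omega lam \<xi> / 2)..ereal s. angular_speed lam \<xi> t)"

definition sigma :: "real \<Rightarrow> real \<Rightarrow> real \<Rightarrow> real" where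
  "sigma lam \<xi> s =
    (if 4 * lam * \<xi> + 1 \<noteq> 0 then 1
     else if \<exists>k::int. 2 * k * omega lam \<xi> \<le> s \<and> s < (2 * k + 1) * omega lam \<xi> then 1
     else - 1)"

definition gamma_curve :: "real \<Rightarrow> real \<Rightarrow> real \<Rightarrow> real^3" where
  "gamma_curve lam \<xi> s =
    (let m = mu lam \<xi> s; r = sigma lam \<xi> s * sqrt (4 * \<xi>^2 * m^2 - 1)
     in (1 / (2 * \<xi> * m)) *\<^sub>R
          vector [1, - r * cos (theta lam \<xi> s), r * sin (theta lam \<xi> s)])"


section \<open>The period map and characteristic numbers\<close>

definition Psi :: "real \<Rightarrow> real \<Rightarrow> real" where
  "Psi lam \<xi> = 2 * \<xi> * (LBINT s=ereal 0..ereal (omega lam \<xi>). angular_speed lam \<xi> s)"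

definition Psi_hat :: "real \<Rightarrow> real \<Rightarrow> real" where
  "Psi_hat lam \<xi> =
    (if 4 * lam * \<xi> + 1 > 0 then Psi lam \<xi> + 2 * pi
     else if 4 * lam * \<xi> + 1 = 0 then Psi lam \<xi> + pi
     else Psi lam \<xi>)"

definition has_characteristic_number :: "real \<Rightarrow> (real \<Rightarrow> real^3) \<Rightarrow> rat \<Rightarrow> bool" where
  "has_characteristic_number lam c q \<longleftrightarrow>
    (\<exists>\<xi>>eta_hat lam. c = gamma_curve lam \<xi> \<and> Psi_hat lam \<xi> = 2 * pi * of_rat q)"

end

theory Submission
  imports Defs
begin

text \<open>Put \<open>X = 1/mu\<close>, \<open>Y = mu + 2 * lam\<close> and \<open>r = 4 * \<xi>^2\<close>. A solution of the equation for \<open>mu\<close> runs along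
  the curve \<open>X * (Y - 2 * lam) = 1\<close> on the sphere of radius \<open>2 * \<xi>\<close>, and \<open>Psi\<close> is the period of an
  angle form about the \<open>X\<close>-axis, which has poles. The sum of this form and the analogous form about
  the \<open>Y\<close>-axis is the differential of an angle whose variation is \<open>0\<close>, \<open>pi\<close> or \<open>2 * pi\<close> according to the sign of
  \<open>4 * lam * \<xi> + 1\<close>. This variation is exactly what \<open>Psi_hat\<close> corrects for, so that \<open>Psi_hat = 2 * pi - H\<close>
  with \<open>H\<close> the integral of the positive form \<open>2 * \<xi> * dmu / ((r - Y^2) * sqrt (- Q mu))\<close> over one period.

  For fixed \<open>lam\<close> the number \<open>y = e1 + e2 + 2 * lam\<close> ranges over an open half-line, and \<open>\<xi>\<close>, \<open>e1\<close>, \<open>e2\<close> are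
  explicit functions of it; with \<open>mu = (e1 + e2)/2 - (e1 - e2)/2 * cos x\<close> the integrand of \<open>H\<close>
  becomes smooth in \<open>(y, x)\<close>. Its \<open>y\<close>-derivative is, up to an explicit \<open>x\<close>-derivative of a function vanishing
  at \<open>0\<close> and \<open>pi\<close>, strictly negative. Hence \<open>H\<close> is strictly decreasing and the image is an open interval.\<close>

section \<open>A certificate for the derivative of the period\<close>

text \<open>That the image is an interval is only continuity; openness is the real claim, since it
  forbids an extremum attained inside. Strict monotonicity settles it without any limit of the
  period at the ends of the parameter range. Two derivatives of \<open>H\<close> compete.
  Differentiating at fixed phase \<open>x\<close> keeps the limits of integration fixed and the
  integrand bounded, but its sign is opaque. Letting \<open>Y\<close> scale with the radius leaves
  \<open>2*xi*dY/(r - Y^2)\<close> invariant, so that only \<open>P\<close> varies and the short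
  density \<open>- 4*t*(t + lam)\<close> appears, but with the non-integrable factor
  \<open>P powr (-3/2)\<close>. The two differ by the velocity they give to \<open>t\<close>, and
  changing a velocity changes the integrand by an exact term. The correction \<open>g*D/2\<close> of
  the scaling velocity makes it carry roots of \<open>P\<close> to roots, as the fixed-phase
  velocity does; then the difference is divisible by \<open>w\<close>, the exact term is smooth in
  \<open>x\<close> and vanishes at both ends, and the constants are forced by this divisibility and
  by the sign of the remainder. The other obstacle is \<open>4*lam*xi + 1 = 0\<close>, where the
  curve runs through a pole of the sphere.\<close>

text \<open>Let \<open>s = e1 + e2\<close>, \<open>p = e1 * e2\<close>, \<open>w t = (e1 - t) * (t - e2)\<close>, \<open>S = t^2 + s*t/p^2 + 1/p\<close>, so that
  \<open>P = w * S = - Q\<close>. The derivative of \<open>H\<close> with respect to the radius \<open>2 * \<xi>\<close> is the finite part of the integral of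
  \<open>- 4 * t * (t + lam) * P powr (-3/2)\<close>. Adding the derivative of \<open>g * P powr (-1/2)\<close>, where the quadratic
  polynomial \<open>g\<close> cancels the singular parts at both roots and makes the remainder \<open>M/S\<close> take the same value
  at both roots, leaves the integrand \<open>M/S * P powr (-1/2)\<close>. Up to powers of \<open>p\<close>, \<open>nu\<close> and
  \<open>s^2 - 4*p\<close> in the denominators, \<open>alpha\<close>, \<open>beta\<close> and \<open>kappa\<close> are the coefficients of \<open>g = alpha * t + beta + kappa * w\<close>, and
  \<open>const\<close> and \<open>tau\<close> those of \<open>M = const * S + tau * w\<close>.\<close>

definition cert_nu :: "real \<Rightarrow> real \<Rightarrow> real" where
  "cert_nu s p = p^2 - 2*p^4 + p^6 + 2* s^2*p + 2* s^2*p^3"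
definition cert_alpha :: "real \<Rightarrow> real \<Rightarrow> real" where
  "cert_alpha s p = - 16*p^4 + 16*p^6 + 6* s^2*p + 12* s^2*p^3 - 2* s^2*p^5"
definition cert_beta :: "real \<Rightarrow> real \<Rightarrow> real" where
  "cert_beta s p = - 4* s*p^2 - 16* s*p^4 - 12* s*p^6 - 2* s^3*p + 2* s^3*p^5"
definition cert_kappa :: "real \<Rightarrow> real \<Rightarrow> real" where
  "cert_kappa s p = 32* s*p^5 + 48* s*p^7 - 64* s*p^9 - 16* s*p^11 - 9* s^3*p^2 - 32* s^3*p^4 - 34* s^3*p^6 + 8* s^3*p^8 + 3* s^3*p^10"
definition cert_const :: "real \<Rightarrow> real \<Rightarrow> real" where
  "cert_const s p = 4*p^5 - 4*p^7 - 4*p^9 + 4*p^11 - 3/2* s^2*p^2 - 6* s^2*p^4 - 17* s^2*p^6 - 6* s^2*p^8 - 3/2* s^2*p^10"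
definition cert_tau :: "real \<Rightarrow> real \<Rightarrow> real" where
  "cert_tau s p = -32*p^8 + 64*p^10 - 32*p^12 + 28* s^2*p^5 + 36* s^2*p^7 + 36* s^2*p^9 + 28* s^2*p^11
     - 9/2* s^4*p^2 - 10* s^4*p^4 - 3* s^4*p^6 - 10* s^4*p^8 - 9/2* s^4*p^10"

text \<open>As \<open>(g * P powr (-1/2))' = (g'*P - g*P'/2) * P powr (-3/2)\<close>, the claim of
  the paragraph above is \<open>N + g'*P - g*P'/2 = M*w\<close> with
  \<open>N = - 4*t*(t + lam)\<close>. Inserting \<open>4*lam = s/p^2 - s\<close> and multiplying by
  \<open>p^2 * de * nu^2\<close> leaves a polynomial identity.\<close>

lemma certificate_identity:
  fixes s p t :: real
  defines "w \<equiv> s*t - t^2 - p" and "S1 \<equiv> p^2*t^2 + s*t + p" and "de \<equiv> s^2 - 4*p"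
  shows "(- 4*p^2*t^2 - s*(1-p^2)*t) * de * (cert_nu s p)^2
     + (cert_alpha s p * cert_nu s p + cert_kappa s p * (s - 2*t)) * w * S1
     - (1/2) * ((cert_alpha s p * t + cert_beta s p) * cert_nu s p + cert_kappa s p * w) * ((s - 2*t) * S1 + w * (2*p^2*t + s))
     = (cert_const s p * de * S1 + cert_tau s p * w) * w"
  unfolding assms cert_nu_def cert_alpha_def cert_beta_def cert_kappa_def cert_const_def cert_tau_def
  by algebra


lemma cert_nu_pos: "0 < p \<Longrightarrow> 0 < s \<Longrightarrow> 0 < cert_nu s p"
proof -
  assume "0 < p" "0 < s"
  moreover have "cert_nu s p = p^2 * (1 - p^2)^2 + 2 * s^2 * p + 2 * s^2 * p^3"
    unfolding cert_nu_def by algebra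
  ultimately show ?thesis by (simp add: add_nonneg_pos)
qed

text \<open>Between the roots \<open>w >= 0\<close> gives \<open>s*t >= p\<close>, so the cofactor
  of \<open>const\<close> is at least \<open>2*p\<close>, while \<open>w\<close> is at most
  \<open>(s^2 - 4*p)/4\<close>, its value at \<open>t = s/2\<close>. Since \<open>const\<close> is
  negative, the case of positive \<open>tau\<close> reduces to \<open>2*p*const + tau/4 < 0\<close>,
  where trading \<open>s^2\<close> for \<open>4*p\<close> absorbs the positive monomials.\<close>

lemma certificate_negative:
  fixes s p t :: real
  assumes p: "0 < p" and s: "0 < s" and d: "4*p < s^2" and t: "0 < t" "0 \<le> s*t - t^2 - p"
  shows "cert_const s p * (s^2-4*p) * (p^2*t^2 + s*t + p) + cert_tau s p * (s*t - t^2 - p) < 0"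
proof -
  define x where "x = s^2"
  define w where "w = s*t - t^2 - p"
  have x: "4*p < x" "0 < x" using d p by (auto simp: x_def)
  have s4: "s^4 = x^2" by (simp add: x_def)
  have xx: "k * (4*p) \<le> k * x" if "0 \<le> k" for k using x that by (intro mult_left_mono) auto
  have n0: "cert_const s p < 0"
  proof -
    have "cert_const s p = 4*p^5 - 4*p^7 - 4*p^9 + 4*p^11 - x * (3/2*p^2 + 6*p^4 + 17*p^6 + 6*p^8 + 3/2*p^10)"
      unfolding cert_const_def x_def by algebra
    moreover have "24 * p^5 \<le> 6*p^4*x" using xx[of "6*p^4"] p by (simp add: eval_nat_numeral mult_ac)
    moreover have "6*p^11 \<le> 3/2*p^10*x" using xx[of "3/2*p^10"] p by (simp add: eval_nat_numeral mult_ac)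
    moreover have "0 < x*p^2" "0 < x*p^6" "0 < x*p^8" "0 < p^5" "0 < p^7" "0 < p^9" "0 < p^11" using x p by auto
    ultimately show ?thesis by (simp only: algebra_simps)
  qed
  have S2: "2*p \<le> p^2*t^2 + s*t + p" using t p by (smt (verit) mult_nonneg_nonneg zero_le_power2)
  have w4: "w \<le> (s^2-4*p)/4"
  proof -
    have "(s^2-4*p)/4 - w = (t - s/2)^2" unfolding w_def by (simp add: power2_eq_square field_simps)
    then show ?thesis by (smt (verit) zero_le_power2)
  qed
  have T: "2*p*cert_const s p + cert_tau s p / 4 < 0"
  proof -
    have e: "2*p*cert_const s p + cert_tau s p / 4 = 8*p^6 - 16*p^8 + 8*p^10
        - x * (3*p^3 + 5*p^5 + 25*p^7 + 3*p^9 - 4*p^11)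
        - x^2 * (9/8*p^2 + 5/2*p^4 + 3/4*p^6 + 5/2*p^8) - x * (9/8*p^10 * x)"
      unfolding cert_const_def cert_tau_def s4 unfolding x_def by algebra
    have "x * (9/8*p^10 * (4*p)) \<le> x * (9/8*p^10 * x)"
      using x p by (intro mult_left_mono) auto
    then have a1: "x * (9/2*p^11) \<le> x * (9/8*p^10 * x)" by (simp add: eval_nat_numeral mult_ac)
    have a2: "20*p^6 \<le> 5*p^5*x" using xx[of "5*p^5"] p by (simp add: eval_nat_numeral mult_ac)
    have a3: "12*p^10 \<le> 3*p^9*x" using xx[of "3*p^9"] p by (simp add: eval_nat_numeral mult_ac)
    have a4: "0 \<le> x^2 * (9/8*p^2 + 5/2*p^4 + 3/4*p^6 + 5/2*p^8)" using p by (intro mult_nonneg_nonneg) auto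
    have a5: "0 < x*p^3" "0 < x*p^7" "0 < x*p^11" "0 < p^8" "0 < p^6" "0 < p^10" using x p by auto
    show ?thesis unfolding e using a1 a2 a3 a4 a5 by (simp only: algebra_simps)
  qed
  have de: "0 < s^2-4*p" using d by simp
  have "cert_const s p * (s^2-4*p) * (p^2*t^2 + s*t + p) \<le> cert_const s p * (s^2-4*p) * (2*p)"
    using S2 n0 de by (intro mult_left_mono_neg) (auto simp: mult_nonpos_nonneg less_imp_le)
  moreover have "cert_tau s p * w < - (cert_const s p * (s^2-4*p) * (2*p))"
  proof (cases "cert_tau s p \<le> 0")
    case True
    then have "cert_tau s p * w \<le> 0" using t by (simp add: w_def mult_nonpos_nonneg)
    moreover have "cert_const s p * (s^2-4*p) * (2*p) < 0" using n0 de p by (simp add: mult_neg_pos)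
    ultimately show ?thesis by linarith
  next
    case False
    then have "cert_tau s p * w \<le> cert_tau s p * ((s^2-4*p)/4)" using w4 by (intro mult_left_mono) auto
    moreover have "(2*p*cert_const s p + cert_tau s p / 4) * (s^2-4*p) < 0" using T de by (simp add: mult_neg_pos)
    ultimately show ?thesis by (simp add: algebra_simps)
  qed
  ultimately show ?thesis by (simp add: w_def)
qed

text \<open>The corrected scaling velocity and the velocity at fixed phase both carry roots to
  roots, so their difference is divisible by \<open>w\<close>. This is the division with
  denominators cleared; the \<open>kappa\<close> part of \<open>g\<close> is left out, being a
  multiple of \<open>w\<close> already.\<close>

lemma velocity_identity:
  fixes s p t :: real
  defines "w \<equiv> s*t - t^2 - p" and "de \<equiv> s^2 - 4*p" and "Y2 \<equiv> 2*p^2*t + s - s*p^2"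
    and "r4 \<equiv> s^2*(1+p^2)^2 - 4*p^5 - 4*p^3"
  shows "4*p^2*Y2*de*cert_nu s p + (cert_alpha s p * t + cert_beta s p) * (r4 - Y2^2)
       - 4*r4*p^3*(s*de + (s^2-p+p^3)*(2*t-s))
     = 4*w*p^2*(cert_alpha s p * p^2*t + s * cert_alpha s p + cert_beta s p * p^2)"
  unfolding assms cert_nu_def cert_alpha_def cert_beta_def by algebra

text \<open>The \<open>t\<close>-derivative of \<open>velocity_identity\<close>, for the divergence
  of the corrected velocity.\<close>

lemma velocity_identity_deriv:
  fixes s p t :: real
  defines "w \<equiv> s*t - t^2 - p" and "de \<equiv> s^2 - 4*p" and "Y2 \<equiv> 2*p^2*t + s - s*p^2"
    and "r4 \<equiv> s^2*(1+p^2)^2 - 4*p^5 - 4*p^3"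
  shows "8*p^4*de*cert_nu s p + cert_alpha s p * (r4 - Y2^2) - (cert_alpha s p * t + cert_beta s p) * (4*p^2*Y2)
       - 8*r4*p^3*(s^2-p+p^3)
     = 4*p^2*((s-2*t)*(cert_alpha s p * p^2*t + s * cert_alpha s p + cert_beta s p * p^2) + w * (cert_alpha s p * p^2))"
  unfolding assms cert_nu_def cert_alpha_def cert_beta_def by algebra

text \<open>The left side is the \<open>y\<close>-derivative of the integrand plus the
  \<open>x\<close>-derivative of \<open>f * integrand * sqrt w\<close>, divided by the integrand.
  The exact term turns the velocity \<open>td\<close> of \<open>t\<close> into
  \<open>v = td + w*f = rd/(2*r) * (Y + g*D/2)\<close>, and the sum collapses to
  \<open>rd*D*M/(4*r*S)\<close>.\<close>

lemma integrand_derivative_mod_exact: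
  fixes s p t :: real
  assumes p: "0 < p" and s: "0 < s" and d: "4*p < s^2" and t: "0 < t" "0 < s*t - t^2 - p"
  defines "b \<equiv> s/p^2" 
  defines "r \<equiv> ((s+b)/2)^2 - p - 1/p"
  defines "Y \<equiv> t + (b-s)/2" 
  defines "D \<equiv> r - Y^2" and "S \<equiv> t^2 + b*t + 1/p" and "de \<equiv> s^2-4*p" and "w \<equiv> s*t - t^2 - p"
  defines "rd \<equiv> cert_nu s p/(2* s*p^3)" and "pd \<equiv> p*(1-p^2)/(2* s)"
  defines "td \<equiv> 1/2 + (1/2)*((2* s-4*pd)/de)*(t - s/2)"
  defines "f \<equiv> rd/(2*r) * ((cert_alpha s p * t + s*cert_alpha s p/p^2 + cert_beta s p)/(2*de*cert_nu s p) + cert_kappa s p*D/(2*de*(cert_nu s p)^2))"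
  defines "f' \<equiv> rd/(2*r) * (cert_alpha s p/(2*de*cert_nu s p) - cert_kappa s p*Y/(de*(cert_nu s p)^2))"
  assumes r: "0 < r"
  shows "rd/(2*r) - (rd - 2*Y*td)/D - (1/2)*((2*t+b)*td + t - pd/p^2)/S
    + w*f' + w*f*(2*Y/D - (1/2)*(2*t+b)/S) + (1/2)*f*(s-2*t) < 0"
proof -
  define nu where "nu = cert_nu s p"
  have nu: "0 < nu" unfolding nu_def using cert_nu_pos p s .
  have de: "0 < de" using d by (simp add: de_def)
  have w: "0 < w" using t by (simp add: w_def)
  have S: "0 < S" unfolding S_def b_def using t p s by (intro add_pos_pos) auto
  define g where "g = (cert_alpha s p * t + cert_beta s p)/(de*nu) + cert_kappa s p/(de*nu^2)*w"
  define g' where "g' = cert_alpha s p/(de*nu) + cert_kappa s p/(de*nu^2)*(s-2*t)"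
  define N where "N = - 2*t*(t+Y)"
  define M where "M = (cert_const s p * de * (p^2*t^2 + s*t + p) + cert_tau s p * w) / (p^2*de*nu^2)"
  define v where "v = rd/(2*r)*(Y + g*D/2)"
  have S1: "p^2 * S = p^2*t^2 + s*t + p" unfolding S_def b_def using p by (simp add: field_simps power2_eq_square)
  have M: "M < 0" unfolding M_def
    using certificate_negative[OF p s d t(1)] t(2) p de nu by (simp add: divide_neg_pos de_def w_def)
  have c3: "N + g'*w*S - (1/2)*g*((s-2*t)*S + w*(2*t+b)) = M*w"
  proof -
    have k: "0 < p^2*de*nu^2" using p de nu by simp
    have b1: "p^2*b = s" using p by (simp add: b_def)
    have N1: "p^2*N = - 4*p^2*t^2 - s*(1-p^2)*t" 
      unfolding N_def Y_def b_def using p by (simp add: field_simps power2_eq_square)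
    have g1: "de*nu^2*g = (cert_alpha s p * t + cert_beta s p) * nu + cert_kappa s p * w" unfolding g_def
      using de nu by (simp add: field_simps power2_eq_square)
    have g2: "de*nu^2*g' = cert_alpha s p * nu + cert_kappa s p * (s-2*t)" unfolding g'_def
      using de nu by (simp add: field_simps power2_eq_square)
    have "p^2*de*nu^2*(N + g'*w*S - (1/2)*g*((s-2*t)*S + w*(2*t+b)))
      = (p^2*N)*de*nu^2 + (de*nu^2*g')*w*(p^2*S) - (1/2)*(de*nu^2*g)*((s-2*t)*(p^2*S)+w*(2*p^2*t+p^2*b))"
      by (simp add: algebra_simps)
    also have "\<dots> = (cert_const s p * de * (p^2*t^2 + s*t + p) + cert_tau s p * w) * w"
      unfolding N1 g1 g2 S1 b1 unfolding nu_def de_def w_def by (rule certificate_identity)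
    also have "\<dots> = p^2*de*nu^2*(M*w)" unfolding M_def using p de nu by (simp add: field_simps)
    finally show ?thesis using p de nu by simp
  qed
  have P: "w*S = t^2*D - 1"
  proof -
    have "(w*S)*p^4 = (t^2*D-1)*p^4" unfolding w_def S_def D_def Y_def r_def b_def using p by (simp add: field_simps) algebra
    then show ?thesis using p by simp
  qed
  have D: "0 < D" using P w S t by (smt (verit) mult_pos_pos zero_less_mult_pos zero_less_power)
  have Pm: "(s-2*t)*S + w*(2*t+b) = 2*t*D - 2*Y*t^2"
  proof -
    have "((s-2*t)*S + w*(2*t+b))*p^4 = (2*t*D - 2*Y*t^2)*p^4" unfolding w_def S_def D_def Y_def r_def b_def using p by (simp add: field_simps) algebra
    then show ?thesis using p by simp
  qed
  have Py: "(t - pd)*S + w*(t - pd/p^2) = rd*t^2"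
  proof -
    have "((t - pd)*S + w*(t - pd/p^2))*(2* s*p^3) = (rd*t^2)*(2* s*p^3)" unfolding w_def S_def D_def Y_def r_def b_def pd_def rd_def cert_nu_def using p s by (simp add: field_simps) algebra
    then show ?thesis using p s by simp
  qed
  define Y2 where "Y2 = 2*p^2*t + s - s*p^2"
  define r4 where "r4 = s^2*(1+p^2)^2 - 4*p^5 - 4*p^3"
  define F where "F = (cert_alpha s p * t + s*cert_alpha s p/p^2 + cert_beta s p)/(2*de*nu)"
  define k where "k = (1/2)*((2* s-4*pd)/de)"
  have rd: "0 < rd" unfolding rd_def using nu p s by (simp add: nu_def)
  have Y2: "2*p^2*Y = Y2" unfolding Y2_def Y_def b_def using p by (simp add: field_simps)
  have r4: "4*p^4*r = r4"
  proof -
    have "4*p^4*r = (p^2 * s + p^2*b)^2 - 4*p^5 - 4*p^3" unfolding r_def using p by (simp add: field_simps eval_nat_numeral)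
    moreover have "p^2*b = s" unfolding b_def using p by simp
    ultimately show ?thesis unfolding r4_def by algebra
  qed
  have D4: "4*p^4*D = r4 - Y2^2" unfolding D_def r4[symmetric] Y2[symmetric] by (simp add: algebra_simps eval_nat_numeral)
  have ki: "s*de*k = s^2-p+p^3" unfolding k_def pd_def using de s by (simp add: field_simps) algebra
  have rr: "2*r/rd = r4* s/(nu*p)" unfolding r4[symmetric] rd_def nu_def[symmetric] using p s nu by (simp add: field_simps eval_nat_numeral)
  have F2: "2*p^2*de*nu*F = cert_alpha s p * p^2*t + s*cert_alpha s p + cert_beta s p * p^2" 
    unfolding F_def using p de nu by (simp add: field_simps)
  have td: "td = 1/2 + k*(t-s/2)" unfolding td_def k_def by simp
  have fF: "f = rd/(2*r)*(F + cert_kappa s p*D/(2*de*nu^2))" unfolding f_def F_def nu_def ..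
  have f'F: "f' = rd/(2*r)*(cert_alpha s p/(2*de*nu) - cert_kappa s p*Y/(de*nu^2))" unfolding f'_def nu_def ..
  have vtt: "Y + (cert_alpha s p * t + cert_beta s p)/(de*nu)*D/2 - 2*r/rd*td = w*F"
  proof -
    have 1: "8*p^4*de*nu*(2*r/rd*td) = 4*r4*p^3*(s*de + (s^2-p+p^3)*(2*t-s))"
      unfolding rr td ki[symmetric] using nu p by (simp add: field_simps eval_nat_numeral)
    have 2: "8*p^4*de*nu*((cert_alpha s p * t + cert_beta s p)/(de*nu)*D/2) = (cert_alpha s p * t + cert_beta s p) * (r4 - Y2^2)"
      unfolding D4[symmetric] using nu de by (simp add: field_simps)
    have "8*p^4*de*nu*(Y + (cert_alpha s p * t + cert_beta s p)/(de*nu)*D/2 - 2*r/rd*td)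
      = 4*p^2*(2*p^2*Y)*de*nu + 8*p^4*de*nu*((cert_alpha s p * t + cert_beta s p)/(de*nu)*D/2) - 8*p^4*de*nu*(2*r/rd*td)"
      by (simp add: algebra_simps)
    also have "\<dots> = 4*w*p^2*(2*p^2*de*nu*F)"
      unfolding 1 2 Y2 F2 unfolding w_def de_def nu_def r4_def Y2_def by (rule velocity_identity)
    also have "\<dots> = 8*p^4*de*nu*(w*F)" by (simp add: algebra_simps eval_nat_numeral)
    finally show ?thesis using nu de p by simp
  qed
  have vt: "td + w*f = v"
  proof -
    have "td + w*f = rd/(2*r)*(2*r/rd*td + w*F + w*cert_kappa s p*D/(2*de*nu^2))"
      unfolding fF using rd r by (simp add: field_simps)
    also have "\<dots> = v" unfolding vtt[symmetric] v_def g_def by (simp add: algebra_simps add_divide_distrib)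
    finally show ?thesis .
  qed
  \<comment> \<open>At fixed phase \<open>w = (halfdiff * sin x)^2\<close> changes by a multiple of
    itself; \<open>2*k\<close> is that rate.\<close>
  have wt: "(t - pd) + (s-2*t)*td = w*(2*k)"
  proof -
    have kd: "k*de = s - 2*pd" unfolding k_def using de by (simp add: field_simps)
    have "((t - pd) + (s-2*t)*td)*de = (t - pd)*de + (s-2*t)*(de/2 + (k*de)*(t-s/2))"
      unfolding td by (simp add: algebra_simps)
    also have "\<dots> = w*(2*(k*de))" unfolding kd unfolding w_def de_def by (simp add: field_simps) algebra
    finally show ?thesis using de by simp
  qed
  define q where "q = k + (1/2)*f*(s-2*t)"
  \<comment> \<open>Both sides are the derivative of \<open>P\<close> along the velocity
    \<open>v\<close>: from \<open>P = w*S\<close> on the left, from \<open>P = t^2*D - 1\<close> on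
    the right. The factor \<open>w\<close> on the left is what removes the singularity.\<close>
  have q1: "w*(2*q*S + (t - pd/p^2) + (2*t+b)* v) = rd*t^2 + (2*t*D-2*Y*t^2)* v"
    unfolding Pm[symmetric] Py[symmetric] vt[symmetric] q_def using wt by algebra
  have q2: "rd*t^2 + (2*t*D-2*Y*t^2)* v = - (rd/(2*r))*D*w*(M - g'*S)"
  proof -
    have "rd*t^2 + (2*t*D-2*Y*t^2)* v = (rd/r)*D*(-(1/2)*N + (1/4)*g*(2*t*D-2*Y*t^2))"
      unfolding v_def N_def D_def using r by (simp add: field_simps) algebra
    also have "\<dots> = - (rd/(2*r))*D*(M*w - g'*w*S)" unfolding c3[symmetric] Pm[symmetric] by (simp add: algebra_simps add_divide_distrib)
    finally show ?thesis by (simp add: algebra_simps)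
  qed
  have q3: "2*q*S + (t - pd/p^2) + (2*t+b)* v = - (rd/(2*r))*D*(M - g'*S)"
    using q1[unfolded q2] w by (metis mult.assoc mult.commute mult_left_cancel less_irrefl)
  \<comment> \<open>Divergence of the velocity: the \<open>t\<close>-derivative of
    \<open>td + w*f\<close> and of \<open>v\<close>.\<close>
  have v': "k + w*f' + (s-2*t)*f = rd/(2*r)*(1 + g'*D/2 - g*Y)"
  proof -
    have 0: "1 + cert_alpha s p/(de*nu)*D/2 - (cert_alpha s p * t + cert_beta s p)/(de*nu)*Y - 2*r/rd*k = (s-2*t)*F + w*(cert_alpha s p/(2*de*nu))"
    proof -
      have 1: "8*p^4*de*nu*(2*r/rd*k) = 8*r4*p^3*(s^2-p+p^3)"
        unfolding rr ki[symmetric] using nu p by (simp add: field_simps eval_nat_numeral)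
      have 2: "8*p^4*de*nu*(cert_alpha s p/(de*nu)*D/2) = cert_alpha s p * (r4 - Y2^2)"
        unfolding D4[symmetric] using nu de by (simp add: field_simps)
      have 3: "8*p^4*de*nu*((cert_alpha s p * t + cert_beta s p)/(de*nu)*Y) = (cert_alpha s p * t + cert_beta s p)*(4*p^2*Y2)"
        unfolding Y2[symmetric] using nu de by (simp add: field_simps)
      have 4: "4*p^2*(2*p^2*de*nu)*(w*(cert_alpha s p/(2*de*nu))) = 4*p^2*(w*(cert_alpha s p * p^2))"
        using nu de by (simp add: field_simps)
      have "8*p^4*de*nu*(1 + cert_alpha s p/(de*nu)*D/2 - (cert_alpha s p * t + cert_beta s p)/(de*nu)*Y - 2*r/rd*k)
        = 8*p^4*de*nu + 8*p^4*de*nu*(cert_alpha s p/(de*nu)*D/2) - 8*p^4*de*nu*((cert_alpha s p * t + cert_beta s p)/(de*nu)*Y)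
           - 8*p^4*de*nu*(2*r/rd*k)"
        by (simp only: algebra_simps)
      also have "\<dots> = 4*p^2*((s-2*t)*(2*p^2*de*nu*F) + w*(cert_alpha s p * p^2))"
        unfolding 1 2 3 F2 unfolding w_def de_def nu_def r4_def Y2_def by (rule velocity_identity_deriv)
      also have "\<dots> = 4*p^2*(2*p^2*de*nu)*((s-2*t)*F) + 4*p^2*(2*p^2*de*nu)*(w*(cert_alpha s p/(2*de*nu)))"
        unfolding 4 by (simp add: algebra_simps)
      also have "\<dots> = 8*p^4*de*nu*((s-2*t)*F + w*(cert_alpha s p/(2*de*nu)))"
        by (simp add: algebra_simps eval_nat_numeral)
      finally show ?thesis using nu de p by simp
    qed
    have "k + w*f' + (s-2*t)*f = rd/(2*r)*(2*r/rd*k + ((s-2*t)*F + w*(cert_alpha s p/(2*de*nu))) 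
        - w*(cert_kappa s p*Y/(de*nu^2)) + (s-2*t)*(cert_kappa s p*D/(2*de*nu^2)))"
      unfolding fF f'F using rd r by (simp add: field_simps)
    also have "\<dots> = rd/(2*r)*(1 + g'*D/2 - g*Y)" unfolding 0[symmetric] g_def g'_def by (simp add: algebra_simps add_divide_distrib diff_divide_distrib)
    finally show ?thesis .
  qed
  have "rd/(2*r) - (rd - 2*Y*td)/D - (1/2)*((2*t+b)*td + t - pd/p^2)/S
    + w*f' + w*f*(2*Y/D - (1/2)*(2*t+b)/S) + (1/2)*f*(s-2*t)
    = rd/(2*r) - rd/D + 2*Y* v/D - (1/2)*(2*q*S + (t-pd/p^2) + (2*t+b)* v)/S + rd/(2*r)*(1 + g'*D/2 - g*Y)"
    unfolding v'[symmetric] vt[symmetric] q_def using S D by (simp add: field_simps)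
  also have "\<dots> = rd*D*M/(4*r*S)"
  proof -
    define x where "x = rd/(2*r)"
    have 1: "rd = 2*r*x" unfolding x_def using r by simp
    have 2: "r = D + Y^2" unfolding D_def by simp
    have "x - 2*r*x/D + 2*Y*(x*(Y + g*D/2))/D - (1/2)*(-x*D*(M - g'*S))/S + x*(1 + g'*D/2 - g*Y) = x*D*M/(2*S)"
      unfolding 2 using S D by (simp add: field_simps power2_eq_square)
    moreover have "rd*D*M/(4*r*S) = x*D*M/(2*S)" unfolding x_def by simp
    ultimately show ?thesis unfolding q3 unfolding v_def by (simp add: x_def[symmetric] 1[symmetric])
  qed
  also have "\<dots> < 0"
  proof -
    have "0 < rd" unfolding rd_def using nu p s by (simp add: nu_def)
    then show ?thesis using D M r S by (simp add: divide_neg_pos mult_pos_neg)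
  qed
  finally show ?thesis .
qed

section \<open>The period as a function of one parameter\<close>

text \<open>The linear coefficient of the product is \<open>s/p - p*b\<close>, and
  \<open>b = s/p^2\<close> is the choice that kills it, as the form \<open>t^2*(...) - 1\<close>
  requires.\<close>

lemma quartic_factor:
  fixes s p t :: real
  assumes p: "0 < p"
  defines "b \<equiv> s/p^2" 
  shows "(s*t - t^2 - p)*(t^2 + b*t + 1/p) = t^2*((((s+b)/2)^2 - p - 1/p) - (t + (b-s)/2)^2) - 1"
proof -
  have "(s*t - t^2 - p)*(t^2 + b*t + 1/p) * p^4 = (t^2*((((s+b)/2)^2 - p - 1/p) - (t + (b-s)/2)^2) - 1)*p^4" 
    unfolding b_def using p by (simp add: field_simps) algebra
  then show ?thesis using p by simp
qed

text \<open>The parameter \<open>y\<close> is \<open>e1 + e2 + 2 * lam\<close>. The coefficients of \<open>Q\<close> force the second quadratic factor of \<open>Q\<close> to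
  be \<open>t^2 + (y + 2*lam) * t + 1/p\<close> with \<open>y + 2*lam = (y - 2*lam)/p^2\<close>, which determines \<open>p = e1 * e2\<close>.\<close>

definition rootprod :: "real \<Rightarrow> real \<Rightarrow> real" where
  "rootprod lam y = sqrt ((y - 2*lam)/(y + 2*lam))"
definition radsq :: "real \<Rightarrow> real \<Rightarrow> real" where
  "radsq lam y = y^2 - rootprod lam y - 1/rootprod lam y"
definition halfdiff :: "real \<Rightarrow> real \<Rightarrow> real" where
  "halfdiff lam y = sqrt ((y - 2*lam)^2/4 - rootprod lam y)"
definition wave :: "real \<Rightarrow> real \<Rightarrow> real \<Rightarrow> real" where
  "wave lam y x = (y - 2*lam)/2 - halfdiff lam y * cos x"
text \<open>On the sphere of squared radius \<open>radsq\<close>, the squared distance from the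
  \<open>Y\<close>-axis.\<close>

definition polar :: "real \<Rightarrow> real \<Rightarrow> real \<Rightarrow> real" where
  "polar lam y x = radsq lam y - (wave lam y x + 2*lam)^2"
definition cofactor :: "real \<Rightarrow> real \<Rightarrow> real \<Rightarrow> real" where
  "cofactor lam y x = (wave lam y x)^2 + (y + 2*lam) * wave lam y x + 1/rootprod lam y"
text \<open>Here \<open>sqrt (radsq lam y)\<close> stands for \<open>2 * xi\<close>, and
  \<open>dmu / sqrt (- Q mu)\<close> has become \<open>dx / sqrt (cofactor lam y x)\<close>. The
  factor 2 accounts for the other half of the period, as \<open>Hfun\<close> integrates over
  \<open>{0..pi}\<close> only.\<close>

definition integrand :: "real \<Rightarrow> real \<Rightarrow> real \<Rightarrow> real" where
  "integrand lam y x = 2 * sqrt (radsq lam y) / (polar lam y x * sqrt (cofactor lam y x))"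
definition Hfun :: "real \<Rightarrow> real \<Rightarrow> real" where
  "Hfun lam y = integral {0..pi} (integrand lam y)"
definition admissible :: "real \<Rightarrow> real set" where
  "admissible lam = {y. 0 < y - 2*lam \<and> 0 < y + 2*lam \<and> 4 * rootprod lam y < (y - 2*lam)^2}"

text \<open>The form about the \<open>Y\<close>-axis has no poles because the factorization reads
  \<open>t^2 * polar = 1 + w * cofactor\<close> with \<open>w\<close> a square.\<close>

lemma admissible_facts:
  assumes "y \<in> admissible lam"
  shows "0 < y - 2*lam" "0 < y + 2*lam" "4 * rootprod lam y < (y - 2*lam)^2" "0 < rootprod lam y"
    "y + 2*lam = (y - 2*lam)/(rootprod lam y)^2" "0 < halfdiff lam y"
    "(halfdiff lam y)^2 = (y - 2*lam)^2/4 - rootprod lam y" "0 < wave lam y x" "0 < cofactor lam y x"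
    "0 < polar lam y x" "0 < radsq lam y"
    "(y - 2*lam)*wave lam y x - (wave lam y x)^2 - rootprod lam y = (halfdiff lam y * sin x)^2"
    "((y - 2*lam)*wave lam y x - (wave lam y x)^2 - rootprod lam y) * cofactor lam y x = (wave lam y x)^2 * polar lam y x - 1"
proof -
  show a: "0 < y - 2*lam" and b: "0 < y + 2*lam" and c: "4 * rootprod lam y < (y - 2*lam)^2"
    using assms by (auto simp: admissible_def)
  show p: "0 < rootprod lam y" using a b by (simp add: rootprod_def)
  have p2: "(rootprod lam y)^2 = (y-2*lam)/(y+2*lam)" using a b by (simp add: rootprod_def)
  show e: "y + 2*lam = (y - 2*lam)/(rootprod lam y)^2" unfolding p2 using a b by simp
  show h: "0 < halfdiff lam y" using c by (simp add: halfdiff_def)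
  show h2: "(halfdiff lam y)^2 = (y - 2*lam)^2/4 - rootprod lam y" using c by (simp add: halfdiff_def)
  have "(halfdiff lam y)^2 < ((y-2*lam)/2)^2" unfolding h2 using p by (simp add: power_divide)
  then have "halfdiff lam y < (y-2*lam)/2" using a by (smt (verit) power_mono h divide_pos_pos)
  moreover have "halfdiff lam y * cos x \<le> halfdiff lam y * 1" using h by (intro mult_left_mono) auto
  ultimately show w: "0 < wave lam y x" unfolding wave_def by simp
  show S: "0 < cofactor lam y x" unfolding cofactor_def using w b p by (intro add_pos_pos) auto
  show f: "(y - 2*lam)*wave lam y x - (wave lam y x)^2 - rootprod lam y = (halfdiff lam y * sin x)^2"
    unfolding power_mult_distrib sin_squared_eq unfolding right_diff_distrib h2
    unfolding wave_def by (simp add: power2_diff power_mult_distrib h2) (simp add: field_simps power2_eq_square)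
  have y: "y = ((y-2*lam) + (y-2*lam)/(rootprod lam y)^2)/2" "2*lam = ((y-2*lam)/(rootprod lam y)^2 - (y-2*lam))/2"
    using e by auto
  show F: "((y - 2*lam)*wave lam y x - (wave lam y x)^2 - rootprod lam y) * cofactor lam y x = (wave lam y x)^2 * polar lam y x - 1"
    unfolding cofactor_def polar_def radsq_def 
    using quartic_factor[OF p, of "y-2*lam" "wave lam y x"] unfolding e[symmetric] by simp
  then have "0 \<le> (wave lam y x)^2 * polar lam y x - 1" unfolding F[symmetric] f using S by simp
  then show D: "0 < polar lam y x" using w by (smt (verit) mult_nonneg_nonpos zero_le_power2)
  then show "0 < radsq lam y" unfolding polar_def by (smt (verit) zero_le_power2)
qed

text \<open>Logarithmic differentiation, shared by the derivatives in the parameter \<open>y\<close>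
  and in the phase \<open>x\<close>; in the latter \<open>r\<close> is constant.\<close>

lemma DERIV_kernel:
  fixes r D S :: "real \<Rightarrow> real"
  assumes "(r has_real_derivative r') (at y)" "(D has_real_derivative D') (at y)" "(S has_real_derivative S') (at y)"
    and "0 < r y" "0 < D y" "0 < S y"
  shows "((\<lambda>y. 2 * sqrt (r y) / (D y * sqrt (S y))) has_real_derivative
     2 * sqrt (r y) / (D y * sqrt (S y)) * (r'/(2*r y) - D'/D y - (1/2)*S'/S y)) (at y)"
proof -
  define u where "u = sqrt (r y)"
  define v where "v = sqrt (S y)"
  have uv: "0 < u" "0 < v" "r y = u^2" "S y = v^2" using assms by (auto simp: u_def v_def)
  have 1: "((\<lambda>y. sqrt (r y)) has_real_derivative r'/(2*u)) (at y)"
    using assms by (auto intro!: derivative_eq_intros simp: u_def field_simps)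
  have 2: "((\<lambda>y. D y * sqrt (S y)) has_real_derivative D' * v + D y*(S'/(2* v))) (at y)"
    using assms by (auto intro!: derivative_eq_intros simp: v_def field_simps)
  have "D y * sqrt (S y) \<noteq> 0" using assms by simp
  from DERIV_divide[OF DERIV_cmult[OF 1, of 2] 2 this] show ?thesis
    unfolding u_def[symmetric] v_def[symmetric]
    by (rule DERIV_cong) (use uv assms(5) in \<open>simp add: uv(3,4) field_simps power2_eq_square\<close>)
qed

section \<open>Differentiation of the integrand in the parameter \<open>y\<close>\<close>

definition dprod :: "real \<Rightarrow> real \<Rightarrow> real" where
  "dprod lam y = rootprod lam y * (1 - (rootprod lam y)^2)/(2*(y - 2*lam))"
definition dradsq :: "real \<Rightarrow> real \<Rightarrow> real" where
  "dradsq lam y = cert_nu (y - 2*lam) (rootprod lam y)/(2*(y - 2*lam)*(rootprod lam y)^3)"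
text \<open>Expressed through \<open>wave\<close> instead of \<open>cos x\<close>, so as to be the
  affine function \<open>td\<close> of \<open>t\<close> in the certificate.\<close>

definition dwave :: "real \<Rightarrow> real \<Rightarrow> real \<Rightarrow> real" where
  "dwave lam y x = 1/2 + (1/2)*((2*(y - 2*lam)-4*dprod lam y)/((y - 2*lam)^2 - 4*rootprod lam y))*(wave lam y x - (y - 2*lam)/2)"
definition dintegrand :: "real \<Rightarrow> real \<Rightarrow> real \<Rightarrow> real" where
  "dintegrand lam y x = integrand lam y x * (dradsq lam y/(2*radsq lam y) 
     - (dradsq lam y - 2*(wave lam y x + 2*lam)*dwave lam y x)/polar lam y x
     - (1/2)*((2*wave lam y x+(y + 2*lam))*dwave lam y x + wave lam y x - dprod lam y/(rootprod lam y)^2)/cofactor lam y x)"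

lemma DERIV_rootprod:
  assumes "y \<in> admissible lam"
  shows "(rootprod lam has_real_derivative dprod lam y) (at y)"
proof -
  note A = admissible_facts(1,2,4,5)[OF assms]
  have 1: "((\<lambda>y. (y-2*lam)/(y+2*lam)) has_real_derivative (4*lam)/(y+2*lam)^2) (at y)"
    using A(2) by (auto intro!: derivative_eq_intros simp: power2_eq_square field_simps)
  have 2: "0 < (y-2*lam)/(y+2*lam)" using A(1,2) by simp
  have 3: "(rootprod lam has_real_derivative inverse (rootprod lam y) / 2 * ((4*lam)/(y+2*lam)^2)) (at y)"
    unfolding rootprod_def[abs_def] by (rule DERIV_chain2[OF DERIV_real_sqrt[OF 2] 1])
  have key: "inverse p/2 * ((s/p^2 - s)/(s/p^2)^2) = p*(1-p^2)/(2* s)" if "0 < s" "0 < p" for s p :: real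
    using that by (simp add: field_simps eval_nat_numeral)
  have l: "(y + 2*lam) - (y-2*lam) = 4*lam" by simp
  show ?thesis
    by (rule DERIV_cong[OF 3]) (use key[OF A(1) A(3)] in \<open>unfold A(4)[symmetric] dprod_def l\<close>)
qed

lemma DERIV_radsq:
  assumes "y \<in> admissible lam"
  shows "(radsq lam has_real_derivative dradsq lam y) (at y)"
proof -
  note A = admissible_facts(1,2,4,5)[OF assms]
  have 1: "(radsq lam has_real_derivative 2*y - dprod lam y + dprod lam y / (rootprod lam y)^2) (at y)"
    unfolding radsq_def[abs_def] using A(3) by (auto intro!: derivative_eq_intros DERIV_rootprod assms simp: power2_eq_square)
  have key: "(s + s/p^2) - p*(1-p^2)/(2* s) + p*(1-p^2)/(2* s)/p^2 = cert_nu s p/(2* s*p^3)" if "0 < s" "0 < p" for s p :: real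
  proof -
    have "((s + s/p^2) - p*(1-p^2)/(2* s) + p*(1-p^2)/(2* s)/p^2) * (2* s*p^3) = cert_nu s p"
      unfolding cert_nu_def using that by (simp add: field_simps) algebra
    then show ?thesis using that by (intro nonzero_eq_divide_eq[THEN iffD2]) auto
  qed
  have "2*y = (y-2*lam) + (y-2*lam)/(rootprod lam y)^2" using A(4) by simp
  then have "2*y - dprod lam y + dprod lam y / (rootprod lam y)^2 = dradsq lam y"
    using key[OF A(1) A(3)] unfolding dprod_def dradsq_def by simp
  with 1 show ?thesis by simp
qed

lemma DERIV_wave:
  assumes "y \<in> admissible lam"
  shows "((\<lambda>y. wave lam y x) has_real_derivative dwave lam y x) (at y)"
proof -
  note A = admissible_facts(3,6,7)[OF assms]
  have 1: "((\<lambda>y. (y - 2*lam)^2/4 - rootprod lam y) has_real_derivative (y-2*lam)/2 - dprod lam y) (at y)"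
    by (rule derivative_eq_intros DERIV_rootprod assms refl | simp)+
  have 2: "0 < (y - 2*lam)^2/4 - rootprod lam y" using A(1) by simp
  have h': "(halfdiff lam has_real_derivative inverse (halfdiff lam y)/2 * ((y-2*lam)/2 - dprod lam y)) (at y)"
    unfolding halfdiff_def[abs_def] by (rule DERIV_chain2[OF DERIV_real_sqrt[OF 2] 1])
  have de: "(y - 2*lam)^2 - 4*rootprod lam y = 4*(halfdiff lam y)^2" using A(3) by simp
  have "dwave lam y x = 1/2 - inverse (halfdiff lam y)/2 * ((y-2*lam)/2 - dprod lam y) * cos x"
    unfolding dwave_def de wave_def using A(2) by (simp add: field_simps power2_eq_square)
  then show ?thesis unfolding wave_def by (auto intro!: derivative_eq_intros h')
qed

lemma DERIV_integrand:
  assumes "y \<in> admissible lam"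
  shows "((\<lambda>y. integrand lam y x) has_real_derivative dintegrand lam y x) (at y)"
proof -
  note A = admissible_facts(4,9,10,11)[OF assms]
  note p' = DERIV_rootprod[OF assms] and r' = DERIV_radsq[OF assms] and w' = DERIV_wave[OF assms]
  have D': "((\<lambda>y. polar lam y x) has_real_derivative dradsq lam y - 2*(wave lam y x + 2*lam)*dwave lam y x) (at y)"
    unfolding polar_def by (rule derivative_eq_intros r' w' refl | simp)+
  have S': "((\<lambda>y. cofactor lam y x) has_real_derivative 
      (2*wave lam y x+(y + 2*lam))*dwave lam y x + wave lam y x - dprod lam y/(rootprod lam y)^2) (at y)"
  proof -
    have "((\<lambda>y. 1/rootprod lam y) has_real_derivative - dprod lam y/(rootprod lam y)^2) (at y)"
      using A(1) by (auto intro!: derivative_eq_intros p' simp: power2_eq_square)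
    then have "((\<lambda>y. cofactor lam y x) has_real_derivative 
      (2*wave lam y x*dwave lam y x + (wave lam y x + (y + 2*lam)*dwave lam y x)) + - dprod lam y/(rootprod lam y)^2) (at y)"
      unfolding cofactor_def by (intro DERIV_add) (auto intro!: derivative_eq_intros w')
    then show ?thesis by (rule DERIV_cong) (simp add: algebra_simps)
  qed
  show ?thesis
    unfolding integrand_def[abs_def] dintegrand_def using DERIV_kernel[OF r' D' S' A(4) A(3) A(2)] .
qed

text \<open>Strictness is asked only inside, because the certificate needs \<open>w > 0\<close> and
  \<open>w\<close> vanishes at \<open>0\<close> and \<open>pi\<close>.\<close>

lemma integral_neg_interior:
  fixes g :: "real \<Rightarrow> real"
  assumes "a < b" "continuous_on {a..b} g" "\<And>x. a < x \<Longrightarrow> x < b \<Longrightarrow> g x < 0"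
  shows "integral {a..b} g < 0"
proof -
  define F where "F x = integral {a..x} g" for x
  have c: "continuous_on {a..b} F" unfolding F_def
    by (intro indefinite_integral_continuous_1 integrable_continuous_real assms)
  have d: "(F has_real_derivative g x) (at x)" if "a < x" "x < b" for x
  proof -
    have "(F has_real_derivative g x) (at x within {a..b})" unfolding F_def
      using assms that by (intro integral_has_real_derivative) auto
    then show ?thesis using that by (simp add: at_within_Icc_at)
  qed
  have "F b < F a"
    using assms(1) by (rule DERIV_neg_imp_decreasing_open) (use d assms(3) c in auto)
  then show ?thesis by (simp add: F_def)
qed

lemma continuous_on_dintegrand:
  "continuous_on (admissible lam \<times> UNIV) (\<lambda>(y, x). dintegrand lam y x)"
  and continuous_on_integrand: "continuous_on (admissible lam \<times> UNIV) (\<lambda>(y, x). integrand lam y x)"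
proof -
  let ?U = "admissible lam \<times> (UNIV::real set)"
  have p: "continuous_on ?U (\<lambda>z. rootprod lam (fst z))" unfolding rootprod_def
    by (intro continuous_intros) (auto dest: admissible_facts)
  have nz: "z \<in> ?U \<Longrightarrow> rootprod lam (fst z) \<noteq> 0 \<and> fst z - 2*lam \<noteq> 0 \<and> (fst z - 2*lam)^2 - 4*rootprod lam (fst z) \<noteq> 0
     \<and> polar lam (fst z) (snd z) \<noteq> 0 \<and> cofactor lam (fst z) (snd z) \<noteq> 0 \<and> sqrt (cofactor lam (fst z) (snd z)) \<noteq> 0 \<and> radsq lam (fst z) \<noteq> 0" for z
  proof -
    assume "z \<in> ?U"
    then have "fst z \<in> admissible lam" by auto
    note A = admissible_facts(1,3,4,9,10,11)[OF this]
    show ?thesis using A(1,2,3,6) A(4,5)[of "snd z"] by simp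
  qed
  have r: "continuous_on ?U (\<lambda>z. radsq lam (fst z))" unfolding radsq_def
    by (intro continuous_intros p) (use nz in auto)
  have w: "continuous_on ?U (\<lambda>z. wave lam (fst z) (snd z))" unfolding wave_def halfdiff_def
    by (intro continuous_intros p) auto
  have D: "continuous_on ?U (\<lambda>z. polar lam (fst z) (snd z))" unfolding polar_def
    by (intro continuous_intros r w)
  have S: "continuous_on ?U (\<lambda>z. cofactor lam (fst z) (snd z))" unfolding cofactor_def
    by (intro continuous_intros p w) (use nz in auto)
  have i: "continuous_on ?U (\<lambda>z. integrand lam (fst z) (snd z))" unfolding integrand_def
    by (intro continuous_intros D S r) (use nz in auto)
  then show "continuous_on ?U (\<lambda>(y, x). integrand lam y x)" by (simp add: case_prod_unfold)
  have d: "continuous_on ?U (\<lambda>z. dprod lam (fst z))" unfolding dprod_def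
    by (intro continuous_intros p) (use nz in auto)
  have nu: "continuous_on ?U (\<lambda>z. dradsq lam (fst z))" unfolding dradsq_def cert_nu_def
    by (intro continuous_intros p) (use nz in auto)
  have dw: "continuous_on ?U (\<lambda>z. dwave lam (fst z) (snd z))" unfolding dwave_def
    by (intro continuous_intros p d w) (use nz in auto)
  have "continuous_on ?U (\<lambda>z. dintegrand lam (fst z) (snd z))" unfolding dintegrand_def
    by (intro continuous_intros i nu r w dw D p d S) (use nz in auto)
  then show "continuous_on ?U (\<lambda>(y, x). dintegrand lam y x)" by (simp add: case_prod_unfold)
qed

lemma dintegrand_integral_neg:
  assumes y: "y \<in> admissible lam"
  shows "integral {0..pi} (dintegrand lam y) < 0"
proof -
  note A = admissible_facts[OF y]
  define s where "s = y - 2*lam"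
  define p where "p = rootprod lam y"
  define b where "b = y + 2*lam"
  define B where "B = halfdiff lam y"
  define r where "r = radsq lam y"
  have b: "b = s/p^2" unfolding b_def s_def p_def by (rule A)
  have yr: "y = (s + s/p^2)/2" "2*lam = (s/p^2 - s)/2" using b by (auto simp: b_def s_def)
  define f where "f t = dradsq lam y/(2*r) * ((cert_alpha s p * t + s*cert_alpha s p/p^2 + cert_beta s p)/(2*(s^2-4*p)*cert_nu s p) 
    + cert_kappa s p*(r - (t + 2*lam)^2)/(2*(s^2-4*p)*(cert_nu s p)^2))" for t
  define f' where "f' t = dradsq lam y/(2*r) * (cert_alpha s p/(2*(s^2-4*p)*cert_nu s p) - cert_kappa s p*(t+2*lam)/((s^2-4*p)*(cert_nu s p)^2))" for t
  have f': "(f has_real_derivative f' t) (at t)" for t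
  proof -
    have "((\<lambda>t. X * ((a * t + c1 + c2)/d1 + k * (r - (t+l)^2)/(2*d2*d3))) has_real_derivative X * (a/d1 - k * (t+l)/(d2*d3))) (at t)"
      for X a c1 c2 k l d1 d2 d3 :: real
      unfolding divide_inverse inverse_mult_distrib by (auto intro!: derivative_eq_intros simp: algebra_simps)
    then show ?thesis unfolding f_def f'_def by this
  qed
  \<comment> \<open>The form \<open>integrand dx\<close> contracted with the velocity
    \<open>w * f\<close> of \<open>t\<close>: since \<open>dt = B * sin x dx\<close> and
    \<open>w = (B * sin x)^2\<close>, this is the phase velocity \<open>f * B * sin x\<close>. It
    vanishes at \<open>0\<close> and \<open>pi\<close>.\<close>
  define Phi where "Phi x = f (wave lam y x) * integrand lam y x * (B * sin x)" for x
  define E where "E x = f' (wave lam y x) * (B * sin x)^2 + f (wave lam y x) * (B * sin x)^2 * 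
     (2*(wave lam y x + 2*lam)/polar lam y x - (1/2)*(2*wave lam y x + b)/cofactor lam y x) 
     + (1/2)*f (wave lam y x)*(s-2*wave lam y x)" for x
  have w': "(wave lam y has_real_derivative B * sin x) (at x)" for x
    unfolding wave_def[abs_def] B_def by (auto intro!: derivative_eq_intros)
  have D': "(polar lam y has_real_derivative - 2*(wave lam y x + 2*lam)*(B * sin x)) (at x)" for x
    unfolding polar_def[abs_def] by (auto intro!: derivative_eq_intros w' simp: algebra_simps)
  have S': "(cofactor lam y has_real_derivative (2*wave lam y x + b)*(B * sin x)) (at x)" for x
    unfolding cofactor_def[abs_def] b_def by (auto intro!: derivative_eq_intros w' simp: algebra_simps)
  have i': "(integrand lam y has_real_derivative integrand lam y x * 
      (2*(wave lam y x + 2*lam)/polar lam y x - (1/2)*(2*wave lam y x + b)/cofactor lam y x)*(B * sin x)) (at x)" for x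
    using DERIV_kernel[OF DERIV_const[of r] D' S', of x] A(9,10,11) unfolding integrand_def[abs_def] r_def
    by (auto elim!: DERIV_cong simp: field_simps)
  have Bc: "B * cos x = (1/2)*(s - 2*wave lam y x)" for x
    unfolding wave_def B_def s_def by (simp add: field_simps)
  have Phi': "(Phi has_real_derivative integrand lam y x * E x) (at x)" for x
  proof -
    have "((\<lambda>x. f (wave lam y x) * integrand lam y x * (B * sin x)) has_real_derivative
      (f' (wave lam y x) * (B * sin x) * integrand lam y x + f (wave lam y x) * (integrand lam y x * 
      (2*(wave lam y x + 2*lam)/polar lam y x - (1/2)*(2*wave lam y x + b)/cofactor lam y x)*(B * sin x))) * (B * sin x)
      + f (wave lam y x) * integrand lam y x * (B * cos x)) (at x)"
      by (auto intro!: derivative_eq_intros DERIV_chain2[OF f' w'] i' simp: algebra_simps)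
    then show ?thesis unfolding Phi_def[abs_def] E_def Bc
      by (rule DERIV_cong) (simp add: algebra_simps power2_eq_square)
  qed
  have ci: "continuous_on {0..pi} (integrand lam y)" 
    using i' by (intro continuous_at_imp_continuous_on ballI DERIV_isCont) blast
  have cd: "continuous_on {0..pi} (dintegrand lam y)"
    using continuous_on_compose2[OF continuous_on_dintegrand, of "{0..pi}" "\<lambda>x. (y,x)" lam] y
    by (simp add: continuous_intros image_subset_iff)
  have cB: "continuous_on {0..pi} (\<lambda>x. integrand lam y x * E x)"
  proof -
    have cw: "continuous_on {0..pi} (wave lam y)" "continuous_on {0..pi} (polar lam y)" "continuous_on {0..pi} (cofactor lam y)"
      using w' D' S' by (intro continuous_at_imp_continuous_on ballI DERIV_isCont; blast)+
    have cf: "continuous_on {0..pi} (\<lambda>x. f (wave lam y x))"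
      by (intro continuous_at_imp_continuous_on ballI DERIV_isCont) (use DERIV_chain2[OF f' w'] in blast)
    have cf': "continuous_on {0..pi} (\<lambda>x. f' (wave lam y x))" unfolding f'_def 
      unfolding divide_inverse by (intro continuous_intros cw)
    show ?thesis unfolding E_def using A(9,10) by (intro continuous_intros ci cw cf cf') (auto simp: less_imp_neq[symmetric])
  qed
  have P0: "((\<lambda>x. integrand lam y x * E x) has_integral (Phi pi - Phi 0)) {0..pi}"
    by (rule fundamental_theorem_of_calculus) 
      (auto simp: has_real_derivative_iff_has_vector_derivative[symmetric] intro: has_field_derivative_at_within Phi')
  have Phi0: "Phi pi - Phi 0 = 0" by (simp add: Phi_def)
  have key: "dintegrand lam y x + integrand lam y x * E x < 0" if "0 < x" "x < pi" for x
  proof -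
    have w0: "0 < s * wave lam y x - (wave lam y x)^2 - p"
      unfolding s_def p_def A(12) using A(6) sin_gt_zero[OF that] by simp
    have h0: "0 < integrand lam y x" unfolding integrand_def using A(9,10,11) by simp
    have r: "((s+s/p^2)/2)^2 - p - 1/p = r" unfolding r_def radsq_def p_def[symmetric] yr(1)[symmetric] ..
    have Y: "wave lam y x + (s/p^2 - s)/2 = wave lam y x + 2*lam" using yr(2) by simp
    have D: "r - (wave lam y x + 2*lam)^2 = polar lam y x" unfolding polar_def r_def ..
    have S: "(wave lam y x)^2 + s/p^2*wave lam y x + 1/p = cofactor lam y x" unfolding cofactor_def b_def[symmetric] p_def[symmetric] b ..
    have rd: "cert_nu s p/(2 * s*p^3) = dradsq lam y" "p*(1-p^2)/(2 * s) = dprod lam y" unfolding dradsq_def dprod_def s_def p_def by auto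
    have td: "1/2 + (1/2)*((2 * s-4*dprod lam y)/(s^2-4*p))*(wave lam y x - s/2) = dwave lam y x"
      unfolding dwave_def s_def p_def ..
    have sin: "(B * sin x)^2 = s * wave lam y x - (wave lam y x)^2 - p" unfolding s_def p_def A(12) B_def ..
    have "dradsq lam y/(2*r) - (dradsq lam y - 2*(wave lam y x + 2*lam)*dwave lam y x)/polar lam y x
     - (1/2)*((2*wave lam y x+s/p^2)*dwave lam y x + wave lam y x - dprod lam y/p^2)/cofactor lam y x 
      + (B * sin x)^2 * f' (wave lam y x)
      + (B * sin x)^2 * f (wave lam y x)*(2*(wave lam y x + 2*lam)/polar lam y x - (1/2)*(2*wave lam y x+s/p^2)/cofactor lam y x)
      + (1/2)*f (wave lam y x)*(s-2*wave lam y x) < 0"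
      using integrand_derivative_mod_exact[of p s "wave lam y x"] A(1,3,4,8,11) w0
      unfolding r Y D S rd td f_def f'_def sin s_def[symmetric] p_def[symmetric] r_def[symmetric] by blast
    from mult_pos_neg[OF h0 this] show ?thesis unfolding dintegrand_def E_def b r_def p_def s_def b[unfolded b_def s_def p_def]
      by (simp add: algebra_simps)
  qed
  have "integral {0..pi} (\<lambda>x. dintegrand lam y x + integrand lam y x * E x) < 0"
    by (rule integral_neg_interior) (auto intro!: continuous_intros cd cB key)
  moreover have "integral {0..pi} (\<lambda>x. dintegrand lam y x + integrand lam y x * E x) = integral {0..pi} (dintegrand lam y) + 0"
    using P0[unfolded Phi0] cd by (subst integral_add) (auto intro: integrable_continuous_real has_integral_integrable simp: integral_unique)
  ultimately show ?thesis by simp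
qed

section \<open>The half-line of admissible parameters and the monotonicity of \<open>Hfun\<close> on
  it\<close>

lemma admissible_iff:
  "y \<in> admissible lam \<longleftrightarrow> 0 < y - 2*lam \<and> 0 < y + 2*lam \<and> 16 < (y - 2*lam)^3 * (y + 2*lam)"
proof -
  have "4 * rootprod lam y < (y - 2*lam)^2 \<longleftrightarrow> 16 < (y - 2*lam)^3 * (y + 2*lam)" 
    if s: "0 < y - 2*lam" and b: "0 < y + 2*lam"
  proof -
    have "4 * rootprod lam y < (y - 2*lam)^2 \<longleftrightarrow> (4 * rootprod lam y)^2 < ((y - 2*lam)^2)^2"
      using s b power_mono_iff[of "(y - 2*lam)^2" "4 * rootprod lam y" 2] by (simp add: rootprod_def flip: not_le)
    also have "(4 * rootprod lam y)^2 = 16 * ((y - 2*lam)/(y + 2*lam))"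
      using s b by (simp add: rootprod_def power_mult_distrib)
    also have "16 * ((y - 2*lam)/(y + 2*lam)) < ((y - 2*lam)^2)^2 \<longleftrightarrow> 16 * (y - 2*lam) < ((y - 2*lam)^2)^2 * (y + 2*lam)"
      using b by (simp add: pos_divide_less_eq)
    also have "((y - 2*lam)^2)^2 * (y + 2*lam) = ((y - 2*lam)^3 * (y + 2*lam)) * (y - 2*lam)"
      by (simp add: eval_nat_numeral)
    finally show ?thesis unfolding mult_less_cancel_right_pos[OF s] .
  qed
  then show ?thesis by (auto simp: admissible_def)
qed

lemma admissible_upward:
  assumes "y \<in> admissible lam" "y \<le> z" shows "z \<in> admissible lam"
proof -
  have y: "0 < y - 2*lam" "0 < y + 2*lam" "16 < (y - 2*lam)^3 * (y + 2*lam)" using assms by (auto simp: admissible_iff)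
  have "(y - 2*lam)^3 * (y + 2*lam) \<le> (z - 2*lam)^3 * (z + 2*lam)"
    using y assms by (intro mult_mono power_mono) auto
  then show ?thesis using y assms(2) by (auto simp: admissible_iff)
qed

lemma open_admissible: "open (admissible lam)"
proof -
  have "admissible lam = {y. 0 < y - 2*lam} \<inter> {y. 0 < y + 2*lam} \<inter> {y. 16 < (y - 2*lam)^3 * (y + 2*lam)}"
    by (auto simp: admissible_iff)
  also have "open \<dots>" by (intro open_Int open_Collect_less continuous_intros)
  finally show ?thesis .
qed

lemma is_interval_admissible: "is_interval (admissible lam)"
  unfolding is_interval_1 using admissible_upward by blast

lemma admissible_nonempty: "admissible lam \<noteq> {}"
proof -
  \<comment> \<open>Both \<open>y - 2*lam\<close> and \<open>y + 2*lam\<close> are at least 3 here,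
    and \<open>3^3 * 3\<close> exceeds 16.\<close>
  have "2*\<bar>lam\<bar> + 3 \<in> admissible lam"
  proof -
    have "3^3 * 3 \<le> (2*\<bar>lam\<bar> + 3 - 2*lam)^3 * (2*\<bar>lam\<bar> + 3 + 2*lam)"
      by (intro mult_mono power_mono) auto
    then show ?thesis by (auto simp: admissible_iff)
  qed
  then show ?thesis by blast
qed

lemma DERIV_Hfun:
  assumes y: "y \<in> admissible lam"
  shows "(Hfun lam has_real_derivative integral {0..pi} (dintegrand lam y)) (at y)"
proof -
  have "((\<lambda>y. integral (cbox 0 pi) (integrand lam y)) has_field_derivative integral (cbox 0 pi) (dintegrand lam y)) (at y within admissible lam)"
  proof (rule leibniz_rule_field_derivative[OF _ _ _ y])
    show "((\<lambda>y. integrand lam y x) has_real_derivative dintegrand lam z x) (at z within admissible lam)" if "z \<in> admissible lam" for z x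
      using DERIV_integrand[OF that] by (rule has_field_derivative_at_within)
    show "integrand lam z integrable_on cbox 0 pi" if "z \<in> admissible lam" for z
    proof -
      have "continuous_on (cbox 0 pi) (\<lambda>x. (\<lambda>(y, x). integrand lam y x) (z, x))"
        by (rule continuous_on_compose2[OF continuous_on_integrand]) (use that in \<open>auto intro!: continuous_intros\<close>)
      then show ?thesis by (intro integrable_continuous) simp
    qed
    show "continuous_on (admissible lam \<times> cbox 0 pi) (\<lambda>(y, x). dintegrand lam y x)"
      by (rule continuous_on_subset[OF continuous_on_dintegrand]) auto
    show "convex (admissible lam)" using is_interval_admissible is_interval_convex by blast
  qed
  then show ?thesis unfolding at_within_open[OF y open_admissible] Hfun_def[abs_def] cbox_interval .
qed

lemma Hfun_strict_decreasing:
  assumes "y \<in> admissible lam" "y < z" shows "Hfun lam z < Hfun lam y"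
  using assms(2)
proof (rule DERIV_neg_imp_decreasing)
  fix x assume "y \<le> x" "x \<le> z"
  then have "x \<in> admissible lam" using admissible_upward assms(1) by blast
  then show "\<exists>D. (Hfun lam has_real_derivative D) (at x) \<and> D < 0"
    using DERIV_Hfun dintegrand_integral_neg by blast
qed

text \<open>Injectivity from strict monotonicity gives openness by invariance of domain;
  connectedness gives the interval.\<close>

lemma Hfun_image:
  "open ((\<lambda>y. 2*pi - Hfun lam y) ` admissible lam)"
  "is_interval ((\<lambda>y. 2*pi - Hfun lam y) ` admissible lam)"
proof -
  have c: "continuous_on (admissible lam) (\<lambda>y. 2*pi - Hfun lam y)"
    by (intro continuous_intros continuous_at_imp_continuous_on ballI DERIV_isCont[OF DERIV_Hfun])
  have i: "inj_on (\<lambda>y. 2*pi - Hfun lam y) (admissible lam)"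
    by (rule linorder_inj_onI') (use Hfun_strict_decreasing in fastforce)
  show "open ((\<lambda>y. 2*pi - Hfun lam y) ` admissible lam)"
    by (rule invariance_of_domain[OF c open_admissible i])
  show "is_interval ((\<lambda>y. 2*pi - Hfun lam y) ` admissible lam)"
    using connected_continuous_image[OF c] is_interval_admissible by (simp add: is_interval_connected_1)
qed

section \<open>Repeatedly differentiable functions on the line\<close>

text \<open>The derivative is an existential witness, so closure rules are plain inductions on
  \<open>k\<close> with the usual derivative rules; only \<open>smoothI\<close> deals with the
  iterated \<open>vector_derivative\<close>.\<close>

fun times_differentiable :: "nat \<Rightarrow> (real \<Rightarrow> 'a::real_normed_vector) \<Rightarrow> bool" where
  "times_differentiable 0 f \<longleftrightarrow> True"
| "times_differentiable (Suc k) f \<longleftrightarrow>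
    (\<exists>f'. (\<forall>s. (f has_vector_derivative f' s) (at s)) \<and> times_differentiable k f')"

lemma times_differentiable_SucI:
  "(\<And>s. (f has_vector_derivative f' s) (at s)) \<Longrightarrow> times_differentiable k f' \<Longrightarrow> times_differentiable (Suc k) f"
  by auto

lemma times_differentiable_Suc_real:
  "times_differentiable (Suc k) f \<longleftrightarrow>
    (\<exists>f'. (\<forall>s. (f has_real_derivative f' s) (at s)) \<and> times_differentiable k f')"
  by (simp add: has_real_derivative_iff_has_vector_derivative)

lemma times_differentiable_Suc_realI:
  "(\<And>s. (f has_real_derivative f' s) (at s)) \<Longrightarrow> times_differentiable k f' \<Longrightarrow> times_differentiable (Suc k) f"
  using times_differentiable_Suc_real by blast

lemma times_differentiable_Suc_imp: "times_differentiable (Suc k) f \<Longrightarrow> times_differentiable k f"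
proof (induction k arbitrary: f)
  case (Suc k)
  then obtain f' where "\<forall>s. (f has_vector_derivative f' s) (at s)" "times_differentiable (Suc k) f'"
    by (auto simp del: times_differentiable.simps(2) simp: times_differentiable.simps(2)[of "Suc k"])
  then show ?case using Suc.IH by auto
qed simp

lemma smoothI:
  assumes "\<And>k. times_differentiable k f" shows "smooth f"
proof -
  let ?D = "\<lambda>g t. vector_derivative g (at t)"
  have "\<forall>k. times_differentiable k ((?D ^^ n) f)" for n
  proof (induction n)
    case (Suc n)
    show ?case
    proof
      fix k
      from Suc obtain g where g: "\<forall>s. ((?D ^^ n) f has_vector_derivative g s) (at s)" "times_differentiable k g"
        using times_differentiable.simps(2) by blast
      then have "(?D ^^ Suc n) f = g" by (auto intro!: ext simp: vector_derivative_at)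
      then show "times_differentiable k ((?D ^^ Suc n) f)" using g by simp
    qed
  qed (use assms in simp)
  then show ?thesis unfolding smooth_def
    by (meson times_differentiable.simps(2) has_vector_derivative_def differentiable_def)
qed

lemma times_differentiable_const [intro, simp]: "times_differentiable k (\<lambda>_. c)"
proof (induction k arbitrary: c)
  case (Suc k)
  show ?case by (rule times_differentiable_SucI[of _ "\<lambda>_. 0"]) (auto intro: Suc)
qed simp

lemma times_differentiable_add [intro]:
  "times_differentiable k f \<Longrightarrow> times_differentiable k g \<Longrightarrow> times_differentiable k (\<lambda>s. f s + g s)"
proof (induction k arbitrary: f g)
  case (Suc k)
  then obtain f' g' where "\<forall>s. (f has_vector_derivative f' s) (at s)" "times_differentiable k f'"
     "\<forall>s. (g has_vector_derivative g' s) (at s)" "times_differentiable k g'" by auto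
  then show ?case by (intro times_differentiable_SucI[of _ "\<lambda>s. f' s + g' s"] Suc.IH) (auto intro: has_vector_derivative_add)
qed simp

lemma times_differentiable_scaleR [intro]:
  fixes f :: "real \<Rightarrow> real"
  shows "times_differentiable k f \<Longrightarrow> times_differentiable k g \<Longrightarrow> times_differentiable k (\<lambda>s. f s *\<^sub>R g s)"
proof (induction k arbitrary: f g)
  case (Suc k)
  note t = Suc.prems[THEN times_differentiable_Suc_imp]
  from Suc.prems obtain f' g' where d: "\<forall>s. (f has_real_derivative f' s) (at s)" "times_differentiable k f'"
     "\<forall>s. (g has_vector_derivative g' s) (at s)" "times_differentiable k g'" 
    unfolding times_differentiable_Suc_real[of k f] by auto
  show ?case
    by (rule times_differentiable_SucI[of _ "\<lambda>s. f s *\<^sub>R g' s + f' s *\<^sub>R g s"])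
      (use d in \<open>auto intro!: has_vector_derivative_scaleR times_differentiable_add Suc.IH t\<close>)
qed simp

lemma times_differentiable_mult [intro]:
  fixes f g :: "real \<Rightarrow> real"
  shows "times_differentiable k f \<Longrightarrow> times_differentiable k g \<Longrightarrow> times_differentiable k (\<lambda>s. f s * g s)"
  using times_differentiable_scaleR[of k f g] by simp

lemma times_differentiable_uminus [intro]:
  fixes f :: "real \<Rightarrow> real"
  shows "times_differentiable k f \<Longrightarrow> times_differentiable k (\<lambda>s. - f s)"
  using times_differentiable_mult[of k "\<lambda>_. -1" f] by simp

lemma times_differentiable_diff [intro]:
  fixes f g :: "real \<Rightarrow> real"
  shows "times_differentiable k f \<Longrightarrow> times_differentiable k g \<Longrightarrow> times_differentiable k (\<lambda>s. f s - g s)"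
  using times_differentiable_add[of k f "\<lambda>s. - g s"] by auto

lemma times_differentiable_power [intro]:
  fixes f :: "real \<Rightarrow> real"
  shows "times_differentiable k f \<Longrightarrow> times_differentiable k (\<lambda>s. f s ^ n)"
  by (induction n) auto

lemma times_differentiable_inverse:
  fixes f :: "real \<Rightarrow> real"
  shows "times_differentiable k f \<Longrightarrow> (\<And>s. f s \<noteq> 0) \<Longrightarrow> times_differentiable k (\<lambda>s. inverse (f s))"
proof (induction k)
  case (Suc k)
  from Suc.prems obtain f' where d: "\<forall>s. (f has_real_derivative f' s) (at s)" "times_differentiable k f'"
    unfolding times_differentiable_Suc_real by auto
  have "times_differentiable k (\<lambda>s. inverse (f s))" using Suc times_differentiable_Suc_imp by blast
  then show ?case using d Suc.prems(2)
    by (intro times_differentiable_Suc_realI[of _ "\<lambda>s. - (inverse (f s) * f' s * inverse (f s))"]) 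
      (auto intro!: DERIV_inverse' times_differentiable_uminus times_differentiable_mult)
qed simp

lemma times_differentiable_divide:
  fixes f g :: "real \<Rightarrow> real"
  shows "times_differentiable k f \<Longrightarrow> times_differentiable k g \<Longrightarrow> (\<And>s. g s \<noteq> 0) \<Longrightarrow> times_differentiable k (\<lambda>s. f s / g s)"
  unfolding divide_inverse by (intro times_differentiable_mult times_differentiable_inverse)

lemma times_differentiable_sqrt:
  fixes f :: "real \<Rightarrow> real"
  shows "times_differentiable k f \<Longrightarrow> (\<And>s. 0 < f s) \<Longrightarrow> times_differentiable k (\<lambda>s. sqrt (f s))"
proof (induction k)
  case (Suc k)
  from Suc.prems obtain f' where d: "\<forall>s. (f has_real_derivative f' s) (at s)" "times_differentiable k f'"
    unfolding times_differentiable_Suc_real by auto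
  have "times_differentiable k (\<lambda>s. sqrt (f s))" using Suc times_differentiable_Suc_imp by blast
  then have "times_differentiable k (\<lambda>s. inverse (sqrt (f s)))"
    by (rule times_differentiable_inverse) (use Suc.prems(2) in \<open>simp add: less_imp_neq[symmetric]\<close>)
  moreover have "((\<lambda>s. sqrt (f s)) has_real_derivative inverse (sqrt (f s)) * (f' s * (1/2))) (at s)" for s
    by (rule DERIV_cong, rule DERIV_chain2[OF DERIV_real_sqrt]) (use d Suc.prems(2) in auto)
  ultimately show ?case using d(2)
    by (intro times_differentiable_Suc_realI[of _ "\<lambda>s. inverse (sqrt (f s)) * (f' s * (1/2))"] times_differentiable_mult) auto
qed simp

lemma times_differentiable_sin_cos:
  fixes f :: "real \<Rightarrow> real"
  shows "times_differentiable k f \<Longrightarrow> times_differentiable k (\<lambda>s. sin (f s)) \<and> times_differentiable k (\<lambda>s. cos (f s))"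
proof (induction k)
  case (Suc k)
  from Suc.prems obtain f' where d: "\<And>s. (f has_real_derivative f' s) (at s)" "times_differentiable k f'"
    unfolding times_differentiable_Suc_real by auto
  have i: "times_differentiable k (\<lambda>s. sin (f s))" "times_differentiable k (\<lambda>s. cos (f s))"
    using Suc times_differentiable_Suc_imp by blast+
  have "((\<lambda>s. sin (f s)) has_real_derivative cos (f s) * f' s) (at s)" for s
    using DERIV_chain2[OF DERIV_sin d(1)] .
  moreover have "((\<lambda>s. cos (f s)) has_real_derivative - sin (f s) * f' s) (at s)" for s
    using DERIV_chain2[OF DERIV_cos d(1)] .
  ultimately show ?case using i d
    by (auto intro!: times_differentiable_Suc_realI simp del: times_differentiable.simps)
qed simp

lemma times_differentiable_sin: "times_differentiable k f \<Longrightarrow> times_differentiable k (\<lambda>s. sin (f s :: real))"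
  and times_differentiable_cos: "times_differentiable k f \<Longrightarrow> times_differentiable k (\<lambda>s. cos (f s :: real))"
  using times_differentiable_sin_cos by blast+

text \<open>Bootstrapping: the right-hand side inherits the regularity of the solution, and the
  solution is one order better than its derivative.\<close>

lemma times_differentiable_ode:
  fixes f :: "real \<Rightarrow> real"
  assumes "\<And>s. (f has_real_derivative g s) (at s)" "\<And>k. times_differentiable k f \<Longrightarrow> times_differentiable k g"
  shows "times_differentiable k f"
proof (induction k)
  case (Suc k)
  then show ?case using assms(2) by (intro times_differentiable_Suc_realI[OF assms(1)]) auto
qed simp

lemma vector_3_axis: "(vector [a, b, c] :: real^3) = a *\<^sub>R axis 1 1 + b *\<^sub>R axis 2 1 + c *\<^sub>R axis 3 1"
  by (simp add: vec_eq_iff forall_3 axis_def)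

lemma times_differentiable_vector_3:
  assumes "times_differentiable k f" "times_differentiable k g" "times_differentiable k h"
  shows "times_differentiable k (\<lambda>s. vector [f s, g s, h s] :: real^3)"
  unfolding vector_3_axis 
  by (intro times_differentiable_add times_differentiable_scaleR times_differentiable_const assms)

lemma has_vector_derivative_vector_3:
  assumes "(f has_real_derivative f') (at s)" "(g has_real_derivative g') (at s)" "(h has_real_derivative h') (at s)"
  shows "((\<lambda>s. vector [f s, g s, h s] :: real^3) has_vector_derivative vector [f', g', h']) (at s)"
  unfolding vector_3_axis using assms
  by (auto intro!: has_vector_derivative_add has_vector_derivative_scaleR[where g'=0, simplified])

section \<open>Ordinary differential equations\<close>

text \<open>The flow is the inverse of the time function \<open>F\<close>, the antiderivative of
  \<open>1/G\<close>. Periodicity gives \<open>F (x + c) = F x + omega\<close>, so \<open>F\<close>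
  is unbounded both ways and the flow is global. Evenness makes \<open>F\<close> odd; with the shift
  this locates \<open>phi (omega/2)\<close>.\<close>

lemma periodic_autonomous_flow:
  fixes G :: "real \<Rightarrow> real"
  assumes cont: "continuous_on UNIV G" and pos: "\<And>x. 0 < G x" and c: "0 < c"
    and per: "\<And>x. G (x + c) = G x" and even: "\<And>x. G (- x) = G x"
  obtains phi omega where "\<And>s. (phi has_real_derivative G (phi s)) (at s)" "phi 0 = 0" "0 < omega"
    "\<And>s. phi (s + omega) = phi s + c" "phi omega = c" "phi (omega/2) = c/2" "strict_mono phi"
proof -
  have "\<exists>F. \<forall>x :: real. (-\<infinity>::ereal) < x \<longrightarrow> x < (\<infinity>::ereal) \<longrightarrow> (F has_vector_derivative inverse (G x)) (at x)"
  proof (rule einterval_antiderivative)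
    fix x :: real
    have "isCont G x" using cont by (simp add: continuous_on_eq_continuous_at)
    then show "isCont (\<lambda>x. inverse (G x)) x" using pos[of x] by (intro continuous_intros) auto
  qed simp
  then obtain F0 where F0: "\<And>x. (F0 has_real_derivative inverse (G x)) (at x)"
    by (auto simp: has_real_derivative_iff_has_vector_derivative)
  define F where "F x = F0 x - F0 0" for x
  have F: "(F has_real_derivative inverse (G x)) (at x)" for x
    unfolding F_def[abs_def] using F0 by (auto intro!: derivative_eq_intros)
  have F00: "F 0 = 0" by (simp add: F_def)
  have mono: "F x < F y" if "x < y" for x y
    using that F pos by (intro DERIV_pos_imp_increasing[OF that]) (meson positive_imp_inverse_positive)
  have cF: "isCont F x" for x using F by (rule DERIV_isCont)
  define omega where "omega = F c"
  have om: "0 < omega" using mono[OF c] F00 by (simp add: omega_def)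
  have shift: "F (x + c) = F x + omega" for x
  proof -
    have "((\<lambda>x. F (x + c) - F x) has_real_derivative 0) (at x)" for x
    proof -
      have "((\<lambda>x. F (x + c)) has_real_derivative inverse (G (x + c)) * 1) (at x)"
        by (rule DERIV_chain2[OF F]) (auto intro!: derivative_eq_intros)
      from DERIV_diff[OF this F[of x]] show ?thesis by (simp add: per)
    qed
    then have "F (x + c) - F x = F (0 + c) - F 0" by (rule DERIV_isconst_all[OF allI])
    then show ?thesis by (simp add: omega_def F00)
  qed
  have odd: "F (- x) = - F x" for x
  proof -
    have "((\<lambda>x. F (- x) + F x) has_real_derivative 0) (at x)" for x
    proof -
      have "((\<lambda>x. F (- x)) has_real_derivative inverse (G (- x)) * - 1) (at x)"
        by (rule DERIV_chain2[OF F]) (auto intro!: derivative_eq_intros)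
      from DERIV_add[OF this F[of x]] show ?thesis by (simp add: even)
    qed
    then have "F (- x) + F x = F (- 0) + F 0" by (rule DERIV_isconst_all[OF allI])
    then show ?thesis by (simp add: F00)
  qed
  have Fn: "F (real n * c) = real n * omega" for n
  proof (induction n)
    case (Suc n)
    have "F (real n * c + c) = real n * omega + omega" using shift[of "real n * c"] Suc by simp
    then show ?case by (simp add: algebra_simps)
  qed (simp add: F00)
  have surj: "\<exists>x. F x = s" for s
  proof -
    obtain n :: nat where n: "\<bar>s\<bar> / omega < real n" using reals_Archimedean2 by blast
    then have "\<bar>s\<bar> < real n * omega" using om by (simp add: pos_divide_less_eq)
    then have "F (- (real n * c)) \<le> s" "s \<le> F (real n * c)" unfolding odd Fn by auto
    moreover have "- (real n * c) \<le> real n * c" using c by (simp add: mult_nonneg_nonneg)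
    ultimately show ?thesis using IVT[of F "- (real n * c)" s "real n * c"] cF by blast
  qed
  define phi where "phi s = (SOME x. F x = s)" for s
  have Fphi: "F (phi s) = s" for s unfolding phi_def using surj by (rule someI_ex)
  have inj: "F x = F y \<Longrightarrow> x = y" for x y using mono by (metis less_irrefl linorder_neqE)
  have phiF: "phi (F x) = x" for x using inj Fphi by blast
  have cphi: "isCont phi s" for s
  proof -
    have "isCont phi (F (phi s))"
      by (rule isCont_inverse_function[of 1]) (use phiF cF in auto)
    then show ?thesis by (simp add: Fphi)
  qed
  show ?thesis
  proof
    show "(phi has_real_derivative G (phi s)) (at s)" for s
    proof -
      have "(phi has_real_derivative inverse (inverse (G (phi s)))) (at s)"
        by (rule DERIV_inverse_function[OF F _ _ _ _ cphi, where a = "s - 1" and b = "s + 1"]) (use pos[of "phi s"] Fphi in auto)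
      then show ?thesis by simp
    qed
    show "phi 0 = 0" using phiF[of 0] by (simp add: F00)
    show "0 < omega" by (rule om)
    show sh: "phi (s + omega) = phi s + c" for s
      using shift[of "phi s"] phiF by (metis Fphi)
    show "phi omega = c" using phiF by (simp add: omega_def)
    have "phi (- s) = - phi s" for s using odd[of "phi s"] phiF by (metis Fphi)
    then show "phi (omega/2) = c/2" using sh[of "- (omega/2)"] by simp
    show "strict_mono phi"
      by (rule strict_monoI) (metis Fphi mono linorder_neqE not_less_iff_gr_or_eq)
  qed
qed

text \<open>The bound on the absolute value of \<open>E'\<close> works in both time directions:
  \<open>E\<close> times \<open>exp (- C*s)\<close> does not increase, and \<open>E\<close> times
  \<open>exp (C*s)\<close> does not decrease.\<close>

lemma gronwall_zero:
  fixes E :: "real \<Rightarrow> real"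
  assumes d: "\<And>s. (E has_real_derivative E' s) (at s)" and b: "\<And>s. \<bar>E' s\<bar> \<le> C * E s" and z: "E s0 = 0"
    and n: "\<And>s. 0 \<le> E s"
  shows "E s = 0"
proof (cases "s0 \<le> s")
  case True
  have "E s * exp (- C * s) \<le> E s0 * exp (- C * s0)"
  proof (rule DERIV_nonpos_imp_nonincreasing[OF True])
    fix x
    have "((\<lambda>s. E s * exp (- C * s)) has_real_derivative (E' x - C * E x) * exp (- C * x)) (at x)"
      by (auto intro!: derivative_eq_intros d simp: algebra_simps)
    moreover have "(E' x - C * E x) * exp (- C * x) \<le> 0" using b[of x] by (intro mult_nonpos_nonneg) auto
    ultimately show "\<exists>y. ((\<lambda>s. E s * exp (- C * s)) has_real_derivative y) (at x) \<and> y \<le> 0" by blast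
  qed
  then show ?thesis using z n[of s] by (simp add: mult_le_0_iff) 
next
  case False
  then have le: "s \<le> s0" by simp
  have "E s * exp (C * s) \<le> E s0 * exp (C * s0)"
  proof (rule DERIV_nonneg_imp_nondecreasing[OF le])
    fix x
    have "((\<lambda>s. E s * exp (C * s)) has_real_derivative (E' x + C * E x) * exp (C * x)) (at x)"
      by (auto intro!: derivative_eq_intros d simp: algebra_simps)
    moreover have "0 \<le> (E' x + C * E x) * exp (C * x)" using b[of x] by (intro mult_nonneg_nonneg) auto
    ultimately show "\<exists>y. ((\<lambda>s. E s * exp (C * s)) has_real_derivative y) (at x) \<and> 0 \<le> y" by blast
  qed
  then show ?thesis using z n[of s] by (simp add: mult_le_0_iff)
qed

text \<open>Gronwall for the squared distance in phase space. The Lipschitz bound is asked only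
  along the two solutions, because the force of interest is a polynomial and Lipschitz only on
  bounded sets.\<close>

lemma second_order_ode_unique:
  fixes u v :: "real \<Rightarrow> real"
  assumes u: "\<And>s. (u has_real_derivative u' s) (at s)" "\<And>s. (u' has_real_derivative f (u s)) (at s)"
    and v: "\<And>s. (v has_real_derivative v' s) (at s)" "\<And>s. (v' has_real_derivative f (v s)) (at s)"
    and lip: "\<And>s. \<bar>f (u s) - f (v s)\<bar> \<le> L * \<bar>u s - v s\<bar>" and L: "0 \<le> L"
    and init: "u s0 = v s0" "u' s0 = v' s0"
  shows "u s = v s"
proof -
  define E where "E s = (u s - v s)^2 + (u' s - v' s)^2" for s
  have "E s = 0"
  proof (rule gronwall_zero[where E = E and C = "1 + L" and ?s0.0 = s0 and E' = "\<lambda>x. 2 * (u x - v x) * (u' x - v' x) + 2 * (u' x - v' x) * (f (u x) - f (v x))"])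
    show "(E has_real_derivative 2 * (u x - v x) * (u' x - v' x) + 2 * (u' x - v' x) * (f (u x) - f (v x))) (at x)" for x
      unfolding E_def[abs_def] by (auto intro!: derivative_eq_intros u v simp: algebra_simps)
    show "\<bar>2 * (u x - v x) * (u' x - v' x) + 2 * (u' x - v' x) * (f (u x) - f (v x))\<bar> \<le> (1 + L) * E x" for x
    proof -
      define a where "a = \<bar>u x - v x\<bar>"
      define b where "b = \<bar>u' x - v' x\<bar>"
      have ab: "2 * a * b \<le> a^2 + b^2" using sum_squares_bound[of a b] by simp
      have "\<bar>2 * (u x - v x) * (u' x - v' x) + 2 * (u' x - v' x) * (f (u x) - f (v x))\<bar>
        \<le> \<bar>2 * (u x - v x) * (u' x - v' x)\<bar> + \<bar>2 * (u' x - v' x) * (f (u x) - f (v x))\<bar>" by (rule abs_triangle_ineq)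
      also have "\<dots> = 2 * a * b + 2 * b * \<bar>f (u x) - f (v x)\<bar>" by (simp only: abs_mult a_def b_def abs_numeral)
      also have "\<dots> \<le> 2 * a * b + 2 * b * (L * a)"
        using lip[of x] by (intro add_left_mono mult_left_mono) (auto simp: a_def b_def)
      also have "\<dots> = (1 + L) * (2 * a * b)" by (simp add: algebra_simps)
      also have "\<dots> \<le> (1 + L) * (a^2 + b^2)" using ab L by (intro mult_left_mono) auto
      finally show ?thesis by (simp add: E_def a_def b_def)
    qed
    show "E s0 = 0" using init by (simp add: E_def)
    show "0 \<le> E x" for x by (simp add: E_def)
  qed
  then show ?thesis by (simp add: E_def sum_power2_eq_zero_iff)
qed

section \<open>The turning points\<close>

text \<open>A positive root of \<open>Q\<close> is thus a point where the hyperbola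
  \<open>X * (Y - 2*lam) = 1\<close> meets the circle of radius \<open>2*xi\<close>.\<close>

lemma Q_eq: "Q lam xi t = 1 - t^2 * (4*xi^2 - (t + 2*lam)^2)"
  unfolding Q_def by algebra

text \<open>Written as \<open>t^3 * (t + 2*lam) = 1\<close>, the left side increases strictly where
  both factors are positive, which holds from any positive solution on. At
  \<open>1 + 2*\<bar>lam\<bar>\<close> both factors are at least 1.\<close>

lemma quartic_root_ex1: "\<exists>!t. 0 < t \<and> t^4 + 2 * lam * t^3 - 1 = (0::real)"
proof -
  have "\<exists>t\<ge>0. t \<le> 1 + 2*\<bar>lam\<bar> \<and> t^4 + 2 * lam * t^3 - 1 = (0::real)"
  proof (rule IVT)
    have "1 * 1 \<le> (1 + 2*\<bar>lam\<bar>)^3 * (1 + 2*\<bar>lam\<bar> + 2*lam)"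
      by (intro mult_mono one_le_power) auto
    then show "0 \<le> (1 + 2*\<bar>lam\<bar>)^4 + 2 * lam * (1 + 2*\<bar>lam\<bar>)^3 - 1"
      by (simp add: algebra_simps eval_nat_numeral)
  qed auto
  then obtain t where t: "0 \<le> t" "t^4 + 2 * lam * t^3 - 1 = 0" by blast
  then have "0 < t" by (cases "t = 0") auto
  moreover have False if "0 < u" "u < v" "u^4 + 2 * lam * u^3 - 1 = 0" "v^4 + 2 * lam * v^3 - 1 = 0" for u v :: real
  proof -
    have e: "u^3 * (u + 2*lam) = 1" "v^3 * (v + 2*lam) = 1" using that by (auto simp: algebra_simps eval_nat_numeral)
    have "0 < u + 2*lam" using e(1) that(1) by (metis zero_less_mult_pos zero_less_one zero_less_power)
    then have "u^3 * (u + 2*lam) < v^3 * (v + 2*lam)" using that by (intro mult_strict_mono power_strict_mono) auto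
    then show False using e by simp
  qed
  ultimately show ?thesis using t(2) by (metis linorder_neqE)
qed

lemma eta: "0 < eta lam" "(eta lam)^3 * (eta lam + 2*lam) = 1"
  using theI'[OF quartic_root_ex1[of lam]] unfolding eta_def[symmetric] by (auto simp: algebra_simps eval_nat_numeral)

lemma eta_hat_sq: "4 * (eta_hat lam)^2 = (eta lam + 2*lam)^2 + 1/(eta lam)^2" and eta_hat_pos: "0 < eta_hat lam"
proof -
  have "0 \<le> 1 + (eta lam * (eta lam + 2*lam))^2" by simp
  then show "4 * (eta_hat lam)^2 = (eta lam + 2*lam)^2 + 1/(eta lam)^2"
    unfolding eta_hat_def power_mult_distrib using eta(1)[of lam] by (simp add: field_simps)
  show "0 < eta_hat lam" unfolding eta_hat_def using eta(1)[of lam] by (intro mult_pos_pos) (auto intro: add_pos_nonneg)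
qed

text \<open>The critical equation of \<open>(t + 2*lam)^2 + 1/t^2\<close> is the equation of
  \<open>eta\<close>, so \<open>2 * eta_hat\<close> is the distance from the origin to the branch
  \<open>X > 0\<close> of the hyperbola, attained only at \<open>eta\<close>.\<close>

lemma radius_min:
  assumes "0 < t" "t \<noteq> eta lam"
  shows "4 * (eta_hat lam)^2 < (t + 2*lam)^2 + 1/t^2"
proof -
  define e where "e = eta lam"
  have e: "0 < e" "e^3 * (e + 2*lam) = 1" using eta by (auto simp: e_def)
  have l: "2*lam = 1/e^3 - e" using e by (simp add: field_simps)
  have "(t + 2*lam)^2 + 1/t^2 - ((e + 2*lam)^2 + 1/e^2) = (t - e)^2 * (1 + 1/(t*e^3) + (t + e)/(e^3*t^2))"
  proof -
    have "((t + 2*lam)^2 + 1/t^2 - ((e + 2*lam)^2 + 1/e^2)) * (t^2*e^6) = ((t - e)^2 * (1 + 1/(t*e^3) + (t + e)/(e^3*t^2))) * (t^2*e^6)"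
      unfolding l using e(1) assms(1) by (simp add: field_simps) algebra
    then show ?thesis using e(1) assms(1) by simp
  qed
  moreover have "0 < (t - e)^2 * (1 + 1/(t*e^3) + (t + e)/(e^3*t^2))"
    using e(1) assms by (intro mult_pos_pos add_pos_pos divide_pos_pos) (auto simp: e_def)
  ultimately show ?thesis unfolding eta_hat_sq e_def by simp
qed

locale wave_data =
  fixes lam xi y :: real
  assumes adm: "y \<in> admissible lam" and xi_pos: "0 < xi" and xi_sq: "radsq lam y = 4*xi^2"
begin

abbreviation "s \<equiv> y - 2*lam"
abbreviation "b \<equiv> y + 2*lam"
abbreviation "p \<equiv> rootprod lam y"

lemmas facts = admissible_facts[OF adm]

lemma Q_wave: "Q lam xi t = - ((s*t - t^2 - p) * (t^2 + b*t + 1/p))"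
proof -
  have y: "(s + b)/2 = y" "(b - s)/2 = 2*lam" by auto
  show ?thesis using quartic_factor[OF facts(4), of s t] unfolding facts(5)[symmetric] y Q_eq
    using xi_sq by (simp add: radsq_def)
qed

lemma wave_roots: "wave lam y 0 * wave lam y pi = p" "wave lam y 0 + wave lam y pi = s" "wave lam y 0 < wave lam y pi"
proof -
  have "wave lam y 0 * wave lam y pi = (s/2)^2 - (halfdiff lam y)^2"
    unfolding wave_def by (simp add: algebra_simps power2_eq_square)
  then show "wave lam y 0 * wave lam y pi = p" unfolding facts(7) by (simp add: power_divide)
qed (use facts(6) in \<open>auto simp: wave_def field_simps\<close>)

lemma quad_wave: "s*t - t^2 - p = (wave lam y pi - t) * (t - wave lam y 0)"
  unfolding wave_roots(1,2)[symmetric] by (simp add: algebra_simps power2_eq_square)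

lemma cofactor_pos: "0 < t \<Longrightarrow> 0 < t^2 + b*t + 1/p"
  using facts(2,4) by (intro add_pos_pos) auto

lemma pos_roots: "{t. 0 < t \<and> Q lam xi t = 0} = {wave lam y 0, wave lam y pi}"
proof -
  have "Q lam xi t = 0 \<longleftrightarrow> t = wave lam y 0 \<or> t = wave lam y pi" if "0 < t" for t
    using cofactor_pos[OF that] unfolding Q_wave quad_wave by auto
  then show ?thesis using facts(8) by auto
qed

lemma e1: "e1 lam xi = wave lam y pi" and e2: "e2 lam xi = wave lam y 0"
  unfolding e1_def e2_def pos_roots using wave_roots(3) by auto

text \<open>Two distinct roots cannot both be the strict minimizer \<open>eta\<close>.\<close>

lemma xi_gt: "eta_hat lam < xi"
proof -
  have "wave lam y 0 \<noteq> eta lam \<or> wave lam y pi \<noteq> eta lam" using wave_roots(3) by auto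
  then obtain t where t: "t \<in> {wave lam y 0, wave lam y pi}" "t \<noteq> eta lam" by blast
  then have q: "0 < t" "Q lam xi t = 0" using pos_roots by auto
  then have "4*xi^2 = (t + 2*lam)^2 + 1/t^2" unfolding Q_eq by (simp add: field_simps)
  then have "(eta_hat lam)^2 < xi^2" using radius_min[OF q(1) t(2)] by simp
  then show ?thesis using xi_pos by (rule power2_less_imp_less[OF _ less_imp_le])
qed

end

text \<open>\<open>Q\<close> is 1 at \<open>0\<close>, negative at \<open>eta\<close> and
  nonnegative far out, so it has a root on either side of \<open>eta\<close>; their sum determines
  \<open>y\<close>.\<close>

lemma wave_data_of_xi:
  assumes "eta_hat lam < xi"
  shows "\<exists>y. wave_data lam xi y"
proof -
  have xi: "0 < xi" using assms eta_hat_pos[of lam] by simp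
  define e where "e = eta lam"
  have e: "0 < e" using eta by (simp add: e_def)
  have "(eta_hat lam)^2 < xi^2" using assms eta_hat_pos[of lam] by (intro power_strict_mono) auto
  then have "(e + 2*lam)^2 + 1/e^2 < 4*xi^2" using eta_hat_sq[of lam] by (simp add: e_def)
  then have "e^2 * ((e + 2*lam)^2 + 1/e^2) < e^2 * (4*xi^2)" using e by (intro mult_strict_left_mono) auto
  then have Qe: "Q lam xi e < 0" unfolding Q_eq using e by (simp add: algebra_simps)
  have cont: "isCont (Q lam xi) t" for t unfolding Q_def[abs_def] by (intro continuous_intros)
  obtain d where d: "0 \<le> d" "d \<le> e" "Q lam xi d = 0"
    using IVT2[of "Q lam xi" e 0 0] Qe e cont by (auto simp: Q_def)
  \<comment> \<open>Large enough for \<open>T + 2*lam >= 2*xi\<close>, which makes \<open>Q\<close>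
    at least 1.\<close>
  define T where "T = 2*\<bar>lam\<bar> + 2*xi + e"
  have "0 \<le> Q lam xi T"
  proof -
    have "(2*xi)^2 \<le> (T + 2*lam)^2" using xi e by (intro power_mono) (auto simp: T_def)
    then have "T^2 * (4*xi^2 - (T + 2*lam)^2) \<le> 0" by (intro mult_nonneg_nonpos) (auto simp: power_mult_distrib)
    then show ?thesis unfolding Q_eq by simp
  qed
  moreover have "e \<le> T" using xi by (simp add: T_def)
  ultimately obtain a where a: "e \<le> a" "Q lam xi a = 0"
    using IVT[of "Q lam xi" e 0 T] Qe cont by auto
  have ne: "d < e" "e < a" using Qe d(2,3) a by (auto simp: less_le)
  have d0: "0 < d" using d by (cases "d = 0") (auto simp: Q_def)
  have a0: "0 < a" using ne e by simp
  define y where "y = a + d + 2*lam"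
  define p where "p = a * d"
  have p: "0 < p" using a0 d0 by (simp add: p_def)
  have qa: "a^2 * (4*xi^2 - (a + 2*lam)^2) = 1" and qd: "d^2 * (4*xi^2 - (d + 2*lam)^2) = 1"
    using a(2) d(3) unfolding Q_eq by auto
  have bq: "a + d + 4*lam = (a + d)/p^2"
  proof -
    \<comment> \<open>Eliminating \<open>xi\<close> from the two root equations leaves the factor
      \<open>a - d\<close>, which is cancelled next.\<close>
    have "(a - d) * (a^2*d^2*(a + d + 4*lam)) = (a - d) * (a + d)" using qa qd by algebra
    then have "a^2*d^2*(a + d + 4*lam) = a + d" using ne by simp
    then have "(a + d + 4*lam) * p^2 = a + d" unfolding p_def power_mult_distrib by (simp only: mult.commute)
    then show ?thesis by (rule nonzero_eq_divide_eq[THEN iffD2, rotated]) (use p in simp)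
  qed
  have s: "y - 2*lam = a + d" "y + 2*lam = (a + d)/p^2" using bq by (auto simp: y_def)
  have rp: "rootprod lam y = p" unfolding rootprod_def s using p a0 d0 by simp
  have "y \<in> admissible lam"
  proof -
    have "0 < (a - d)^2" using ne by simp
    then have "4 * p < (a + d)^2" unfolding p_def by (simp add: power2_eq_square algebra_simps)
    then have "0 < y - 2*lam" "0 < y + 2*lam" "4 * rootprod lam y < (y - 2*lam)^2"
      unfolding rp s using p a0 d0 by auto
    then show ?thesis by (simp add: admissible_def)
  qed
  moreover have "radsq lam y = 4*xi^2"
  proof -
    have y: "((a + d) + (a + d)/p^2)/2 = y" "((a + d)/p^2 - (a + d))/2 = 2*lam" using s by auto
    have "((a + d)*a - a^2 - p) = 0" by (simp add: p_def algebra_simps power2_eq_square)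
    then have "a^2 * (radsq lam y - (a + 2*lam)^2) = 1" using quartic_factor[OF p, of "a + d" a]
      unfolding y radsq_def rp by simp
    then have "a^2 * (radsq lam y - (a + 2*lam)^2) = a^2 * (4*xi^2 - (a + 2*lam)^2)" using qa by simp
    then show ?thesis using a0 by simp
  qed
  ultimately show ?thesis using xi by (intro exI[of _ y]) (simp add: wave_data_def)
qed

lemma wave_data_of_admissible:
  assumes "y \<in> admissible lam"
  shows "wave_data lam (sqrt (radsq lam y)/2) y"
  using admissible_facts(11)[OF assms] assms by unfold_locales (auto simp: power_divide)

section \<open>The normalized solution\<close>

text \<open>Half the derivative of \<open>- t^2 * Q\<close>: differentiating the equation for
  \<open>mu\<close> and cancelling \<open>2 * mu'\<close> yields
  \<open>mu'' = half_force mu\<close>.\<close>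

definition half_force :: "real \<Rightarrow> real \<Rightarrow> real \<Rightarrow> real" where
  "half_force lam xi t = - (3*t^5 + 10*lam*t^4 + 8*(lam^2 - xi^2)*t^3 + t)"

lemma DERIV_potential: "((\<lambda>t. - (t^2 * Q lam xi t)) has_real_derivative 2 * half_force lam xi t) (at t)"
  unfolding Q_def half_force_def by (auto intro!: derivative_eq_intros simp: eval_nat_numeral algebra_simps)

context wave_data
begin

text \<open>The two turning points are simple roots, so the slope of \<open>- t^2 * Q\<close> there
  is \<open>s - 2*e\<close> times a positive number.\<close>

lemma half_force_root:
  assumes "e \<in> {wave lam y 0, wave lam y pi}"
  shows "half_force lam xi e \<noteq> 0"
proof -
  define K where "K t = t^2 * (t^2 + b*t + 1/p)" for t
  define K' where "K' t = 2*t*(t^2 + b*t + 1/p) + t^2*(2*t + b)" for t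
  have K': "(K has_real_derivative K' t) (at t)" for t
    unfolding K_def[abs_def] K'_def using facts(4) by (auto intro!: derivative_eq_intros simp: algebra_simps eval_nat_numeral)
  have A: "((\<lambda>t. (s*t - t^2 - p) * K t) has_real_derivative (s - 2*e) * K e + (s*e - e^2 - p) * K' e) (at e)"
    by (auto intro!: derivative_eq_intros K')
  have B: "(\<lambda>t. (s*t - t^2 - p) * K t) = (\<lambda>t. - (t^2 * Q lam xi t))"
    unfolding Q_wave K_def by (simp add: algebra_simps)
  have "2 * half_force lam xi e = (s - 2*e) * K e + (s*e - e^2 - p) * K' e"
    by (rule DERIV_unique[OF DERIV_potential A[unfolded B]])
  also have "s*e - e^2 - p = 0" using assms unfolding quad_wave by auto
  finally have "2 * half_force lam xi e = (s - 2*e) * K e" by simp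
  moreover have "s - 2*e \<noteq> 0" using assms wave_roots(2,3) by auto
  moreover have "0 < e" using assms facts(8) by auto
  then have "0 < K e" unfolding K_def using cofactor_pos by simp
  ultimately show ?thesis by auto
qed

text \<open>Smoothness enters here: where \<open>u\<close> is stationary on an interval the second derivative
  vanishes, whereas it stays away from 0 at the turning points.\<close>

lemma normalized_solution_second_order:
  assumes "normalized_solution lam xi u"
  shows "(deriv u has_real_derivative half_force lam xi (u t)) (at t)"
proof -
  have sm: "smooth u" and pos: "\<And>t. 0 < u t" and nc: "\<not> u constant_on UNIV" 
    and sol: "\<And>t. (u has_real_derivative deriv u t) (at t)" "\<And>t. (deriv u t)^2 = - ((u t)^2 * Q lam xi (u t))"
    using assms by (auto simp: normalized_solution_def solves_Q_equation_def)
  let ?D = "\<lambda>g t. vector_derivative g (at t)"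
  have D1: "?D u = deriv u"
    using sol(1) by (auto intro!: ext vector_derivative_at simp: has_real_derivative_iff_has_vector_derivative)
  define u2 where "u2 = ?D (deriv u)"
  have "deriv u differentiable (at t)" for t
    using sm[unfolded smooth_def, rule_format, of 1 t] D1 by simp
  then have u2: "(deriv u has_real_derivative u2 t) (at t)" for t
    unfolding u2_def has_real_derivative_iff_has_vector_derivative using vector_derivative_works by blast
  have "u2 differentiable (at t)" for t
    using sm[unfolded smooth_def, rule_format, of 2 t] D1 by (simp add: u2_def eval_nat_numeral)
  then have cu2: "isCont u2 t" for t using differentiable_imp_continuous_within by blast
  \<comment> \<open>The defect of the second-order equation. Where it is nonzero, \<open>u\<close>
    rests at a turning point and the defect is minus the force there. So its absolute value is 0 or
    at least \<open>m\<close>, and by continuity it is zero everywhere or nowhere; the latter makes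
    \<open>u\<close> constant.\<close>
  define h where "h t = u2 t - half_force lam xi (u t)" for t
  have ch: "isCont h t" for t
    unfolding h_def half_force_def using cu2 DERIV_isCont[OF sol(1)] by (intro continuous_intros) auto
  have prod: "deriv u t * h t = 0" for t
  proof -
    have "((\<lambda>t. (deriv u t)^2) has_real_derivative 2 * deriv u t * u2 t) (at t)"
      by (auto intro!: derivative_eq_intros u2)
    moreover have "((\<lambda>t. - ((u t)^2 * Q lam xi (u t))) has_real_derivative 2 * half_force lam xi (u t) * deriv u t) (at t)"
      by (rule DERIV_chain2[OF DERIV_potential sol(1)])
    ultimately have "2 * deriv u t * u2 t = 2 * half_force lam xi (u t) * deriv u t"
      unfolding sol(2) by (rule DERIV_unique)
    then show ?thesis unfolding h_def by (simp add: algebra_simps)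
  qed
  define m where "m = min \<bar>half_force lam xi (wave lam y 0)\<bar> \<bar>half_force lam xi (wave lam y pi)\<bar>"
  have m: "0 < m" unfolding m_def using half_force_root by auto
  have gap: "m \<le> \<bar>h t\<bar>" if "h t \<noteq> 0" for t
  proof -
    have "\<forall>\<^sub>F x in nhds t. h x \<noteq> 0" 
      using ch[of t] that by (intro tendsto_imp_eventually_ne[of h "h t"]) (simp_all add: isCont_def tendsto_at_iff_tendsto_nhds)
    then have ev: "\<forall>\<^sub>F x in nhds t. deriv u x = 0" by (rule eventually_mono) (use prod in auto)
    have "(deriv u has_real_derivative 0) (at t)"
      by (rule DERIV_cong_ev[THEN iffD2, OF refl ev refl]) auto
    then have "u2 t = 0" using u2 DERIV_unique by blast
    moreover have "deriv u t = 0" using prod that by auto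
    then have "Q lam xi (u t) = 0" using sol(2)[of t] pos[of t] by auto
    then have "u t \<in> {wave lam y 0, wave lam y pi}" using pos pos_roots by blast
    ultimately show ?thesis unfolding h_def m_def by auto
  qed
  have "h t = 0"
  proof (rule ccontr)
    assume t: "h t \<noteq> 0"
    have "h x \<noteq> 0" for x
    proof
      assume x: "h x = 0"
      have "connected (range (\<lambda>t. \<bar>h t\<bar>))"
        using ch by (intro connected_continuous_image continuous_at_imp_continuous_on ballI continuous_intros) auto
      moreover have "0 \<in> range (\<lambda>t. \<bar>h t\<bar>)" "\<bar>h t\<bar> \<in> range (\<lambda>t. \<bar>h t\<bar>)" using x by force+
      ultimately have "m/2 \<in> range (\<lambda>t. \<bar>h t\<bar>)"
        by (rule connectedD_interval) (use m gap[OF t] in auto)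
      then obtain z where z: "\<bar>h z\<bar> = m/2" by auto
      then have "h z \<noteq> 0" using m by auto
      then show False using gap[of z] z m by auto
    qed
    then have "deriv u x = 0" for x using prod[of x] by auto
    then have "\<forall>x. (u has_real_derivative 0) (at x)" using sol(1) by metis
    then have "u x = u 0" for x by (rule DERIV_isconst_all)
    then show False using nc by (auto simp: constant_on_def)
  qed
  then show ?thesis using u2[of t] by (simp add: h_def)
qed

section \<open>Uniqueness of the normalized solution\<close>

lemma half_force_lipschitz:
  obtains L where "0 \<le> L" "\<And>x z. x \<in> {A..B} \<Longrightarrow> z \<in> {A..B} \<Longrightarrow> \<bar>half_force lam xi x - half_force lam xi z\<bar> \<le> L * \<bar>x - z\<bar>"
proof -
  define f' where "f' t = - (15*t^4 + 40*lam*t^3 + 24*(lam^2 - xi^2)*t^2 + 1)" for t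
  have d: "(half_force lam xi has_real_derivative f' t) (at t)" for t
    unfolding half_force_def[abs_def] f'_def by (auto intro!: derivative_eq_intros simp: algebra_simps)
  have "compact (f' ` {A..B})" unfolding f'_def by (intro compact_continuous_image continuous_intros) auto
  then obtain L where L: "0 < L" "\<And>t. t \<in> {A..B} \<Longrightarrow> norm (f' t) \<le> L"
    using compact_imp_bounded bounded_pos by (metis imageI)
  show ?thesis
  proof (rule that[of L])
    show "\<bar>half_force lam xi x - half_force lam xi z\<bar> \<le> L * \<bar>x - z\<bar>" if "x \<in> {A..B}" "z \<in> {A..B}" for x z
      using field_differentiable_bound[of "{A..B}" "half_force lam xi" f' L x z] L(2) that
        has_field_derivative_at_within[OF d] by auto
  qed (use L in auto)
qed

text \<open>Both derivatives vanish where \<open>e1\<close> is taken, so shifting one solution until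
  these points meet makes the initial data agree. Translates have the same least period, which
  forces the shift to be zero.\<close>

lemma normalized_solution_unique:
  assumes u: "normalized_solution lam xi u" "least_period u w" "u (w/2) = e1 lam xi"
    and v: "normalized_solution lam xi v" "least_period v om" "v (om/2) = e1 lam xi"
  shows "u = v" "w = om"
proof -
  define c where "c = w/2 - om/2"
  have sol: "\<And>t. (z has_real_derivative deriv z t) (at t)" "\<And>t. (deriv z t)^2 = - ((z t)^2 * Q lam xi (z t))"
     "\<And>t. z t \<in> {e2 lam xi..e1 lam xi}" if "normalized_solution lam xi z" for z
    using that by (auto simp: normalized_solution_def solves_Q_equation_def)
  have "e1 lam xi \<in> {t. 0 < t \<and> Q lam xi t = 0}" unfolding pos_roots e1 by simp
  then have "Q lam xi (e1 lam xi) = 0" by simp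
  then have d0: "deriv u (w/2) = 0" "deriv v (om/2) = 0" using sol(2)[OF u(1), of "w/2"] sol(2)[OF v(1), of "om/2"] u(3) v(3) by auto
  have sh: "((\<lambda>t. t + c) has_real_derivative 1) (at t)" for t by (auto intro!: derivative_eq_intros)
  obtain L where L: "0 \<le> L" "\<And>x z. x \<in> {e2 lam xi..e1 lam xi} \<Longrightarrow> z \<in> {e2 lam xi..e1 lam xi} \<Longrightarrow> 
     \<bar>half_force lam xi x - half_force lam xi z\<bar> \<le> L * \<bar>x - z\<bar>"
    using half_force_lipschitz by blast
  have uv: "u (t + c) = v t" for t
  proof (rule second_order_ode_unique[where u = "\<lambda>t. u (t + c)" and v = v and u' = "\<lambda>t. deriv u (t + c)" and v' = "deriv v"
        and f = "half_force lam xi" and L = L and ?s0.0 = "om/2"])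
    show "((\<lambda>t. u (t + c)) has_real_derivative deriv u (t + c)) (at t)" for t
      using DERIV_chain2[OF sol(1)[OF u(1)] sh] by simp
    show "((\<lambda>t. deriv u (t + c)) has_real_derivative half_force lam xi (u (t + c))) (at t)" for t
      using DERIV_chain2[OF normalized_solution_second_order[OF u(1)] sh] by simp
    show "(v has_real_derivative deriv v t) (at t)" for t using sol(1)[OF v(1)] .
    show "(deriv v has_real_derivative half_force lam xi (v t)) (at t)" for t
      using normalized_solution_second_order[OF v(1)] .
    show "\<bar>half_force lam xi (u (t + c)) - half_force lam xi (v t)\<bar> \<le> L * \<bar>u (t + c) - v t\<bar>" for t
      using L(2) sol(3)[OF u(1)] sol(3)[OF v(1)] by blast
    show "u (om/2 + c) = v (om/2)" "deriv u (om/2 + c) = deriv v (om/2)"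
      using d0 u(3) v(3) by (auto simp: c_def)
  qed (rule L)
  have vu: "u t = v (t - c)" for t using uv[of "t - c"] by simp
  have per: "(\<forall>t. u (t + q) = u t) \<longleftrightarrow> (\<forall>t. v (t + q) = v t)" for q
  proof
    assume "\<forall>t. u (t + q) = u t"
    then show "\<forall>t. v (t + q) = v t" unfolding uv[symmetric] by (metis add.assoc add.commute)
  next
    assume "\<forall>t. v (t + q) = v t"
    then show "\<forall>t. u (t + q) = u t" unfolding vu by (metis add_diff_eq add.commute)
  qed
  show "w = om" using u(2) v(2) unfolding least_period_def per by (meson order_antisym)
  then have "c = 0" by (simp add: c_def)
  then show "u = v" using uv by auto
qed

text \<open>With \<open>mu = wave (phi)\<close> the common factor \<open>halfdiff * sin phi\<close>
  drops out of the square root of the equation and \<open>phi' = speed phi\<close> remains: positive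
  and smooth, also at the turning points.\<close>

definition speed :: "real \<Rightarrow> real" where "speed x = wave lam y x * sqrt (cofactor lam y x)"

lemma DERIV_wave_phase: "(wave lam y has_real_derivative halfdiff lam y * sin x) (at x)"
  unfolding wave_def[abs_def] by (auto intro!: derivative_eq_intros)

lemma wave_bounds: "wave lam y 0 \<le> wave lam y x" "wave lam y x \<le> wave lam y pi"
proof -
  have "halfdiff lam y * cos x \<le> halfdiff lam y * 1" "halfdiff lam y * (-1) \<le> halfdiff lam y * cos x"
    using facts(6) by (intro mult_left_mono; simp)+
  then show "wave lam y 0 \<le> wave lam y x" "wave lam y x \<le> wave lam y pi" by (auto simp: wave_def)
qed

lemma times_differentiable_wave_comp:
  "times_differentiable k f \<Longrightarrow> times_differentiable k (\<lambda>t. wave lam y (f t))"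
  unfolding wave_def by (intro times_differentiable_diff times_differentiable_mult times_differentiable_cos) auto

lemma times_differentiable_phase:
  assumes "\<And>t. (phi has_real_derivative speed (phi t)) (at t)"
  shows "times_differentiable k phi"
proof (rule times_differentiable_ode[OF assms])
  fix k assume "times_differentiable k phi"
  note w = times_differentiable_wave_comp[OF this]
  show "times_differentiable k (\<lambda>t. speed (phi t))"
    unfolding speed_def cofactor_def
    by (intro times_differentiable_mult times_differentiable_sqrt times_differentiable_add times_differentiable_power 
        times_differentiable_const w) (rule facts(9)[unfolded cofactor_def])
qed

lemma wave_phase_normalized:
  assumes phi: "\<And>s. (phi has_real_derivative speed (phi s)) (at s)" "phi 0 = 0" "0 < om"
    "\<And>s. phi (s + om) = phi s + 2*pi" "phi om = 2*pi" "phi (om/2) = pi" "strict_mono phi"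
  shows "normalized_solution lam xi (\<lambda>s. wave lam y (phi s))" "least_period (\<lambda>s. wave lam y (phi s)) om"
proof -
  let ?v = "\<lambda>s. wave lam y (phi s)"
  have sm: "smooth ?v"
    by (intro smoothI times_differentiable_wave_comp times_differentiable_phase phi(1))
  have v': "(?v has_real_derivative halfdiff lam y * sin (phi s) * speed (phi s)) (at s)" for s
    by (rule DERIV_chain2[OF DERIV_wave_phase phi(1)])
  have sol: "solves_Q_equation lam xi ?v" unfolding solves_Q_equation_def
  proof (intro allI conjI)
    fix s
    have d: "deriv ?v s = halfdiff lam y * sin (phi s) * speed (phi s)" using v' by (rule DERIV_imp_deriv)
    then show "(?v has_real_derivative deriv ?v s) (at s)" using v' by simp
    have "(deriv ?v s)^2 = (halfdiff lam y * sin (phi s))^2 * ((?v s)^2 * cofactor lam y (phi s))"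
      unfolding d speed_def power_mult_distrib using facts(9)[of "phi s"] by simp
    then show "(deriv ?v s)^2 = - ((?v s)^2 * Q lam xi (?v s))"
      unfolding facts(12)[symmetric] Q_wave cofactor_def by (simp add: mult.left_commute)
  qed
  have v0: "?v 0 = e2 lam xi" "?v (om/2) = e1 lam xi" unfolding phi(2,6) e1 e2 by auto
  have lp: "least_period ?v om" unfolding least_period_def
  proof (intro conjI allI impI)
    show "?v (s + om) = ?v s" for s unfolding phi(4) by (simp add: wave_def)
    fix q assume q: "0 < q \<and> (\<forall>s. ?v (s + q) = ?v s)"
    then have "?v q = ?v 0" by (metis add_0)
    \<comment> \<open>The minimum is attained only at multiples of \<open>2*pi\<close>, so a period
      advances the phase, which starts at 0, by a positive multiple of \<open>2*pi\<close>.\<close>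
    then have "cos (phi q) = 1" using facts(6) by (simp add: wave_def phi(2))
    moreover have "0 < phi q" using phi(7) q phi(2) by (metis strict_monoD)
    moreover obtain n :: int where n: "phi q = of_int n * 2 * pi" using calculation(1) cos_one_2pi_int by blast
    ultimately have "0 < n" by (simp add: zero_less_mult_iff)
    then have "1 * (2*pi) \<le> of_int n * (2*pi)" by (intro mult_right_mono) auto
    then have "2*pi \<le> phi q" unfolding n by simp
    then show "om \<le> q" using phi(5,7) by (metis strict_mono_less_eq)
  qed (rule phi(3))
  then show "least_period ?v om" .
  have "\<not> ?v constant_on UNIV"
    using v0 wave_roots(3) unfolding e1 e2 constant_on_def by (metis UNIV_I less_irrefl)
  moreover have "e2 lam xi \<in> range ?v" "e1 lam xi \<in> range ?v" using v0 by (metis rangeI)+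
  ultimately show "normalized_solution lam xi ?v" unfolding normalized_solution_def
    using sm sol facts(8) wave_bounds v0 lp by (auto simp: e1[symmetric] e2[symmetric])
qed

text \<open>The phase flow supplies a normalized solution, and uniqueness identifies it with the one
  picked by \<open>SOME\<close>.\<close>

lemma mu_eq_wave:
  obtains phi where "\<And>s. (phi has_real_derivative speed (phi s)) (at s)" "phi 0 = 0" "0 < omega lam xi"
    "\<And>s. phi (s + omega lam xi) = phi s + 2*pi" "phi (omega lam xi) = 2*pi" "phi (omega lam xi/2) = pi" "strict_mono phi"
    "mu lam xi = (\<lambda>s. wave lam y (phi s))" "normalized_solution lam xi (mu lam xi)"
proof -
  have "continuous_on UNIV speed" unfolding speed_def cofactor_def wave_def by (intro continuous_intros)
  moreover have "0 < speed x" for x unfolding speed_def using facts(8,9) by simp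
  moreover have "speed (x + 2*pi) = speed x" "speed (- x) = speed x" for x
    unfolding speed_def cofactor_def wave_def by simp_all
  ultimately obtain phi om where phi: "\<And>s. (phi has_real_derivative speed (phi s)) (at s)" "phi 0 = 0" "0 < om"
    "\<And>s. phi (s + om) = phi s + 2*pi" "phi om = 2*pi" "phi (om/2) = 2*pi/2" "strict_mono phi"
    using periodic_autonomous_flow[of speed "2*pi"] by (metis pi_gt_zero zero_less_mult_iff zero_less_numeral)
  have phi6: "phi (om/2) = pi" using phi(6) by simp
  let ?v = "\<lambda>s. wave lam y (phi s)"
  note v = wave_phase_normalized[OF phi(1-5) phi6 phi(7)]
  have v1: "?v (om/2) = e1 lam xi" unfolding phi6 e1 ..
  have n: "normalized_solution lam xi (mu lam xi)" unfolding mu_def by (rule someI[where P = "normalized_solution lam xi", OF v(1)])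
  then obtain w where w: "least_period (mu lam xi) w" "mu lam xi (w/2) = e1 lam xi" unfolding normalized_solution_def by blast
  note eq = normalized_solution_unique[OF n w v v1]
  have om: "omega lam xi = om" unfolding omega_def
    using w(1) unfolding eq(2) by (rule the_equality) (metis least_period_def order_antisym w(1) eq(2))
  show ?thesis using that[of phi] phi(1-5,7) phi6 eq(1) n unfolding om by blast
qed

end

section \<open>The regularized period map\<close>

locale wave_flow = wave_data +
  fixes phi :: "real \<Rightarrow> real"
  assumes DERIV_phi: "\<And>s. (phi has_real_derivative speed (phi s)) (at s)"
    and phi_0: "phi 0 = 0" and omega_pos: "0 < omega lam xi"
    and phi_shift: "\<And>s. phi (s + omega lam xi) = phi s + 2*pi"
    and phi_omega: "phi (omega lam xi) = 2*pi" and phi_half: "phi (omega lam xi/2) = pi"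
    and phi_mono: "strict_mono phi"
    and mu_wave: "mu lam xi = (\<lambda>s. wave lam y (phi s))"
    and mu_normalized: "normalized_solution lam xi (mu lam xi)"

lemma (in wave_data) wave_flow_exists: "\<exists>phi. wave_flow lam xi y phi"
proof (rule mu_eq_wave)
  fix phi
  assume "\<And>s. (phi has_real_derivative speed (phi s)) (at s)" "phi 0 = 0" "0 < omega lam xi"
    "\<And>s. phi (s + omega lam xi) = phi s + 2*pi" "phi (omega lam xi) = 2*pi" "phi (omega lam xi/2) = pi" "strict_mono phi"
    "mu lam xi = (\<lambda>s. wave lam y (phi s))" "normalized_solution lam xi (mu lam xi)"
  then have "wave_flow lam xi y phi" by unfold_locales
  then show ?thesis by blast
qed

section \<open>The level curve on the sphere and its two angle forms\<close>

context wave_data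
begin

text \<open>Up to the factor \<open>wave^2\<close>, the squared distance from the
  \<open>X\<close>-axis; the denominator in \<open>angular_speed\<close> is its negative.\<close>

definition gap :: "real \<Rightarrow> real" where "gap x = 4*xi^2*(wave lam y x)^2 - 1"
definition height :: "real \<Rightarrow> real" where "height x = wave lam y x + 2*lam"

lemma polar_height: "polar lam y x = 4*xi^2 - (height x)^2"
  unfolding polar_def height_def xi_sq ..

text \<open>On the sphere this is \<open>wave^2 * (Z^2 + Y^2)\<close> with \<open>Z\<close> the
  third coordinate, hence nonnegative.\<close>

lemma gap_eq: "gap x = (halfdiff lam y * sin x)^2 * cofactor lam y x + (wave lam y x * height x)^2"
  using facts(13)[of x] unfolding facts(12) gap_def polar_height by (simp add: power_mult_distrib right_diff_distrib mult_ac)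

lemma gap_nonneg: "0 \<le> gap x" unfolding gap_eq using facts(9)[of x] by simp

lemma wave_ge: "1/(2*xi) \<le> wave lam y x"
proof -
  have "1^2 \<le> (2*xi*wave lam y x)^2" using gap_nonneg[of x] by (simp add: gap_def power_mult_distrib)
  then have "1 \<le> 2*xi*wave lam y x" using facts(8)[of x] xi_pos by (intro power2_le_imp_le[of 1]) auto
  then show ?thesis using xi_pos by (simp add: field_simps)
qed

text \<open>\<open>- 2*lam = 1/(2*xi)\<close> is then a root of \<open>Q\<close> and equals the
  lower bound \<open>wave_ge\<close>, so it is the smaller root: the curve meets the
  \<open>X\<close>-axis there.\<close>

lemma degenerate:
  assumes "4*lam*xi + 1 = 0"
  shows "2*lam = - wave lam y 0" "4*xi^2*(wave lam y 0)^2 = 1"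
proof -
  have l: "- 2*lam = 1/(2*xi)" using assms xi_pos by (simp add: field_simps)
  then have "0 < - 2*lam" using xi_pos by simp
  moreover have "Q lam xi (- 2*lam) = 0" unfolding Q_eq l using xi_pos l by (simp add: power_divide power_mult_distrib)
  ultimately have "- 2*lam \<in> {wave lam y 0, wave lam y pi}" using pos_roots by blast
  moreover have "- 2*lam \<noteq> wave lam y pi" using wave_ge[of 0] wave_roots(3) l by simp
  ultimately show "2*lam = - wave lam y 0" by simp
  then have "wave lam y 0 = 1/(2*xi)" using l by simp
  then show "4*xi^2*(wave lam y 0)^2 = 1" using xi_pos by (simp add: power_divide power_mult_distrib)
qed

lemma gap_zero_iff: "gap x = 0 \<longleftrightarrow> 4*lam*xi + 1 = 0 \<and> wave lam y x = wave lam y 0"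
proof
  assume g: "gap x = 0"
  moreover have "0 \<le> (halfdiff lam y * sin x)^2 * cofactor lam y x" using facts(9)[of x] by simp
  moreover have "0 \<le> (wave lam y x * height x)^2" by simp
  ultimately have "(wave lam y x * height x)^2 = 0" using gap_eq[of x] by linarith
  then have h: "wave lam y x = - 2*lam" using facts(8)[of x] by (simp add: height_def)
  have "(2*xi*wave lam y x)^2 = 1^2" using g by (simp add: gap_def power_mult_distrib)
  then have "2*xi*wave lam y x = 1" 
    by (rule power2_eq_imp_eq) (use facts(8)[of x] xi_pos in simp_all)
  then have d: "4*lam*xi + 1 = 0" unfolding h by (simp add: algebra_simps)
  show "4*lam*xi + 1 = 0 \<and> wave lam y x = wave lam y 0" using d degenerate(1)[OF d] h by simp
next
  assume "4*lam*xi + 1 = 0 \<and> wave lam y x = wave lam y 0"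
  then show "gap x = 0" using degenerate(2) by (simp add: gap_def)
qed

lemma gap_degenerate:
  assumes "4*lam*xi + 1 = 0"
  shows "gap x = 4*xi^2 * height x * (wave lam y x + wave lam y 0)"
  using degenerate[OF assms] unfolding gap_def height_def by algebra

text \<open>The quotient in \<open>angular_speed\<close> as a function of the phase. In the
  degenerate case \<open>gap\<close> contains the factor \<open>height\<close>, and cancelling it is
  the extension by continuity.\<close>

definition rate :: "real \<Rightarrow> real" where
  "rate x = (if 4*lam*xi + 1 = 0 then - ((wave lam y x)^2 / (4*xi^2*(wave lam y x + wave lam y 0)))
     else - ((wave lam y x)^2 * height x / gap x))"

lemma rate_eq:
  assumes "gap x \<noteq> 0" shows "rate x = - ((wave lam y x)^2 * height x / gap x)"
proof (cases "4*lam*xi + 1 = 0")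
  case True
  have "height x \<noteq> 0" "wave lam y x + wave lam y 0 \<noteq> 0" using assms unfolding gap_degenerate[OF True] by auto
  then show ?thesis unfolding rate_def gap_degenerate[OF True] using True xi_pos by simp
qed (simp add: rate_def)

lemma continuous_wave [continuous_intros]: "continuous_on A (wave lam y)"
  unfolding wave_def by (intro continuous_intros)

lemma continuous_rate: "continuous_on A rate"
proof (cases "4*lam*xi + 1 = 0")
  case True
  have "4*xi^2*(wave lam y x + wave lam y 0) \<noteq> 0" for x
    using xi_pos facts(8)[of x] facts(8)[of 0] by simp
  then show ?thesis unfolding rate_def[abs_def] using True by (auto intro!: continuous_intros)
next
  case False
  then have "gap x \<noteq> 0" for x using gap_zero_iff by blast
  then show ?thesis unfolding rate_def[abs_def] height_def using False 
    by (auto intro!: continuous_intros simp: gap_def)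
qed

lemma speed_pos: "0 < speed x" unfolding speed_def using facts(8,9) by simp

lemma continuous_speed: "continuous_on A speed"
  unfolding speed_def cofactor_def by (intro continuous_intros)

text \<open>At \<open>t = - 2*lam\<close> the value of \<open>Q\<close> is
  \<open>1 - (4*lam*xi)^2\<close>, negative here, so this point lies strictly between the
  roots.\<close>

lemma turning_heights:
  assumes "4*lam*xi + 1 < 0" shows "wave lam y 0 < - 2*lam" "- 2*lam < wave lam y pi"
proof -
  have l: "1/(2*xi) < - 2*lam" using assms xi_pos by (simp add: field_simps)
  moreover have "0 < 1/(2*xi)" using xi_pos by simp
  ultimately have l0: "0 < - 2*lam" by linarith
  have "1^2 < (- 4*lam*xi)^2" using assms by (intro power_strict_mono) auto
  then have "Q lam xi (- 2*lam) < 0" unfolding Q_eq by (simp add: power_mult_distrib algebra_simps)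
  then have "0 < ((wave lam y pi - (- 2*lam)) * ((- 2*lam) - wave lam y 0)) * ((- 2*lam)^2 + b*(- 2*lam) + 1/p)"
    unfolding Q_wave quad_wave by linarith
  then have "0 < (wave lam y pi - (- 2*lam)) * ((- 2*lam) - wave lam y 0)"
    using cofactor_pos[OF l0] by (rule zero_less_mult_pos2)
  then show "wave lam y 0 < - 2*lam" "- 2*lam < wave lam y pi"
    using wave_roots(3) by (auto simp: zero_less_mult_iff)
qed

text \<open>The sign of \<open>Y\<close> at the lower turning point decides \<open>chi 0\<close> and
  so separates the three cases of \<open>Psi_hat\<close>.\<close>

lemma height_0: "4*lam*xi + 1 > 0 \<Longrightarrow> 0 < height 0" "4*lam*xi + 1 = 0 \<Longrightarrow> height 0 = 0"
  "4*lam*xi + 1 < 0 \<Longrightarrow> height 0 < 0"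
proof -
  assume "4*lam*xi + 1 > 0"
  then have "- 2*lam < 1/(2*xi)" using xi_pos by (simp add: field_simps)
  then show "0 < height 0" using wave_ge[of 0] by (simp add: height_def)
next
  assume "4*lam*xi + 1 = 0"
  then show "height 0 = 0" using degenerate(1) by (simp add: height_def)
next
  assume "4*lam*xi + 1 < 0"
  then show "height 0 < 0" using turning_heights(1) by (simp add: height_def)
qed

lemma height_pi: "0 < height pi"
proof (cases "4*lam*xi + 1 < 0")
  case True
  then show ?thesis using turning_heights(2) by (simp add: height_def)
next
  case False
  then have "0 \<le> height 0" using height_0(1,2) by (cases "4*lam*xi + 1 = 0") auto
  then show ?thesis using wave_roots(3) by (simp add: height_def)
qed

text \<open>The level curve \<open>(1/wave, height)\<close> lies on the sphere of radius \<open>2 * xi\<close>. The sum of the angle forms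
  about its first and its second coordinate axis is the differential of the angle \<open>chi\<close>; it
  trades the integrand with poles for one without.\<close>

definition chi :: "real \<Rightarrow> real" where
  "chi x = arcsin (height x / sqrt (gap x * polar lam y x))"

lemma chi_arg_sq: "gap x * polar lam y x - (height x)^2 = 4*xi^2 * ((halfdiff lam y * sin x)^2 * cofactor lam y x)"
proof -
  have "(halfdiff lam y * sin x)^2 * cofactor lam y x = gap x - (wave lam y x)^2 * (height x)^2"
    using gap_eq[of x] by (simp add: power_mult_distrib)
  then show ?thesis unfolding polar_height gap_def by algebra
qed

lemma chi_arg_bound: "\<bar>height x / sqrt (gap x * polar lam y x)\<bar> \<le> 1"
proof (cases "gap x = 0")
  case False
  then have g: "0 < gap x * polar lam y x" using gap_nonneg[of x] facts(10)[of x] by simp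
  have "0 \<le> 4*xi^2 * ((halfdiff lam y * sin x)^2 * cofactor lam y x)"
    using facts(9)[of x] by (intro mult_nonneg_nonneg) auto
  then have "(height x)^2 \<le> gap x * polar lam y x" using chi_arg_sq[of x] by linarith
  then have "\<bar>height x\<bar> \<le> sqrt (gap x * polar lam y x)" by (rule real_le_rsqrt[of "\<bar>height x\<bar>", simplified])
  then show ?thesis using g by (simp add: abs_divide)
qed simp

text \<open>In the degenerate case numerator and denominator vanish together at the lower turning
  point. Cancelling \<open>sqrt (height x)\<close> shows that the limit is 0, which is also the
  value of \<open>0/0\<close>.\<close>

lemma continuous_chi: "continuous_on A chi"
proof -
  have "continuous_on A (\<lambda>x. height x / sqrt (gap x * polar lam y x))"
  proof (cases "4*lam*xi + 1 = 0")
    case True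
    have "height x / sqrt (gap x * polar lam y x) = sqrt (height x) / sqrt (4*xi^2*(wave lam y x + wave lam y 0) * polar lam y x)" for x
    proof -
      have h: "0 \<le> height x" using degenerate(1)[OF True] wave_bounds(1)[of x] by (simp add: height_def)
      have "sqrt (gap x * polar lam y x) = sqrt (height x) * sqrt (4*xi^2*(wave lam y x + wave lam y 0) * polar lam y x)"
        unfolding gap_degenerate[OF True] real_sqrt_mult[symmetric] by (simp add: mult_ac)
      then show ?thesis by (simp only: divide_divide_eq_left[symmetric] real_div_sqrt[OF h])
    qed
    moreover have "sqrt (4*xi^2*(wave lam y x + wave lam y 0) * polar lam y x) \<noteq> 0" for x
      using xi_pos facts(8)[of x] facts(8)[of 0] facts(10)[of x] by simp
    ultimately show ?thesis unfolding height_def polar_height by (simp add: height_def) (intro continuous_intros, auto)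
  next
    case False
    then have "gap x \<noteq> 0" for x using gap_zero_iff by blast
    then have "sqrt (gap x * polar lam y x) \<noteq> 0" for x using facts(10)[of x] by simp
    then show ?thesis unfolding polar_height height_def gap_def 
      by (intro continuous_intros) (auto simp: gap_def polar_height height_def)
  qed
  moreover have "- 1 \<le> height x / sqrt (gap x * polar lam y x) \<and> height x / sqrt (gap x * polar lam y x) \<le> 1" for x
    using abs_le_D1[OF chi_arg_bound[of x]] abs_le_D2[OF chi_arg_bound[of x]] by linarith
  ultimately show ?thesis unfolding chi_def by (intro continuous_on_arcsin) blast+
qed

lemma chi_at_turning: "sin x = 0 \<Longrightarrow> height x \<noteq> 0 \<Longrightarrow> chi x = (if 0 < height x then pi/2 else - pi/2)"
proof -
  assume "sin x = 0" and h: "height x \<noteq> 0"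
  then have "gap x * polar lam y x = (height x)^2" using chi_arg_sq[of x] by simp
  then show ?thesis unfolding chi_def using h by (auto simp: real_sqrt_abs divide_self_if)
qed

lemma DERIV_chi:
  assumes "0 < x" "x < pi"
  shows "(chi has_real_derivative 2*xi*(rate x/speed x) + 2*xi/(polar lam y x * sqrt (cofactor lam y x))) (at x)"
proof -
  define Z where "Z x = sqrt ((wave lam y x)^2 * polar lam y x - 1)" for x
  have pos: "0 < (wave lam y z)^2 * polar lam y z - 1" if "0 < z" "z < pi" for z
    unfolding facts(13)[symmetric] facts(12) using facts(6,9) sin_gt_zero[OF that] by simp
  have Zs: "Z z = halfdiff lam y * sin z * sqrt (cofactor lam y z)" if "0 < z" "z < pi" for z
    unfolding Z_def facts(13)[symmetric] facts(12) using facts(6) sin_gt_zero[OF that]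
    by (simp add: real_sqrt_mult real_sqrt_abs abs_mult)
  have Z0: "0 < Z z" if "0 < z" "z < pi" for z using pos[OF that] by (simp add: Z_def)
  have Z2: "(Z z)^2 = gap z - (wave lam y z * height z)^2" if "0 < z" "z < pi" for z
    using pos[OF that] unfolding Z_def gap_def polar_height by (simp add: algebra_simps power_mult_distrib)
  have g0: "0 < gap z" if "0 < z" "z < pi" for z 
  proof -
    have "0 < (Z z)^2" using Z0[OF that] by simp
    moreover have "0 \<le> (wave lam y z * height z)^2" by simp
    ultimately show ?thesis using Z2[OF that] by linarith
  qed
  \<comment> \<open>The arcsine extends continuously to the turning points, where \<open>Z\<close>
    vanishes and this quotient breaks down; in between the arctangent is differentiable by the
    standard rule.\<close>
  have eq: "chi z = arctan (height z / (2*xi * Z z))" if z: "0 < z" "z < pi" for z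
  proof -
    have gp: "0 < gap z * polar lam y z" using g0[OF z] facts(10) by simp
    define q where "q = height z / sqrt (gap z * polar lam y z)"
    have "1 - q^2 = (gap z * polar lam y z - (height z)^2) / (gap z * polar lam y z)"
      unfolding q_def using gp g0[OF z] facts(10)[of z] by (simp add: power_divide diff_divide_distrib)
    also have "gap z * polar lam y z - (height z)^2 = 4*xi^2 * (Z z)^2"
      unfolding chi_arg_sq Zs[OF z] power_mult_distrib using facts(9)[of z] by simp
    finally have q: "1 - q^2 = (2*xi*Z z)^2 / (gap z * polar lam y z)" by (simp add: power_mult_distrib)
    have xz: "0 < 2*xi*Z z" using xi_pos Z0[OF z] by simp
    then have "0 < (2*xi*Z z)^2 / (gap z * polar lam y z)" using gp by (intro divide_pos_pos zero_less_power)
    then have "q^2 < 1" using q by linarith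
    then have "\<bar>q\<bar> < 1" by (simp only: abs_square_less_1)
    then have q1: "-1 < q" "q < 1" by linarith+
    have r: "0 < sqrt (gap z * polar lam y z)" using gp by simp
    have e1: "sqrt (1 - q^2) = 2*xi*Z z / sqrt (gap z * polar lam y z)"
      unfolding q real_sqrt_divide using xz by (simp add: real_sqrt_abs)
    have e2: "q / (2*xi*Z z / sqrt (gap z * polar lam y z)) = height z / (2*xi*Z z)"
      unfolding q_def using g0[OF z] facts(10)[of z] by simp
    show ?thesis unfolding chi_def q_def[symmetric] arcsin_arctan[OF q1] e1 e2 ..
  qed
  define w' where "w' = halfdiff lam y * sin x"
  have w'0: "0 < w'" unfolding w'_def using facts(6) sin_gt_zero[OF assms] by simp
  have dw: "(wave lam y has_real_derivative w') (at x)" unfolding w'_def by (rule DERIV_wave_phase)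
  have dh: "(height has_real_derivative w') (at x)" unfolding height_def[abs_def] by (auto intro!: derivative_eq_intros dw)
  have "((\<lambda>x. (wave lam y x)^2 * polar lam y x - 1) has_real_derivative 
     2 * w' * (wave lam y x * polar lam y x - (wave lam y x)^2 * height x)) (at x)"
    unfolding polar_height by (auto intro!: derivative_eq_intros dw dh simp: algebra_simps)
  note dZ = DERIV_chain2[OF DERIV_real_sqrt[OF pos[OF assms]] this, folded Z_def]
  define W where "W = wave lam y x" define Y where "Y = height x" define D where "D = polar lam y x" 
  define z where "z = Z x" define g where "g = gap x" define S where "S = cofactor lam y x"
  have z0: "0 < z" and gg: "0 < g" and D0: "0 < D" and S0: "0 < S" and W0: "0 < W"
    unfolding z_def g_def D_def S_def W_def using Z0[OF assms] g0[OF assms] facts(8-10) by auto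
  have zz: "z^2 = g - W^2*Y^2" and DY: "D = 4*xi^2 - Y^2" and gW: "g = 4*xi^2*W^2 - 1"
    unfolding z_def g_def W_def Y_def D_def using Z2[OF assms] by (auto simp: polar_height gap_def power_mult_distrib)
  have zS: "z = w' * sqrt S" unfolding z_def S_def w'_def by (rule Zs[OF assms])
  have T: "((\<lambda>x. height x / (2*xi * Z x)) has_real_derivative 
     (w' * (2*xi*z) - Y * (2*xi * (inverse z / 2 * (2 * w' * (W * D - W^2 * Y))))) / ((2*xi*z)*(2*xi*z))) (at x)"
    unfolding W_def Y_def D_def z_def using z0 xi_pos
    by (intro DERIV_divide dh DERIV_cmult dZ) (auto simp: z_def)
  have "(inverse (1 + (Y/(2*xi*z))^2) * ((w' * (2*xi*z) - Y * (2*xi * (inverse z / 2 * (2 * w' * (W * D - W^2 * Y))))) / ((2*xi*z)*(2*xi*z))))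
     = 2*xi*(- (W^2*Y/g)/(W * sqrt S)) + 2*xi/(D * sqrt S)"
  proof -
    have a: "1 + (Y/(2*xi*z))^2 = g*D/(2*xi*z)^2"
    proof -
      have "(2*xi*z)^2 + Y^2 = g*D" using zz DY gW by algebra
      then show ?thesis using xi_pos z0 by (simp add: field_simps)
    qed
    have b: "(w' * (2*xi*z) - Y * (2*xi * (inverse z / 2 * (2 * w' * (W * D - W^2 * Y))))) = 2*xi*w'/z*(g - W*Y*D)"
    proof -
      have "z^2 - Y*(W*D - W^2*Y) = g - W*Y*D" using zz by algebra
      moreover have "(w' * (2*xi*z) - Y * (2*xi * (inverse z / 2 * (2 * w' * (W * D - W^2 * Y))))) = 2*xi*w'/z*(z^2 - Y*(W*D - W^2*Y))"
        using z0 by (simp add: field_simps power2_eq_square) 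
      ultimately show ?thesis by simp
    qed
    have c: "w'/z = 1/sqrt S" unfolding zS using w'0 S0 by simp
    have "inverse (g*D/(2*xi*z)^2) * (2*xi*w'/z*(g - W*Y*D) / ((2*xi*z)*(2*xi*z))) = 2*xi*(w'/z)*((g - W*Y*D)/(g*D))"
      using xi_pos z0 gg D0 by (simp add: field_simps power2_eq_square)
    also have "\<dots> = 2*xi*(- (W^2*Y/g)/(W * sqrt S)) + 2*xi/(D * sqrt S)"
      unfolding c using gg D0 S0 W0 by (simp add: field_simps power2_eq_square)
    finally show ?thesis unfolding a b .
  qed
  also have "\<dots> = 2*xi*(rate x/speed x) + 2*xi/(polar lam y x * sqrt (cofactor lam y x))"
    unfolding rate_eq[OF less_imp_neq[OF g0[OF assms], symmetric]] speed_def W_def Y_def g_def S_def D_def by simp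
  finally have "((\<lambda>x. arctan (height x / (2*xi * Z x))) has_real_derivative \<dots>) (at x)"
    using DERIV_chain2[OF DERIV_arctan T] by (simp add: Y_def z_def)
  moreover have "\<forall>\<^sub>F z in nhds x. chi z = arctan (height z / (2*xi * Z z))"
    using eventually_nhds_in_open[of "{0<..<pi}" x] assms eq by (auto elim!: eventually_mono)
  ultimately show ?thesis by (subst DERIV_cong_ev[OF refl _ refl])
qed

end

section \<open>Evaluation of the regularized period\<close>

context wave_flow
begin

text \<open>At a zero of the denominator \<open>sin (phi t)\<close> has the nonzero derivative
  \<open>speed\<close>, so the zero is isolated and the limit is that of the continuous function
  \<open>rate (phi t)\<close>.\<close>

lemma angular_speed_rate: "angular_speed lam xi u = rate (phi u)"
proof -
  define f where "f = (\<lambda>t. (mu lam xi t)^2 * (mu lam xi t + 2 * lam) / (1 - 4 * xi^2 * (mu lam xi t)^2))"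
  have f: "f t = rate (phi t)" if "gap (phi t) \<noteq> 0" for t
    unfolding rate_eq[OF that] f_def mu_wave gap_def height_def by (simp add: minus_divide_right)
  have g: "1 - 4 * xi^2 * (mu lam xi t)^2 = - gap (phi t)" for t unfolding mu_wave gap_def by simp
  have "angular_speed lam xi u = (if 1 - 4 * xi^2 * (mu lam xi u)^2 = 0 then Lim (at u) f else f u)"
    unfolding angular_speed_def Let_def f_def ..
  then have as: "angular_speed lam xi u = (if gap (phi u) = 0 then Lim (at u) f else f u)"
    unfolding g by simp
  show ?thesis
  proof (cases "gap (phi u) = 0")
    case True
    then have d: "4*lam*xi + 1 = 0" "wave lam y (phi u) = wave lam y 0" by (auto simp: gap_zero_iff)
    then have c: "cos (phi u) = 1" using facts(6) by (simp add: wave_def)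
    then have s0: "sin (phi u) = 0" using sin_cos_squared_add[of "phi u"] by simp
    have "((\<lambda>t. sin (phi t)) has_real_derivative cos (phi u) * speed (phi u)) (at u)"
      by (rule DERIV_chain2[OF DERIV_sin DERIV_phi])
    then have "(\<lambda>t. (sin (phi t) - sin (phi u)) / (t - u)) \<midarrow>u\<rightarrow> speed (phi u)"
      unfolding has_field_derivative_iff c by simp
    then have "\<forall>\<^sub>F t in at u. (sin (phi t) - sin (phi u)) / (t - u) \<noteq> 0"
      by (rule tendsto_imp_eventually_ne) (use speed_pos[of "phi u"] in simp)
    then have "\<forall>\<^sub>F t in at u. f t = rate (phi t)"
    proof (rule eventually_mono)
      fix t assume "(sin (phi t) - sin (phi u)) / (t - u) \<noteq> 0"
      then have "sin (phi t) \<noteq> 0" using s0 by auto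
      then have "cos (phi t) \<noteq> 1" using cos_one_sin_zero by blast
      then have "wave lam y (phi t) \<noteq> wave lam y 0" using facts(6) by (simp add: wave_def)
      then show "f t = rate (phi t)" by (intro f) (simp add: gap_zero_iff)
    qed
    moreover have "((\<lambda>t. rate (phi t)) \<longlongrightarrow> rate (phi u)) (at u)"
    proof -
      have "isCont rate (phi u)" using continuous_rate[of UNIV] by (simp add: continuous_on_eq_continuous_at)
      from isCont_o2[OF DERIV_isCont[OF DERIV_phi] this] show ?thesis by (simp add: isCont_def)
    qed
    ultimately have "(f \<longlongrightarrow> rate (phi u)) (at u)" by (simp cong: tendsto_cong)
    then have "Lim (at u) f = rate (phi u)" by (intro tendsto_Lim) auto
    then show ?thesis unfolding as using True by simp
  qed (use as f in simp)
qed

lemma continuous_rate_phi: "continuous_on A (\<lambda>s. rate (phi s))"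
  by (rule continuous_on_compose2[OF continuous_rate[of UNIV]])
    (auto intro!: continuous_at_imp_continuous_on DERIV_isCont[OF DERIV_phi])

text \<open>Integrating \<open>DERIV_chi\<close> over half a period gives
  \<open>Psi + Hfun = 2 * (chi pi - chi 0)\<close>. Here \<open>chi pi = pi/2\<close> and
  \<open>chi 0\<close> is \<open>pi/2\<close>, \<open>0\<close> or \<open>- pi/2\<close>, which
  matches the three corrections in \<open>Psi_hat\<close>.\<close>

lemma Psi_hat_eq: "Psi_hat lam xi = 2*pi - Hfun lam y"
proof -
  have "\<exists>J. \<forall>x :: real. (-\<infinity>::ereal) < x \<longrightarrow> x < (\<infinity>::ereal) \<longrightarrow> (J has_vector_derivative rate x / speed x) (at x)"
  proof (rule einterval_antiderivative)
    fix x :: real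
    have "continuous_on UNIV (\<lambda>x. rate x / speed x)"
      by (intro continuous_intros continuous_rate continuous_speed) (use speed_pos in \<open>auto simp: less_imp_neq[symmetric]\<close>)
    then show "isCont (\<lambda>x. rate x / speed x) x" by (simp add: continuous_on_eq_continuous_at)
  qed simp
  then obtain J where J: "\<And>x. (J has_real_derivative rate x / speed x) (at x)"
    by (auto simp: has_real_derivative_iff_has_vector_derivative)
  have "(LBINT s=ereal 0..ereal (omega lam xi). rate (phi s)) = J (phi (omega lam xi)) - J (phi 0)"
  proof (rule interval_integral_FTC_finite)
    show "continuous_on {min 0 (omega lam xi)..max 0 (omega lam xi)} (\<lambda>s. rate (phi s))" by (rule continuous_rate_phi)
    fix s
    have "((\<lambda>s. J (phi s)) has_real_derivative rate (phi s) / speed (phi s) * speed (phi s)) (at s)"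
      by (rule DERIV_chain2[OF J DERIV_phi])
    then have "((\<lambda>s. J (phi s)) has_real_derivative rate (phi s)) (at s)" using speed_pos[of "phi s"] by simp
    then show "((\<lambda>s. J (phi s)) has_vector_derivative rate (phi s)) (at s within {min 0 (omega lam xi)..max 0 (omega lam xi)})"
      unfolding has_real_derivative_iff_has_vector_derivative by (rule has_vector_derivative_at_within)
  qed
  also have "\<dots> = J (2*pi) - J 0" by (simp add: phi_0 phi_omega)
  also have "\<dots> = 2 * (J pi - J 0)"
  proof -
    \<comment> \<open>The wave is symmetric about \<open>x = pi\<close>, so its two half periods
      contribute equally.\<close>
    have sym: "rate (2*pi - x) / speed (2*pi - x) = rate x / speed x" for x
      unfolding rate_def speed_def cofactor_def gap_def height_def wave_def by (simp add: cos_diff)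
    have "((\<lambda>x. J (2*pi - x) + J x) has_real_derivative 0) (at x)" for x
    proof -
      have "((\<lambda>x. J (2*pi - x)) has_real_derivative rate (2*pi - x) / speed (2*pi - x) * - 1) (at x)"
        by (rule DERIV_chain2[OF J]) (auto intro!: derivative_eq_intros)
      from DERIV_add[OF this J[of x]] show ?thesis by (simp add: sym)
    qed
    then have "J (2*pi - pi) + J pi = J (2*pi - 0) + J 0" by (rule DERIV_isconst_all[OF allI])
    then show ?thesis by simp
  qed
  finally have LB: "(LBINT s=ereal 0..ereal (omega lam xi). rate (phi s)) = 2 * (J pi - J 0)" .
  have as: "angular_speed lam xi = (\<lambda>s. rate (phi s))" by (simp add: fun_eq_iff angular_speed_rate)
  have Psi: "Psi lam xi = 2 * (2*xi*(J pi - J 0))"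
    unfolding Psi_def as LB by simp
  have "((\<lambda>x. 2*xi*(rate x/speed x) + 2*xi/(polar lam y x * sqrt (cofactor lam y x))) has_integral (chi pi - chi 0)) {0..pi}"
  proof (rule fundamental_theorem_of_calculus_interior)
    fix x assume "x \<in> {0<..<pi}"
    then show "(chi has_vector_derivative 2*xi*(rate x/speed x) + 2*xi/(polar lam y x * sqrt (cofactor lam y x))) (at x)"
      unfolding has_real_derivative_iff_has_vector_derivative[symmetric] by (intro DERIV_chi) auto
  qed (simp_all add: continuous_chi)
  moreover have "((\<lambda>x. 2*xi*(rate x/speed x)) has_integral 2*xi*(J pi - J 0)) {0..pi}"
    by (intro has_integral_mult_right fundamental_theorem_of_calculus)
      (auto simp: has_real_derivative_iff_has_vector_derivative[symmetric] intro: has_field_derivative_at_within J)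
  moreover have "((\<lambda>x. 2*xi/(polar lam y x * sqrt (cofactor lam y x))) has_integral Hfun lam y/2) {0..pi}"
  proof -
    have r: "sqrt (radsq lam y) = 2*xi" unfolding xi_sq using xi_pos by (simp add: real_sqrt_mult)
    have "continuous_on {0..pi} (integrand lam y)"
    proof -
      have "continuous_on {0..pi} (\<lambda>x. (\<lambda>(y, x). integrand lam y x) (y, x))"
        by (rule continuous_on_compose2[OF continuous_on_integrand]) (use adm in \<open>auto intro!: continuous_intros\<close>)
      then show ?thesis by simp
    qed
    then have "(integrand lam y has_integral Hfun lam y) {0..pi}"
      unfolding Hfun_def by (intro integrable_integral integrable_continuous_real)
    from has_integral_mult_right[OF this, of "1/2"] show ?thesis unfolding integrand_def r by simp
  qed
  ultimately have "chi pi - chi 0 = 2*xi*(J pi - J 0) + Hfun lam y/2"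
    using has_integral_add has_integral_unique by blast
  then have sum: "Psi lam xi + Hfun lam y = 2 * (chi pi - chi 0)" unfolding Psi by simp
  have pi: "chi pi = pi/2" using chi_at_turning[of pi] height_pi by simp
  consider "4*lam*xi + 1 > 0" | "4*lam*xi + 1 = 0" | "4*lam*xi + 1 < 0" by linarith
  then show ?thesis
  proof cases
    case 1
    then have "chi 0 = pi/2" using chi_at_turning[of 0] height_0(1) by simp
    then show ?thesis using sum pi 1 by (simp add: Psi_hat_def)
  next
    case 2
    then have "chi 0 = 0" using height_0(2) by (simp add: chi_def)
    then show ?thesis using sum pi 2 by (simp add: Psi_hat_def)
  next
    case 3
    then have "chi 0 = - pi/2" using chi_at_turning[of 0] height_0(3) by simp
    then show ?thesis using sum pi 3 by (simp add: Psi_hat_def)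
  qed
qed

end

text \<open>Every \<open>xi\<close> has some \<open>y\<close> and every admissible \<open>y\<close>
  some \<open>xi\<close>, which is enough for images to agree.\<close>

lemma Psi_hat_image: "Psi_hat lam ` {eta_hat lam<..} = (\<lambda>y. 2*pi - Hfun lam y) ` admissible lam"
proof (intro equalityI subsetI)
  fix v assume "v \<in> Psi_hat lam ` {eta_hat lam<..}"
  then obtain xi where xi: "eta_hat lam < xi" "v = Psi_hat lam xi" by auto
  from wave_data_of_xi[OF xi(1)] obtain y where y: "wave_data lam xi y" by blast
  from wave_data.wave_flow_exists[OF y] obtain phi where "wave_flow lam xi y phi" by blast
  from wave_flow.Psi_hat_eq[OF this] show "v \<in> (\<lambda>y. 2*pi - Hfun lam y) ` admissible lam"
    unfolding xi(2) using wave_data.adm[OF y] by blast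
next
  fix v assume "v \<in> (\<lambda>y. 2*pi - Hfun lam y) ` admissible lam"
  then obtain y where y: "y \<in> admissible lam" "v = 2*pi - Hfun lam y" by auto
  note w = wave_data_of_admissible[OF y(1)]
  from wave_data.wave_flow_exists[OF w] obtain phi where "wave_flow lam (sqrt (radsq lam y)/2) y phi" by blast
  from wave_flow.Psi_hat_eq[OF this] wave_data.xi_gt[OF w] show "v \<in> Psi_hat lam ` {eta_hat lam<..}"
    unfolding y(2) by (metis greaterThan_iff image_eqI)
qed

section \<open>The curves\<close>

lemma orthonormal_frame_expansion:
  fixes a c v :: "real^3"
  assumes "c \<bullet> c = 1" "v \<bullet> v = 1" "c \<bullet> v = 0" "a \<bullet> c = 0" "a \<bullet> v = 0"
  shows "a = (a \<bullet> cross3 c v) *\<^sub>R cross3 c v"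
proof -
  define n where "n = cross3 c v"
  have "(norm n)^2 + (c \<bullet> v)^2 = (norm c * norm v)^2" unfolding n_def by (rule norm_cross_dot)
  then have n: "n \<bullet> n = 1" using assms by (simp add: power_mult_distrib power2_norm_eq_inner)
  have "cross3 a n = 0" unfolding n_def Lagrange using assms by simp
  then have "(n \<bullet> n) *\<^sub>R a - (n \<bullet> a) *\<^sub>R n = 0" unfolding Lagrange[symmetric] by simp
  then show ?thesis using n by (simp add: n_def[symmetric] inner_commute)
qed

lemma DERIV_inner:
  fixes f g :: "real \<Rightarrow> 'a::real_inner"
  assumes "(f has_vector_derivative f') (at t)" "(g has_vector_derivative g') (at t)"
  shows "((\<lambda>t. f t \<bullet> g t) has_real_derivative f t \<bullet> g' + f' \<bullet> g t) (at t)"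
  using bounded_bilinear.has_vector_derivative[OF bounded_bilinear_inner assms]
  by (simp add: has_real_derivative_iff_has_vector_derivative)

lemma DERIV_component:
  fixes f :: "real \<Rightarrow> real^'n"
  assumes "(f has_vector_derivative f') (at t)"
  shows "((\<lambda>t. f t $ i) has_real_derivative f' $ i) (at t)"
  using bounded_linear.has_vector_derivative[OF bounded_linear_vec_nth assms]
  by (simp add: has_real_derivative_iff_has_vector_derivative)

text \<open>Differentiating \<open>c . c = 1\<close>, \<open>v . v = 1\<close> and
  \<open>c . v = 0\<close> shows that \<open>a + c\<close> is orthogonal to \<open>c\<close> and
  \<open>v\<close>. Comparing the two expressions in one coordinate will reveal the
  curvature.\<close>

lemma covariant_acceleration_unit_speed:
  assumes c: "\<And>t. (c has_vector_derivative v t) (at t)" "\<And>t. (v has_vector_derivative a t) (at t)"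
    and n: "\<And>t. c t \<bullet> c t = 1" "\<And>t. v t \<bullet> v t = 1"
  shows "covariant_acceleration c t = (a t \<bullet> cross3 (c t) (v t)) *\<^sub>R cross3 (c t) (v t)"
    and "covariant_acceleration c t = a t + c t"
proof -
  have cv: "c t \<bullet> v t = 0" for t
  proof -
    have "((\<lambda>t. c t \<bullet> c t) has_real_derivative c t \<bullet> v t + v t \<bullet> c t) (at t)" by (rule DERIV_inner[OF c(1) c(1)])
    moreover have "((\<lambda>t. c t \<bullet> c t) has_real_derivative 0) (at t)" unfolding n by simp
    ultimately have "c t \<bullet> v t + v t \<bullet> c t = 0" by (rule DERIV_unique)
    then show ?thesis by (simp add: inner_commute)
  qed
  have va: "v t \<bullet> a t = 0"
  proof -
    have "((\<lambda>t. v t \<bullet> v t) has_real_derivative v t \<bullet> a t + a t \<bullet> v t) (at t)" by (rule DERIV_inner[OF c(2) c(2)])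
    moreover have "((\<lambda>t. v t \<bullet> v t) has_real_derivative 0) (at t)" unfolding n by simp
    ultimately have "v t \<bullet> a t + a t \<bullet> v t = 0" by (rule DERIV_unique)
    then show ?thesis by (simp add: inner_commute)
  qed
  have ca: "c t \<bullet> a t = - 1"
  proof -
    have "((\<lambda>t. c t \<bullet> v t) has_real_derivative c t \<bullet> a t + v t \<bullet> v t) (at t)" by (rule DERIV_inner[OF c(1) c(2)])
    moreover have "((\<lambda>t. c t \<bullet> v t) has_real_derivative 0) (at t)" unfolding cv by simp
    ultimately have "c t \<bullet> a t + v t \<bullet> v t = 0" by (rule DERIV_unique)
    then show ?thesis by (simp add: n)
  qed
  have v: "velocity c = v" unfolding velocity_def[abs_def] using c(1) by (auto simp: vector_derivative_at)
  show cov: "covariant_acceleration c t = a t + c t"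
    unfolding covariant_acceleration_def Let_def v vector_derivative_at[OF c(2)] using ca by (simp add: inner_commute)
  have 1: "(a t + c t) \<bullet> c t = 0" using ca n(1)[of t] by (simp add: inner_add_left inner_commute[of "a t" "c t"])
  have 2: "(a t + c t) \<bullet> v t = 0" using va cv[of t] by (simp add: inner_add_left inner_commute[of "a t" "v t"])
  have 3: "(a t + c t) \<bullet> cross3 (c t) (v t) = a t \<bullet> cross3 (c t) (v t)"
    by (simp add: inner_add_left dot_cross_self)
  show "covariant_acceleration c t = (a t \<bullet> cross3 (c t) (v t)) *\<^sub>R cross3 (c t) (v t)"
    unfolding cov using orthonormal_frame_expansion[OF n(1) n(2) cv 1 2] unfolding 3 .
qed

text \<open>For each \<open>k\<close> the definition provides a derivative of its own;
  \<open>vector_derivative\<close> is one choice for all \<open>k\<close>.\<close>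

lemma times_differentiable_obtain:
  assumes "\<And>k. times_differentiable k f"
  obtains f' where "\<And>t. (f has_vector_derivative f' t) (at t)" "\<And>k. times_differentiable k f'"
proof -
  let ?f' = "\<lambda>t. vector_derivative f (at t)"
  have *: "(\<forall>t. (f has_vector_derivative ?f' t) (at t)) \<and> times_differentiable k ?f'" for k
  proof -
    obtain g where g: "\<And>t. (f has_vector_derivative g t) (at t)" "times_differentiable k g"
      using assms[of "Suc k"] by auto
    then have e: "vector_derivative f (at t) = g t" for t by (simp add: vector_derivative_at)
    show ?thesis unfolding e using g by simp
  qed
  show ?thesis using that[of ?f'] * by blast
qed

lemma times_differentiable_obtain_real:
  fixes f :: "real \<Rightarrow> real"
  assumes "\<And>k. times_differentiable k f"
  obtains f' where "\<And>t. (f has_real_derivative f' t) (at t)" "\<And>k. times_differentiable k f'"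
  using times_differentiable_obtain[OF assms] by (metis has_real_derivative_iff_has_vector_derivative)

section \<open>Smoothness of the angle and of the signed radius\<close>

context wave_flow
begin

lemmas times_differentiable_wave = times_differentiable_wave_comp[OF times_differentiable_phase[OF DERIV_phi]]

lemma times_differentiable_rate: "times_differentiable k (\<lambda>t. rate (phi t))"
proof (cases "4*lam*xi + 1 = 0")
  case True
  have "4*xi^2*(wave lam y (phi t) + wave lam y 0) \<noteq> 0" for t
    using xi_pos facts(8)[of "phi t"] facts(8)[of 0] by simp
  then show ?thesis unfolding rate_def if_P[OF True]
    by (intro times_differentiable_uminus times_differentiable_divide times_differentiable_mult
        times_differentiable_add times_differentiable_power times_differentiable_const times_differentiable_wave; simp)
next
  case False
  then have "gap (phi t) \<noteq> 0" for t using gap_zero_iff by blast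
  then show ?thesis unfolding rate_def if_not_P[OF False] gap_def height_def
    by (intro times_differentiable_uminus times_differentiable_divide times_differentiable_mult
        times_differentiable_add times_differentiable_diff times_differentiable_power times_differentiable_const times_differentiable_wave; simp)
qed

lemma theta_properties:
  "(theta lam xi has_real_derivative 2*xi*rate (phi t)) (at t)"
  "theta lam xi (t + omega lam xi) = theta lam xi t + Psi lam xi"
proof -
  have LB: "(LBINT t=ereal (omega lam xi/2)..ereal u. rate (phi t)) = F u - F (omega lam xi/2)" 
    if "\<And>t. (F has_real_derivative rate (phi t)) (at t)" for F u
    by (rule interval_integral_FTC_finite)
      (use continuous_rate_phi that in \<open>auto simp: has_real_derivative_iff_has_vector_derivative intro: has_vector_derivative_at_within\<close>)
  have "\<exists>F. \<forall>x :: real. (-\<infinity>::ereal) < x \<longrightarrow> x < (\<infinity>::ereal) \<longrightarrow> (F has_vector_derivative rate (phi x)) (at x)"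
  proof (rule einterval_antiderivative)
    show "isCont (\<lambda>x. rate (phi x)) x" for x
      using continuous_rate_phi[of UNIV] by (simp add: continuous_on_eq_continuous_at)
  qed simp
  then obtain F where F: "\<And>x. (F has_real_derivative rate (phi x)) (at x)"
    by (auto simp: has_real_derivative_iff_has_vector_derivative)
  have th: "theta lam xi u = 2*xi*(F u - F (omega lam xi/2))" for u
    unfolding theta_def angular_speed_rate LB[OF F] by simp
  show "(theta lam xi has_real_derivative 2*xi*rate (phi t)) (at t)"
    unfolding th[abs_def] by (auto intro!: derivative_eq_intros F)
  have "(LBINT t=ereal 0..ereal (omega lam xi). rate (phi t)) = F (omega lam xi) - F 0"
    by (rule interval_integral_FTC_finite)
      (use continuous_rate_phi F in \<open>auto simp: has_real_derivative_iff_has_vector_derivative intro: has_vector_derivative_at_within\<close>)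
  then have Psi: "Psi lam xi = 2*xi*(F (omega lam xi) - F 0)" unfolding Psi_def angular_speed_rate by simp
  have per: "rate (phi (u + omega lam xi)) = rate (phi u)" for u
    unfolding phi_shift rate_def gap_def height_def wave_def by simp
  have "((\<lambda>u. F (u + omega lam xi) - F u) has_real_derivative 0) (at u)" for u
  proof -
    have "((\<lambda>u. F (u + omega lam xi)) has_real_derivative rate (phi (u + omega lam xi)) * 1) (at u)"
      by (rule DERIV_chain2[OF F]) (auto intro!: derivative_eq_intros)
    from DERIV_diff[OF this F[of u]] show ?thesis by (simp add: per)
  qed
  then have "F (t + omega lam xi) - F t = F (0 + omega lam xi) - F 0" by (rule DERIV_isconst_all[OF allI])
  then have e: "F (t + omega lam xi) = F t + (F (omega lam xi) - F 0)" by simp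
  show "theta lam xi (t + omega lam xi) = theta lam xi t + Psi lam xi"
    unfolding th Psi e by (simp add: algebra_simps)
qed

lemma times_differentiable_theta: "times_differentiable k (theta lam xi)"
  by (rule times_differentiable_ode[OF theta_properties(1)])
    (intro times_differentiable_mult times_differentiable_const times_differentiable_rate)

lemma phi_shift_int: "phi (u + of_int k * omega lam xi) = phi u + of_int k * (2*pi)"
proof (induction k rule: int_induct[where k = 0])
  case base show ?case by simp
next
  case (step1 i)
  then show ?case using phi_shift[of "u + of_int i * omega lam xi"] by (simp add: algebra_simps)
next
  case (step2 i)
  then show ?case using phi_shift[of "u + of_int (i - 1) * omega lam xi"] by (simp add: algebra_simps)
qed

definition radial :: "real \<Rightarrow> real" where
  "radial t = sigma lam xi t * sqrt (4*xi^2*(mu lam xi t)^2 - 1)"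

text \<open>The root of \<open>gap\<close> is \<open>\<bar>sin (phi t/2)\<bar>\<close> times a
  smooth positive factor. Since \<open>phi (j * omega) = 2*pi*j\<close>, the sign
  \<open>sigma\<close> flips exactly where \<open>sin (phi t/2)\<close> does, so the product is
  smooth through the pole.\<close>

lemma radial_degenerate:
  assumes d: "4*lam*xi + 1 = 0"
  shows "radial t = sin (phi t/2) * (2*xi * sqrt (2*halfdiff lam y*(wave lam y (phi t) + wave lam y 0)))"
proof -
  \<comment> \<open>Index of the block of two periods containing \<open>t\<close>, one full period
    of \<open>sigma\<close>.\<close>
  define k :: int where "k = \<lfloor>t / (2* omega lam xi)\<rfloor>"
  have k: "2 * of_int k * omega lam xi \<le> t" "t < (2 * of_int k + 2) * omega lam xi"
  proof -
    have "of_int k \<le> t / (2* omega lam xi)" "t / (2* omega lam xi) < of_int k + 1" unfolding k_def by linarith+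
    then show "2 * of_int k * omega lam xi \<le> t" "t < (2 * of_int k + 2) * omega lam xi"
      using omega_pos by (auto simp: field_simps)
  qed
  have phik: "phi (of_int j * omega lam xi) = of_int j * (2*pi)" for j using phi_shift_int[of 0 j] phi_0 by simp
  have sn: "sigma lam xi t * \<bar>sin (phi t/2)\<bar> = sin (phi t/2)"
  proof (cases "\<exists>k::int. 2 * k * omega lam xi \<le> t \<and> t < (2 * k + 1) * omega lam xi")
    case True
    then obtain j :: int where j: "2 * of_int j * omega lam xi \<le> t" "t < (2 * of_int j + 1) * omega lam xi" by blast
    have "of_int (2*j) * (2*pi) \<le> phi t" "phi t < of_int (2*j+1) * (2*pi)"
      unfolding phik[symmetric] using j phi_mono by (auto simp: strict_mono_less strict_mono_less_eq)
    then have "0 \<le> sin (phi t/2 - (2*pi) * of_int j)" by (intro sin_ge_zero) (auto simp: algebra_simps)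
    then have "0 \<le> sin (phi t/2)" by (simp add: sin_diff)
    then show ?thesis unfolding sigma_def using d True by simp
  next
    case False
    then have "(2 * of_int k + 1) * omega lam xi \<le> t" using k(1) by force
    then have "of_int (2*k+1) * (2*pi) \<le> phi t" "phi t < of_int (2*k+2) * (2*pi)"
      unfolding phik[symmetric] using k phi_mono by (auto simp: strict_mono_less strict_mono_less_eq)
    then have "sin (phi t/2 - (2*pi) * of_int k) \<le> 0" by (intro sin_le_zero) (auto simp: algebra_simps)
    then have "sin (phi t/2) \<le> 0" by (simp add: sin_diff)
    moreover have "sigma lam xi t = - 1" unfolding sigma_def if_not_P[OF False] using d by simp
    ultimately show ?thesis by simp
  qed
  have "4*xi^2*(mu lam xi t)^2 - 1 = (sin (phi t/2))^2 * ((2*xi)^2 * (2*halfdiff lam y*(wave lam y (phi t) + wave lam y 0)))"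
  proof -
    have "4*xi^2*(mu lam xi t)^2 - 1 = 4*xi^2 * height (phi t) * (wave lam y (phi t) + wave lam y 0)"
      using gap_degenerate[OF d, of "phi t"] unfolding gap_def mu_wave .
    moreover have "height (phi t) = halfdiff lam y * (1 - cos (phi t))"
      unfolding height_def degenerate(1)[OF d] by (simp add: wave_def algebra_simps)
    moreover have "1 - cos (phi t) = 2 * (sin (phi t/2))^2" using cos_double_sin[of "phi t/2"] by simp
    ultimately show ?thesis by (simp add: power_mult_distrib)
  qed
  then have "sqrt (4*xi^2*(mu lam xi t)^2 - 1) = \<bar>sin (phi t/2)\<bar> * (2*xi * sqrt (2*halfdiff lam y*(wave lam y (phi t) + wave lam y 0)))"
    by (simp only: real_sqrt_mult real_sqrt_abs abs_mult abs_of_pos[OF xi_pos] abs_numeral)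
  then show ?thesis unfolding radial_def using sn by (metis mult.assoc)
qed

lemma radial_nondegenerate: "4*lam*xi + 1 \<noteq> 0 \<Longrightarrow> radial t = sqrt (gap (phi t))"
  unfolding radial_def sigma_def gap_def mu_wave by simp

lemma radial_sq: "(radial t)^2 = gap (phi t)"
proof -
  have "(sigma lam xi t)^2 = 1" by (auto simp: sigma_def)
  then show ?thesis unfolding radial_def power_mult_distrib mu_wave gap_def[symmetric] using gap_nonneg by simp
qed

lemma times_differentiable_radial: "times_differentiable k radial"
proof (cases "4*lam*xi + 1 = 0")
  case True
  have "times_differentiable k (\<lambda>t. phi t * (1/2))" for k
    by (intro times_differentiable_mult times_differentiable_phase[OF DERIV_phi] times_differentiable_const)
  then have h: "times_differentiable k (\<lambda>t. phi t/2)" for k by simp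
  have "0 < 2*halfdiff lam y*(wave lam y (phi t) + wave lam y 0)" for t
    using facts(6) facts(8)[of "phi t"] facts(8)[of 0] by simp
  then show ?thesis unfolding radial_degenerate[OF True, abs_def]
    by (intro times_differentiable_mult times_differentiable_sin h times_differentiable_const times_differentiable_sqrt
      times_differentiable_add times_differentiable_wave)
next
  case False
  then have "gap (phi t) \<noteq> 0" for t using gap_zero_iff by blast
  then have "0 < gap (phi t)" for t using gap_nonneg[of "phi t"] by (simp add: less_le)
  then show ?thesis unfolding radial_nondegenerate[OF False, abs_def] gap_def
    by (intro times_differentiable_mult times_differentiable_const times_differentiable_sqrt
      times_differentiable_diff times_differentiable_power times_differentiable_wave)
qed

end

section \<open>Curvature and closing of the standard curves\<close>

context wave_flow
begin

lemma mu_pos: "0 < mu lam xi t" unfolding mu_wave by (rule facts(8))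

lemma DERIV_mu: "(mu lam xi has_real_derivative deriv (mu lam xi) t) (at t)"
  and deriv_mu_sq: "(deriv (mu lam xi) t)^2 = - ((mu lam xi t)^2 * Q lam xi (mu lam xi t))"
  using mu_normalized by (auto simp: normalized_solution_def solves_Q_equation_def)

lemmas DERIV_deriv_mu = normalized_solution_second_order[OF mu_normalized]

text \<open>Level sets of \<open>mu\<close> have empty interior, because the acceleration does not vanish at turning points.\<close>

lemma zero_off_level:
  fixes F :: "real \<Rightarrow> real"
  assumes cont: "\<And>t. isCont F t" and zero: "\<And>t. mu lam xi t \<noteq> c \<Longrightarrow> F t = 0"
  shows "F t = 0"
proof (rule ccontr)
  assume "F t \<noteq> 0"
  then have "\<forall>\<^sub>F z in nhds t. F z \<noteq> 0"
    using cont[of t] by (intro tendsto_imp_eventually_ne[of F "F t"]) (simp_all add: isCont_def tendsto_at_iff_tendsto_nhds)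
  then have c: "\<forall>\<^sub>F z in nhds t. mu lam xi z = c" by (rule eventually_mono) (use zero in auto)
  then have "\<forall>\<^sub>F z in nhds t. \<forall>\<^sub>F x in nhds z. mu lam xi x = c" by (simp add: eventually_eventually)
  then have d: "\<forall>\<^sub>F z in nhds t. deriv (mu lam xi) z = 0"
  proof (rule eventually_mono)
    fix z assume "\<forall>\<^sub>F x in nhds z. mu lam xi x = c"
    then have "(mu lam xi has_real_derivative 0) (at z)" by (rule DERIV_cong_ev[THEN iffD2, OF refl _ refl]) auto
    then show "deriv (mu lam xi) z = 0" by (rule DERIV_imp_deriv)
  qed
  then have "(deriv (mu lam xi) has_real_derivative 0) (at t)" by (rule DERIV_cong_ev[THEN iffD2, OF refl _ refl]) auto
  then have h: "half_force lam xi (mu lam xi t) = 0" by (rule DERIV_unique[OF DERIV_deriv_mu])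
  have "deriv (mu lam xi) t = 0" using d by (rule eventually_nhds_x_imp_x)
  then have "Q lam xi (mu lam xi t) = 0" using deriv_mu_sq[of t] mu_pos[of t] by auto
  then show False using half_force_root h mu_pos pos_roots by blast
qed

definition curve :: "real \<Rightarrow> real^3" where
  "curve t = vector [1/(2*xi*mu lam xi t), - (radial t/(2*xi*mu lam xi t) * cos (theta lam xi t)),
     radial t/(2*xi*mu lam xi t) * sin (theta lam xi t)]"

lemma gamma_curve_eq: "gamma_curve lam xi = curve"
proof
  fix t
  have "(1/(2*xi*mu lam xi t)) *\<^sub>R vector [1, - radial t * cos (theta lam xi t), radial t * sin (theta lam xi t)] = curve t"
    unfolding curve_def by (simp add: vec_eq_iff forall_3)
  then show "gamma_curve lam xi t = curve t"
    unfolding gamma_curve_def Let_def radial_def .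
qed

text \<open>The first coordinate \<open>g\<close> decides everything: \<open>g'' + g\<close> is the
  first component of the covariant acceleration, \<open>- rho^2 * th' = (W + 2*lam)/(2*xi)\<close>
  that of the normal, and their quotient is \<open>W^2\<close>. Division by zero at
  \<open>W = - 2*lam\<close> is bypassed by \<open>zero_off_level\<close>.\<close>

lemma curve_B_curve: "B_curve lam curve"
proof -
  define W where "W = mu lam xi"
  define W' where "W' = deriv W"
  define g where "g t = 1/(2*xi*W t)" for t
  define rho where "rho t = radial t/(2*xi*W t)" for t
  define th where "th = theta lam xi"
  have W0: "0 < W t" for t unfolding W_def by (rule mu_pos)
  have Wn: "2*xi*W t \<noteq> 0" for t using W0[of t] xi_pos by simp
  have tdW: "times_differentiable k W" for k unfolding W_def mu_wave by (rule times_differentiable_wave)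
  have tdg: "times_differentiable k g" for k unfolding g_def[abs_def]
    by (rule times_differentiable_divide) (use tdW Wn in auto)
  have tdr: "times_differentiable k rho" for k unfolding rho_def[abs_def]
    by (rule times_differentiable_divide) (use tdW times_differentiable_radial Wn in auto)
  have tdt: "times_differentiable k th" for k unfolding th_def by (rule times_differentiable_theta)
  have c: "curve = (\<lambda>t. vector [g t, - (rho t * cos (th t)), rho t * sin (th t)])"
    unfolding curve_def[abs_def] g_def rho_def th_def W_def ..
  have tdc: "times_differentiable k curve" for k unfolding c
    by (intro times_differentiable_vector_3 times_differentiable_uminus times_differentiable_mult
        times_differentiable_cos times_differentiable_sin tdg tdr tdt)
  have dW: "(W has_real_derivative W' t) (at t)" "(W' has_real_derivative half_force lam xi (W t)) (at t)" for t
    unfolding W_def W'_def by (rule DERIV_mu DERIV_deriv_mu)+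
  have W'2: "(W' t)^2 = - ((W t)^2 * Q lam xi (W t))" for t unfolding W_def W'_def by (rule deriv_mu_sq)
  define g' where "g' t = - W' t/(2*xi*(W t)^2)" for t
  have dg: "(g has_real_derivative g' t) (at t)" for t
    unfolding g_def[abs_def] g'_def using W0[of t] xi_pos
    by (auto intro!: derivative_eq_intros dW simp: power2_eq_square)
  define g'' where "g'' t = (2*(W' t)^2/(W t)^3 - half_force lam xi (W t)/(W t)^2)/(2*xi)" for t
  have dg': "(g' has_real_derivative g'' t) (at t)" for t
  proof -
    have "(g' has_real_derivative ((- half_force lam xi (W t)) * (2*xi*(W t)^2) - (- W' t) * (2*xi*(2 * W t * W' t))) 
        / ((2*xi*(W t)^2)*(2*xi*(W t)^2))) (at t)"
      unfolding g'_def[abs_def] using W0[of t] xi_pos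
      by (intro DERIV_divide DERIV_minus dW DERIV_cmult) (auto intro!: derivative_eq_intros dW)
    then show ?thesis
      by (rule DERIV_cong) (use W0[of t] xi_pos in \<open>simp add: g''_def field_simps eval_nat_numeral\<close>)
  qed
  have gW: "g t * W t = 1/(2*xi)" for t unfolding g_def using W0[of t] by simp
  have g2: "g'' t + g t = (W t)^2 * (W t + 2*lam)/(2*xi)" for t
  proof -
    have "(2*xi*(W t)^3)*(g'' t + g t) = 2*(W' t)^2 - half_force lam xi (W t) * W t + (W t)^2"
      unfolding g''_def g_def using W0[of t] xi_pos by (simp add: field_simps eval_nat_numeral)
    also have "\<dots> = (2*xi*(W t)^3)*((W t)^2 * (W t + 2*lam)/(2*xi))"
      unfolding W'2 Q_def half_force_def using xi_pos by (simp add: field_simps) algebra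
    finally have "(2*xi*(W t)^3)*(g'' t + g t) = (2*xi*(W t)^3)*((W t)^2 * (W t + 2*lam)/(2*xi))" .
    moreover have "2*xi*(W t)^3 \<noteq> 0" using W0[of t] xi_pos by simp
    ultimately show ?thesis using mult_left_cancel by blast
  qed
  obtain rho' where dr: "\<And>t. (rho has_real_derivative rho' t) (at t)" and tdr': "\<And>k. times_differentiable k rho'"
    using times_differentiable_obtain_real[OF tdr] by metis
  define th' where "th' t = 2*xi*rate (phi t)" for t
  have dt: "(th has_real_derivative th' t) (at t)" for t unfolding th_def th'_def by (rule theta_properties)
  have tdt': "times_differentiable k th'" for k unfolding th'_def[abs_def]
    by (intro times_differentiable_mult times_differentiable_const times_differentiable_rate)
  define v where "v t = (vector [g' t, - (rho' t * cos (th t) - rho t * (sin (th t) * th' t)),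
     rho' t * sin (th t) + rho t * (cos (th t) * th' t)] :: real^3)" for t
  have dcos: "((\<lambda>t. cos (th t)) has_real_derivative - sin (th t) * th' t) (at t)"
    and dsin: "((\<lambda>t. sin (th t)) has_real_derivative cos (th t) * th' t) (at t)" for t
    by (rule DERIV_chain2[OF DERIV_cos dt] DERIV_chain2[OF DERIV_sin dt])+
  have dc: "(curve has_vector_derivative v t) (at t)" for t unfolding c v_def
    by (rule has_vector_derivative_vector_3[OF dg]; rule DERIV_cong) 
      (rule DERIV_minus DERIV_mult' dr dcos dsin | simp)+
  have rho2: "(rho t)^2 = 1 - (g t)^2" for t
  proof -
    have "(radial t)^2 = 4*xi^2*(W t)^2 - 1" using radial_sq[of t] unfolding gap_def W_def mu_wave .
    then show ?thesis unfolding rho_def g_def power_divide using W0[of t] xi_pos by (simp add: power_mult_distrib diff_divide_distrib)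
  qed
  have rt: "(rho t)^2 * th' t = - ((W t + 2*lam)/(2*xi))" for t
  proof -
    have "gap (phi t) * rate (phi t) = - ((W t)^2 * height (phi t))"
    proof (cases "gap (phi t) = 0")
      case True
      then have "height (phi t) = 0" using degenerate(1) by (auto simp: gap_zero_iff height_def)
      then show ?thesis using True by simp
    qed (simp add: rate_eq W_def mu_wave)
    then have "(radial t)^2 * th' t = - (2*xi*(W t)^2 * (W t + 2*lam))"
      unfolding radial_sq th'_def by (simp add: height_def W_def mu_wave)
    then show ?thesis unfolding rho_def power_divide using W0[of t] xi_pos
      by (simp add: power_mult_distrib field_simps eval_nat_numeral)
  qed
  have cc: "curve t \<bullet> curve t = 1" for t
  proof -
    have "curve t \<bullet> curve t = g t * g t + (rho t * cos (th t)) * (rho t * cos (th t)) + (rho t * sin (th t)) * (rho t * sin (th t))"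
      unfolding c inner_vec_def sum_3 by simp
    also have "\<dots> = (g t)^2 + (rho t)^2" using sin_cos_squared_add[of "th t"] by algebra
    finally show ?thesis unfolding rho2 by simp
  qed
  have vv0: "v t \<bullet> v t = (g' t)^2 + (rho' t)^2 + (rho t)^2 * (th' t)^2" for t
  proof -
    have "v t \<bullet> v t = g' t * g' t + (rho' t * cos (th t) - rho t * (sin (th t) * th' t)) * (rho' t * cos (th t) - rho t * (sin (th t) * th' t))
      + (rho' t * sin (th t) + rho t * (cos (th t) * th' t)) * (rho' t * sin (th t) + rho t * (cos (th t) * th' t))"
      unfolding v_def inner_vec_def sum_3 by (simp add: algebra_simps)
    also have "\<dots> = (g' t)^2 + (rho' t)^2 + (rho t)^2 * (th' t)^2" using sin_cos_squared_add[of "th t"] by algebra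
    finally show ?thesis .
  qed
  have rr': "rho t * rho' t = - (g t * g' t)" for t
  proof -
    have "((\<lambda>t. (rho t)^2) has_real_derivative 2 * rho t * rho' t) (at t)" by (auto intro!: derivative_eq_intros dr)
    moreover have "((\<lambda>t. 1 - (g t)^2) has_real_derivative - (2 * g t * g' t)) (at t)" by (auto intro!: derivative_eq_intros dg)
    ultimately have "2 * rho t * rho' t = - (2 * g t * g' t)" unfolding rho2 by (rule DERIV_unique)
    then show ?thesis by (simp add: mult.commute)
  qed
  \<comment> \<open>\<open>rho'\<close> is known only through \<open>rho * rho' = - g * g'\<close>,
    so the squared speed is computed after multiplication by \<open>rho^2\<close>.\<close>
  have vv_off: "v t \<bullet> v t - 1 = 0" if "W t \<noteq> - 2*lam" for t
  proof -
    have "rho t \<noteq> 0"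
    proof
      assume "rho t = 0"
      then have "(W t + 2*lam)/(2*xi) = 0" using rt[of t] by simp
      then show False using that xi_pos by auto
    qed
    then have r0: "(rho t)^2 \<noteq> 0" by simp
    have "(rho t)^2 * (v t \<bullet> v t) = (rho t)^2 * (g' t)^2 + (rho t * rho' t)^2 + ((rho t)^2 * th' t)^2"
      unfolding vv0 by algebra
    also have "\<dots> = (g' t)^2 + ((W t + 2*lam)/(2*xi))^2" unfolding rr' rt unfolding rho2 by (simp add: power2_eq_square algebra_simps)
    also have "\<dots> = 1 - (g t)^2"
    proof -
      have "(4*xi^2*(W t)^2)*((g' t)^2 + ((W t + 2*lam)/(2*xi))^2) = (W' t)^2/(W t)^2 + (W t)^2*(W t + 2*lam)^2"
        unfolding g'_def using W0[of t] xi_pos by (simp add: field_simps eval_nat_numeral)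
      also have "(W' t)^2/(W t)^2 = - Q lam xi (W t)" unfolding W'2 using W0[of t] by simp
      also have "- Q lam xi (W t) + (W t)^2*(W t + 2*lam)^2 = 4*xi^2*(W t)^2 - 1" unfolding Q_eq by (simp add: algebra_simps)
      also have "\<dots> = (4*xi^2*(W t)^2) * (1 - (g t)^2)" unfolding g_def using W0[of t] xi_pos
        by (simp add: power_divide power_mult_distrib right_diff_distrib)
      finally show ?thesis using W0[of t] xi_pos by simp
    qed
    finally show ?thesis unfolding rho2[symmetric] using r0 by simp
  qed
  have cont: "isCont f t" if "\<And>k. times_differentiable k f" for f :: "real \<Rightarrow> real" and t
    using times_differentiable_obtain_real[OF that] DERIV_isCont by metis
  have tdW': "times_differentiable k W'" for k
  proof -
    obtain W1 where "\<And>t. (W has_real_derivative W1 t) (at t)" "\<And>k. times_differentiable k W1"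
      using times_differentiable_obtain_real[OF tdW] by metis
    moreover have "W1 = W'" using calculation(1) dW(1) DERIV_unique by blast
    ultimately show ?thesis by simp
  qed
  have tdg': "times_differentiable k g'" for k unfolding g'_def[abs_def]
    by (intro times_differentiable_divide times_differentiable_uminus times_differentiable_mult times_differentiable_power
        times_differentiable_const tdW tdW') (use W0 xi_pos in \<open>auto simp: less_imp_neq[symmetric]\<close>)
  have vv: "v t \<bullet> v t = 1" for t
  proof -
    have "v t \<bullet> v t - 1 = 0"
    proof (rule zero_off_level[where c = "- 2*lam" and F = "\<lambda>t. v t \<bullet> v t - 1"])
      show "isCont (\<lambda>t. v t \<bullet> v t - 1) t" for t unfolding vv0
        by (intro cont times_differentiable_diff times_differentiable_add times_differentiable_mult times_differentiable_power
            times_differentiable_const tdg' tdr tdr' tdt')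
      show "v t \<bullet> v t - 1 = 0" if "mu lam xi t \<noteq> - 2*lam" for t using vv_off that unfolding W_def by blast
    qed
    then show ?thesis by simp
  qed
  obtain a where da: "\<And>t. (v has_vector_derivative a t) (at t)" and tda: "\<And>k. times_differentiable k a"
  proof -
    obtain v1 where v1: "\<And>t. (curve has_vector_derivative v1 t) (at t)" "\<And>k. times_differentiable k v1"
      using times_differentiable_obtain[OF tdc] by metis
    have "v1 = v" using v1(1) dc vector_derivative_unique_at by blast
    then show ?thesis using times_differentiable_obtain[OF v1(2)] that by metis
  qed
  note cov = covariant_acceleration_unit_speed[OF dc da cc vv]
  have vel: "velocity curve t = v t" for t unfolding velocity_def using dc by (rule vector_derivative_at)
  have n1: "cross3 (curve t) (v t) $ 1 = (W t + 2*lam)/(2*xi)" for t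
  proof -
    have "cross3 (curve t) (v t) $ 1 = - (rho t * cos (th t)) * (rho' t * sin (th t) + rho t * (cos (th t) * th' t))
      + rho t * sin (th t) * (rho' t * cos (th t) - rho t * (sin (th t) * th' t))"
      unfolding c v_def cross3_def by (simp add: algebra_simps)
    also have "\<dots> = - ((rho t)^2 * th' t)" using sin_cos_squared_add[of "th t"] by algebra
    finally show ?thesis unfolding rt by simp
  qed
  define k where "k t = a t \<bullet> cross3 (curve t) (v t)" for t
  have kW: "k t = (W t)^2" for t
  proof -
    have "k t - (W t)^2 = 0"
    proof (rule zero_off_level[where c = "- 2*lam" and F = "\<lambda>t. k t - (W t)^2"])
      fix t
      have "isCont a t" "isCont curve t" "isCont v t"
        using times_differentiable_obtain[OF tda] has_vector_derivative_continuous dc da by metis+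
      then show "isCont (\<lambda>t. k t - (W t)^2) t" unfolding k_def
        using DERIV_isCont[OF dW(1)] by (intro continuous_intros continuous_cross)
    next
      fix t assume "mu lam xi t \<noteq> - 2*lam"
      then have Y: "W t + 2*lam \<noteq> 0" by (simp add: W_def)
      have "a t $ 1 = g'' t"
      proof -
        have "((\<lambda>t. v t $ 1) has_real_derivative a t $ 1) (at t)" by (rule DERIV_component[OF da])
        then have "(g' has_real_derivative a t $ 1) (at t)" unfolding v_def by simp
        then show ?thesis using dg' DERIV_unique by blast
      qed
      then have "(a t + curve t) $ 1 = (W t)^2 * (W t + 2*lam)/(2*xi)"
        using g2[of t] unfolding c by simp
      moreover have "(a t + curve t) $ 1 = k t * ((W t + 2*lam)/(2*xi))"
        unfolding cov(2)[symmetric] cov(1) k_def[symmetric] by (simp add: n1)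
      ultimately have "k t * ((W t + 2*lam)/(2*xi)) = (W t)^2 * ((W t + 2*lam)/(2*xi))" by (metis times_divide_eq_right)
      moreover have "(W t + 2*lam)/(2*xi) \<noteq> 0" using Y xi_pos by simp
      ultimately show "k t - (W t)^2 = 0" using mult_right_cancel by (metis diff_self)
    qed
    then show ?thesis by simp
  qed
  have "arclength_curve_in_sphere curve" unfolding arclength_curve_in_sphere_def vel
    using smoothI[OF tdc] cc vv by (auto simp: norm_eq_sqrt_inner)
  moreover have "has_geodesic_curvature curve (\<lambda>t. (W t)^2)"
    unfolding has_geodesic_curvature_def unit_normal_def vel cov(1) k_def[symmetric] kW by simp
  moreover have "\<forall>t. 0 < (W t)^2" using W0 by (simp add: less_imp_neq[symmetric])
  moreover have "\<not> (\<lambda>t. (W t)^2) constant_on UNIV"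
  proof
    assume "(\<lambda>t. (W t)^2) constant_on UNIV"
    then obtain d where "(W t)^2 = d" for t by (auto simp: constant_on_def)
    then have "W t = sqrt d" for t using W0[of t] by (metis less_imp_le real_sqrt_unique)
    then have "W constant_on UNIV" by (auto simp: constant_on_def)
    then show False using mu_normalized unfolding W_def normalized_solution_def by blast
  qed
  moreover have "periodic (\<lambda>t. (W t)^2)"
  proof -
    have "W (t + omega lam xi) = W t" for t unfolding W_def mu_wave phi_shift by (simp add: wave_def)
    then show ?thesis unfolding periodic_def using omega_pos by auto
  qed
  moreover have "solves_Q_equation lam xi (\<lambda>t. sqrt ((W t)^2))"
  proof -
    have "(\<lambda>t. sqrt ((W t)^2)) = mu lam xi" using W0 by (auto simp: W_def less_imp_le)
    then show ?thesis using mu_normalized by (simp add: normalized_solution_def)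
  qed
  ultimately show ?thesis unfolding B_curve_def using xi_pos by blast
qed

text \<open>The period found is \<open>2*n*omega\<close>, not \<open>n*omega\<close>: in the
  degenerate case \<open>Psi_hat - Psi\<close> is only \<open>pi\<close> and \<open>radial\<close>
  changes sign after one \<open>omega\<close>. An even number of periods cures both.\<close>

lemma curve_periodic:
  assumes "Psi_hat lam xi = 2 * pi * of_rat q"
  shows "periodic curve"
proof -
  obtain m n where q: "quotient_of q = (m, n)" by fastforce
  have n: "0 < n" using quotient_of_denom_pos[OF q] .
  have "(of_rat q :: real) = of_int m / of_int n" using quotient_of_div[OF q] by (simp add: of_rat_divide)
  then have nq: "of_int n * Psi_hat lam xi = 2*pi* of_int m" unfolding assms using n by simp
  have shift: "theta lam xi (t + of_int j * omega lam xi) = theta lam xi t + of_int j * Psi lam xi" for t j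
  proof (induction j rule: int_induct[where k = 0])
    case base show ?case by simp
  next
    case (step1 i)
    then show ?case using theta_properties(2)[of "t + of_int i * omega lam xi"] by (simp add: algebra_simps)
  next
    case (step2 i)
    then show ?case using theta_properties(2)[of "t + of_int (i - 1) * omega lam xi"] by (simp add: algebra_simps)
  qed
  obtain j :: int where j: "of_int (2*n) * Psi lam xi = (2*pi) * of_int j"
  proof -
    have "of_int (2*n) * Psi_hat lam xi = (2*pi) * of_int (2*m)" using nq by simp
    then have "\<exists>j :: int. of_int (2*n) * Psi lam xi = (2*pi) * of_int j"
      unfolding Psi_hat_def
      \<comment> \<open>The witnesses subtract \<open>2*n\<close> times the correction
        \<open>2*pi\<close>, \<open>pi\<close> or \<open>0\<close>, measured in units of
        \<open>2*pi\<close>.\<close>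
      by (auto split: if_splits simp: algebra_simps intro: exI[of _ "2*m - 2*n"] exI[of _ "2*m - n"] exI[of _ "2*m"])
    then show ?thesis using that by blast
  qed
  define P where "P = of_int (2*n) * omega lam xi"
  have P: "0 < P" unfolding P_def using n omega_pos by simp
  have th: "theta lam xi (t + P) = theta lam xi t + (2*pi) * of_int j" for t unfolding P_def shift j ..
  have ph: "phi (t + P) = phi t + (2*pi) * of_int (2*n)" for t unfolding P_def phi_shift_int by simp
  have W: "wave lam y (phi (t + P)) = wave lam y (phi t)" for t
    unfolding ph wave_def cos_add cos_int_2pin sin_int_2pin by simp
  have R: "radial (t + P) = radial t" for t
  proof (cases "4*lam*xi + 1 = 0")
    case True
    have e: "phi (t + P)/2 = phi t/2 + (2*pi) * of_int n" unfolding ph by simp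
    have "sin (phi (t + P)/2) = sin (phi t/2)" unfolding e sin_add cos_int_2pin sin_int_2pin by simp
    then show ?thesis unfolding radial_degenerate[OF True] W by simp
  qed (simp add: radial_nondegenerate gap_def W)
  have "curve (t + P) = curve t" for t
    unfolding curve_def mu_wave W R th cos_add sin_add cos_int_2pin sin_int_2pin by simp
  then show ?thesis unfolding periodic_def using P by blast
qed

end

theorem theorem1p2:
  fixes lam :: real
  shows "\<exists>I::real set.
    Psi_hat lam ` {eta_hat lam<..} = I \<and> open I \<and> is_interval I \<and> I \<noteq> {} \<and>
    (\<forall>q::rat. 2 * pi * of_rat q \<in> I \<longrightarrow>
      (\<forall>\<xi>>eta_hat lam. Psi_hat lam \<xi> = 2 * pi * of_rat q \<longrightarrow>
        B_string lam (gamma_curve lam \<xi>) \<and>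
        has_characteristic_number lam (gamma_curve lam \<xi>) q))"
proof (intro exI conjI allI impI)
  show "Psi_hat lam ` {eta_hat lam<..} = (\<lambda>y. 2*pi - Hfun lam y) ` admissible lam"
    by (rule Psi_hat_image)
  show "open ((\<lambda>y. 2*pi - Hfun lam y) ` admissible lam)" "is_interval ((\<lambda>y. 2*pi - Hfun lam y) ` admissible lam)"
    by (rule Hfun_image)+
  show "(\<lambda>y. 2*pi - Hfun lam y) ` admissible lam \<noteq> {}" using admissible_nonempty by blast
  fix q \<xi> assume xi: "eta_hat lam < \<xi>" "Psi_hat lam \<xi> = 2 * pi * of_rat q"
  from wave_data_of_xi[OF xi(1)] obtain y where "wave_data lam \<xi> y" by blast
  from wave_data.wave_flow_exists[OF this] obtain phi where w: "wave_flow lam \<xi> y phi" by blast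
  show "B_string lam (gamma_curve lam \<xi>)" unfolding B_string_def wave_flow.gamma_curve_eq[OF w]
    using wave_flow.curve_B_curve[OF w] wave_flow.curve_periodic[OF w xi(2)] by blast
  show "has_characteristic_number lam (gamma_curve lam \<xi>) q"
    unfolding has_characteristic_number_def using xi by blast
qed

end
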